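(* Let $\Gamma\subset\mathrm{PSL}_2(\mathbb R)$ be a Fuchsian group of the first kind with at least one cusp and let $V$ be a vertex operator algebra of CFT-type. Then the explicit map $$P=\exp\Big(-\frac{2\pi i}{12}E_2^\Gamma\otimes L(1)\Big),\qquad P(f\otimes v)=\sum_{r\ge0}\frac1{r!}\Big(-\frac{2\pi i}{12}\Big)^r(E_2^\Gamma)^r f\,L(1)^rv,$$ restricts to a weight-preserving $M(\Gamma)$-linear isomorphism $$P:M(\Gamma)\otimes V^{(2)}\xrightarrow{\ \sim\ }M(V,\Gamma),$$ and consequently, for every even $k\ge0$, $$\dim M_k(V,\Gamma)=\sum_{i=0}^{k/2}\dim M_{2i}(\Gamma)\,\dim V_{k/2-i}.$$
   Context: A VOA $V=\bigoplus_nV_n$ has Virasoro modes $L(n)$, with $L(0)=n$ on $V_n$; CFT-type means $V_n=0$ for $n<0$ and $V_0=\mathbb C\mathbf 1$. $F_NV=\bigoplus_{n\le N}V_n$; $V^{(2)}$ is $V$ with doubled grading $V^{(2)}_{2n}=V_n$. A Fuchsian group of the first kind is a finitely generated discrete subgroup of $\mathrm{PSL}_2(\mathbb R)$ of finite covolume; elements of $\Gamma$ are lifted to $\mathrm{SL}_2(\mathbb R)$ (full preimage). For $\gamma=\begin{pmatrix}a&b\\c&d\end{pmatrix}$: $j(\gamma,\tau)=c\tau+d$, $X(\gamma,\tau)=c/j(\gamma,\tau)$, $f|_k\gamma(\tau)=j(\gamma,\tau)^{-k}f(\gamma\tau)$, $K(\gamma,\tau)=e^{-c\,j(\gamma,\tau)L(1)}j(\gamma,\tau)^{-2L(0)}$,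 $f\Vert_k\gamma(\tau)=j(\gamma,\tau)^{-k}K(\gamma,\tau)^{-1}f(\gamma\tau)$. At a cusp $s=\sigma\infty$ ($\sigma\in\mathrm{SL}_2(\mathbb R)$), the stabilizer of $\infty$ in $\sigma^{-1}\Gamma\sigma$ is generated up to sign by $\tau\mapsto\tau+\lambda$, and $q_\lambda=e^{2\pi i\tau/\lambda}$. $M_k(\Gamma)$: holomorphic $f:\mathbb H\to\mathbb C$ with $f|_k\gamma=f$ for all $\gamma\in\Gamma$ and $f|_k\sigma\in\mathbb C[[q_\lambda]]$ at every cusp; $M(\Gamma)=\bigoplus_kM_k(\Gamma)$. $M_k(V,\Gamma)$: holomorphic $f:\mathbb H\to F_NV$ (some $N$) with $f\Vert_k\gamma=f$ for all $\gamma\in\Gamma$, $f\Vert_k\sigma\in F_NV[[q_\lambda]]$ at every cusp, and $f(\tau_i)$ fixed by $j(\gamma_i,\tau_i)^kK(\gamma_i,\tau_i)$ at every elliptic point $\tau_i$ with stabilizer generator $\gamma_i$; $M(V,\Gamma)=\bigoplus_kM_k(V,\Gamma)$. $E_2^\Gamma:\mathbb H\to\mathbb C$ is a fixed holomorphic function, holomorphic at the cusps ($E_2^\Gamma|_2\sigma$ bounded as $\mathrm{Im}\,\tau\to\infty$, uniformly for $\mathrm{Re}\,\tau$ in compact sets, for every $\sigma\in\mathrm{SL}_2(\mathbb R)$ with $\sigma\infty$ a cusp), with $E_2^\Gamma|_2\gamma=E_2^\Gamma+\frac{12}{2\pi i}X(\gamma,\tau)$ for all $\gamma\in\Gamma$;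 it exists because $\Gamma$ has a cusp. Elements $f\otimes v$ are identified with the functions $\tau\mapsto f(\tau)v$. *)

theory Defs
  imports
    "HOL-Complex_Analysis.Complex_Analysis"
    "HOL-Algebra.Generated_Groups"
    "HOL-Library.Function_Algebras"
    "HOL-Library.Groups_Big_Fun"
    "HOL-Library.Extended_Nat"
begin

section \<open>Linear algebra\<close>

definition pointwise :: "('c \<Rightarrow> 'v \<Rightarrow> 'v) \<Rightarrow> 'c \<Rightarrow> ('x \<Rightarrow> 'v) \<Rightarrow> 'x \<Rightarrow> 'v" where
  "pointwise s c f = (\<lambda>x. s c (f x))"

text \<open>Dimension of a subspace with value \<open>\<infinity>\<close> for infinite-dimensional ones
  (the library's \<open>dim\<close> is a natural number, with junk value 0 in that case).\<close>

definition edim :: "('a::field \<Rightarrow> 'b::ab_group_add \<Rightarrow> 'b) \<Rightarrow> 'b set \<Rightarrow> enat" where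
  "edim s S = (if \<exists>B. finite B \<and> module.span s B = S then enat (vector_space.dim s S) else \<infinity>)"

text \<open>The external direct sum of a family of spaces, its elements being the finitely
  supported families.\<close>

definition direct_sum :: "(int \<Rightarrow> 'b::zero set) \<Rightarrow> (int \<Rightarrow> 'b) set" where
  "direct_sum A = {F. (\<forall>k. F k \<in> A k) \<and> finite {k. F k \<noteq> 0}}"

definition homogeneous_part :: "int \<Rightarrow> (int \<Rightarrow> 'b::zero) set \<Rightarrow> (int \<Rightarrow> 'b) set" where
  "homogeneous_part k S = {F \<in> S. \<forall>l. l \<noteq> k \<longrightarrow> F l = 0}"


section \<open>Fuchsian groups\<close>

definition uhp :: "complex set" where
  "uhp = {\<tau>. Im \<tau> > 0}"

definition SL2R :: "(real^2^2) set" where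
  "SL2R = {\<gamma>. det \<gamma> = 1}"

definition SL2R_group :: "(real^2^2) monoid" where
  "SL2R_group = \<lparr>carrier = SL2R, monoid.mult = (**), one = mat 1\<rparr>"

definition moeb :: "real^2^2 \<Rightarrow> complex \<Rightarrow> complex" where
  "moeb \<gamma> \<tau> = (of_real (\<gamma>$1$1) * \<tau> + of_real (\<gamma>$1$2)) / (of_real (\<gamma>$2$1) * \<tau> + of_real (\<gamma>$2$2))"

definition jfac :: "real^2^2 \<Rightarrow> complex \<Rightarrow> complex" where
  "jfac \<gamma> \<tau> = of_real (\<gamma>$2$1) * \<tau> + of_real (\<gamma>$2$2)"

definition Xfac :: "real^2^2 \<Rightarrow> complex \<Rightarrow> complex" where
  "Xfac \<gamma> \<tau> = of_real (\<gamma>$2$1) / jfac \<gamma> \<tau>"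

definition fundamental_domain :: "(real^2^2) set \<Rightarrow> complex set \<Rightarrow> bool" where
  "fundamental_domain \<Gamma> D \<longleftrightarrow>
     D \<in> sets borel \<and> D \<subseteq> uhp \<and> (\<Union>\<gamma>\<in>\<Gamma>. moeb \<gamma> ` D) = uhp \<and>
     (\<forall>\<gamma>\<in>\<Gamma>. \<gamma> \<noteq> mat 1 \<longrightarrow> \<gamma> \<noteq> - mat 1 \<longrightarrow> D \<inter> moeb \<gamma> ` D \<in> null_sets lborel)"

text \<open>A subgroup of \<open>PSL\<^sub>2(\<real>)\<close> is represented by its full preimage in \<open>SL\<^sub>2(\<real>)\<close>,
  that is, by a subgroup containing \<open>-1\<close>. As the kernel is finite, discreteness and finite
  generation may be read off the preimage. The area form is \<open>dx dy / y\<^sup>2\<close>.\<close>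

definition fuchsian_first_kind :: "(real^2^2) set \<Rightarrow> bool" where
  "fuchsian_first_kind \<Gamma> \<longleftrightarrow>
     subgroup \<Gamma> SL2R_group \<and> - mat 1 \<in> \<Gamma> \<and> discrete \<Gamma> \<and>
     (\<exists>S. finite S \<and> S \<subseteq> SL2R \<and> generate SL2R_group S = \<Gamma>) \<and>
     (\<exists>D. fundamental_domain \<Gamma> D \<and> (\<integral>\<^sup>+\<tau>\<in>D. ennreal (1 / (Im \<tau>)\<^sup>2) \<partial>lborel) < \<infinity>)"

definition parabolic :: "real^2^2 \<Rightarrow> bool" where
  "parabolic \<gamma> \<longleftrightarrow> \<gamma> \<in> SL2R \<and> \<gamma> \<noteq> mat 1 \<and> \<gamma> \<noteq> - mat 1 \<and> \<bar>trace \<gamma>\<bar> = 2"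

definition conj_by :: "real^2^2 \<Rightarrow> real^2^2 \<Rightarrow> real^2^2" where
  "conj_by \<sigma> \<gamma> = matrix_inv \<sigma> ** \<gamma> ** \<sigma>"

text \<open>Every point of \<open>\<real> \<union> {\<infinity>}\<close> is of the form \<open>\<sigma>\<infinity>\<close>, and \<open>\<gamma>\<close> fixes
  \<open>\<sigma>\<infinity>\<close> iff \<open>\<sigma>\<inverse>\<gamma>\<sigma>\<close> fixes \<open>\<infinity>\<close>, i.e. is upper triangular. So boundary
  points are represented by \<open>\<sigma>\<close>; the next predicate says that \<open>\<sigma>\<infinity>\<close> is a cusp of \<open>\<Gamma>\<close>,
  i.e. is fixed by a parabolic element of \<open>\<Gamma>\<close>.\<close>

definition cusp_at :: "(real^2^2) set \<Rightarrow> real^2^2 \<Rightarrow> bool" where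
  "cusp_at \<Gamma> \<sigma> \<longleftrightarrow> \<sigma> \<in> SL2R \<and> (\<exists>\<gamma>\<in>\<Gamma>. parabolic \<gamma> \<and> conj_by \<sigma> \<gamma> $2$1 = 0)"

definition translation :: "real \<Rightarrow> real^2^2" where
  "translation t = vector [vector [1, t], vector [0, 1]]"

text \<open>The stabilizer of \<open>\<infinity>\<close> in \<open>\<sigma>\<inverse>\<Gamma>\<sigma>\<close> is generated, up to sign, by
  \<open>\<tau> \<mapsto> \<tau> + h\<close>.\<close>

definition cusp_width :: "(real^2^2) set \<Rightarrow> real^2^2 \<Rightarrow> real \<Rightarrow> bool" where
  "cusp_width \<Gamma> \<sigma> h \<longleftrightarrow> h > 0 \<and>
     {\<delta> \<in> conj_by \<sigma> ` \<Gamma>. \<delta>$2$1 = 0} =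
       {\<delta>. \<exists>n::int. \<delta> = translation (of_int n * h) \<or> \<delta> = - translation (of_int n * h)}"

definition qpar :: "real \<Rightarrow> complex \<Rightarrow> complex" where
  "qpar h \<tau> = exp (2 * of_real pi * \<i> * \<tau> / of_real h)"

text \<open>\<open>\<tau>\<close> is an elliptic point and \<open>\<gamma>\<close> generates its stabilizer modulo \<open>\<plusminus>1\<close>.\<close>

definition elliptic_with_generator :: "(real^2^2) set \<Rightarrow> complex \<Rightarrow> real^2^2 \<Rightarrow> bool" where
  "elliptic_with_generator \<Gamma> \<tau> \<gamma> \<longleftrightarrow> \<tau> \<in> uhp \<and>
     {\<delta>\<in>\<Gamma>. moeb \<delta> \<tau> = \<tau>} \<noteq> {mat 1, - mat 1} \<and>
     generate SL2R_group {\<gamma>, - mat 1} = {\<delta>\<in>\<Gamma>. moeb \<delta> \<tau> = \<tau>}"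


section \<open>Scalar modular forms\<close>

definition slash :: "int \<Rightarrow> real^2^2 \<Rightarrow> (complex \<Rightarrow> complex) \<Rightarrow> complex \<Rightarrow> complex" where
  "slash k \<gamma> f \<tau> = jfac \<gamma> \<tau> powi (- k) * f (moeb \<gamma> \<tau>)"

text \<open>A function on the upper half-plane is represented by its extension by 0 to the whole
  plane, so that equality, and hence the dimension of spaces of functions, is the right one.\<close>

definition modular_forms :: "(real^2^2) set \<Rightarrow> int \<Rightarrow> (complex \<Rightarrow> complex) set" where
  "modular_forms \<Gamma> k = {f.
     (\<forall>\<tau>. \<tau> \<notin> uhp \<longrightarrow> f \<tau> = 0) \<and>
     f holomorphic_on uhp \<and>
     (\<forall>\<gamma>\<in>\<Gamma>. \<forall>\<tau>\<in>uhp. slash k \<gamma> f \<tau> = f \<tau>) \<and>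
     (\<forall>\<sigma> h. cusp_at \<Gamma> \<sigma> \<and> cusp_width \<Gamma> \<sigma> h \<longrightarrow>
        (\<exists>a::nat \<Rightarrow> complex. \<forall>\<tau>\<in>uhp. (\<lambda>n. a n * qpar h \<tau> ^ n) sums slash k \<sigma> f \<tau>))}"

definition modular_ring :: "(real^2^2) set \<Rightarrow> (int \<Rightarrow> complex \<Rightarrow> complex) set" where
  "modular_ring \<Gamma> = direct_sum (modular_forms \<Gamma>)"

text \<open>The characterising properties of the fixed quasimodular function of weight 2.\<close>

definition quasimodular_E2 :: "(real^2^2) set \<Rightarrow> (complex \<Rightarrow> complex) \<Rightarrow> bool" where
  "quasimodular_E2 \<Gamma> E \<longleftrightarrow>
     E holomorphic_on uhp \<and>
     (\<forall>\<gamma>\<in>\<Gamma>. \<forall>\<tau>\<in>uhp. slash 2 \<gamma> E \<tau> = E \<tau> + 12 / (2 * of_real pi * \<i>) * Xfac \<gamma> \<tau>) \<and>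
     (\<forall>\<sigma>. cusp_at \<Gamma> \<sigma> \<longrightarrow> (\<forall>C::real set. compact C \<longrightarrow>
        (\<exists>y0>0. \<exists>B. \<forall>\<tau>. Re \<tau> \<in> C \<and> Im \<tau> \<ge> y0 \<longrightarrow> norm (slash 2 \<sigma> E \<tau>) \<le> B)))"


section \<open>Vertex operator algebras\<close>

text \<open>\<open>hsp V n\<close> is the homogeneous space \<open>V\<^sub>n\<close>, and \<open>mode V u n\<close> is the endomorphism
  \<open>u\<^sub>(\<^sub>n\<^sub>)\<close> in \<open>Y(u,z) = \<Sum>\<^sub>n u\<^sub>(\<^sub>n\<^sub>) z\<^sup>-\<^sup>n\<^sup>-\<^sup>1\<close>. The underlying space is the whole type.\<close>

record 'v voa =
  smul :: "complex \<Rightarrow> 'v \<Rightarrow> 'v"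
  hsp :: "int \<Rightarrow> 'v set"
  mode :: "'v \<Rightarrow> int \<Rightarrow> 'v \<Rightarrow> 'v"
  vac :: 'v
  conf :: 'v
  ccharge :: complex

definition vir :: "'v voa \<Rightarrow> int \<Rightarrow> 'v \<Rightarrow> 'v" where
  "vir V n = mode V (conf V) (n + 1)"

text \<open>The Jacobi identity is given in its component form (the Borcherds identity). All the
  sums occurring in it are finite by truncation; \<open>Sum_any\<close> sums over the support.\<close>

locale vertex_operator_algebra = vector_space "smul V"
  for V :: "'v::ab_group_add voa" +
  assumes hsp_subspace: "\<And>n. module.subspace (smul V) (hsp V n)"
    and hsp_decomposition:
      "\<And>v. \<exists>!c. (\<forall>n. c n \<in> hsp V n) \<and> finite {n. c n \<noteq> 0} \<and> Sum_any c = v"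
    and hsp_finite_dim: "\<And>n. \<exists>B. finite B \<and> module.span (smul V) B = hsp V n"
    and hsp_bounded_below: "\<exists>N. \<forall>n<N. hsp V n = {0}"
    and mode_linear: "\<And>u n. Vector_Spaces.linear (smul V) (smul V) (mode V u n)"
    and mode_linear_left: "\<And>n v. Vector_Spaces.linear (smul V) (smul V) (\<lambda>u. mode V u n v)"
    and truncation: "\<And>u v. \<exists>N. \<forall>n\<ge>N. mode V u n v = 0"
    and vacuum: "\<And>n v. mode V (vac V) n v = (if n = -1 then v else 0)"
    and creation: "\<And>v. mode V v (-1) (vac V) = v" "\<And>v n. n \<ge> 0 \<Longrightarrow> mode V v n (vac V) = 0"
    and borcherds: "\<And>u v w l m n.
      Sum_any (\<lambda>i. smul V (of_int m gchoose i) (mode V (mode V u (l + int i) v) (m + n - int i) w)) =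
      Sum_any (\<lambda>i. smul V ((-1) ^ i * (of_int l gchoose i))
        (mode V u (l + m - int i) (mode V v (n + int i) w)
         - smul V ((-1) powi l) (mode V v (l + n - int i) (mode V u (m + int i) w))))"
    and vac_weight: "vac V \<in> hsp V 0"
    and conf_weight: "conf V \<in> hsp V 2"
    and virasoro: "\<And>m n v.
      vir V m (vir V n v) - vir V n (vir V m v) =
      smul V (of_int (m - n)) (vir V (m + n) v)
      + (if m + n = 0 then smul V (of_int (m ^ 3 - m) / 12 * ccharge V) v else 0)"
    and L0_grading: "\<And>n v. v \<in> hsp V n \<Longrightarrow> vir V 0 v = smul V (of_int n) v"
    and L_minus1_derivative: "\<And>u n v. mode V (vir V (-1) u) n v = smul V (- of_int n) (mode V u (n - 1) v)"

definition cft_type :: "'v::ab_group_add voa \<Rightarrow> bool" where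
  "cft_type V \<longleftrightarrow> (\<forall>n<0. hsp V n = {0}) \<and> hsp V 0 = range (\<lambda>c. smul V c (vac V))"

definition filtration :: "'v::ab_group_add voa \<Rightarrow> int \<Rightarrow> 'v set" where
  "filtration V N = module.span (smul V) (\<Union>n\<in>{..N}. hsp V n)"

definition hcomp :: "'v::ab_group_add voa \<Rightarrow> 'v \<Rightarrow> int \<Rightarrow> 'v" where
  "hcomp V v = (THE c. (\<forall>n. c n \<in> hsp V n) \<and> finite {n. c n \<noteq> 0} \<and> Sum_any c = v)"

text \<open>\<open>z\<^sup>m\<^sup>L\<^sup>(\<^sup>0\<^sup>)\<close>, acting on \<open>V\<^sub>n\<close> by \<open>z\<^sup>m\<^sup>n\<close>; and \<open>e\<^sup>z\<^sup>L\<^sup>(\<^sup>1\<^sup>)\<close>, whose series terminates on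
  every vector because \<open>L(1)\<close> lowers the weight.\<close>

definition pow_L0 :: "'v::ab_group_add voa \<Rightarrow> complex \<Rightarrow> int \<Rightarrow> 'v \<Rightarrow> 'v" where
  "pow_L0 V z m v = Sum_any (\<lambda>n. smul V (z powi (m * n)) (hcomp V v n))"

definition exp_L1 :: "'v::ab_group_add voa \<Rightarrow> complex \<Rightarrow> 'v \<Rightarrow> 'v" where
  "exp_L1 V z v = Sum_any (\<lambda>r. smul V (z ^ r / fact r) ((vir V 1 ^^ r) v))"


section \<open>Vector-valued modular forms\<close>

definition Kfac :: "'v::ab_group_add voa \<Rightarrow> real^2^2 \<Rightarrow> complex \<Rightarrow> 'v \<Rightarrow> 'v" where
  "Kfac V \<gamma> \<tau> v = exp_L1 V (- (of_real (\<gamma>$2$1) * jfac \<gamma> \<tau>)) (pow_L0 V (jfac \<gamma> \<tau>) (-2) v)"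

definition vslash :: "'v::ab_group_add voa \<Rightarrow> int \<Rightarrow> real^2^2 \<Rightarrow> (complex \<Rightarrow> 'v) \<Rightarrow> complex \<Rightarrow> 'v" where
  "vslash V k \<gamma> f \<tau> = smul V (jfac \<gamma> \<tau> powi (- k)) (inv_into UNIV (Kfac V \<gamma> \<tau>) (f (moeb \<gamma> \<tau>)))"

text \<open>Holomorphy and convergence of power series are only used for functions with values in
  the finite-dimensional spaces \<open>filtration V N\<close>; there they may be tested on linear
  functionals.\<close>

definition vholomorphic :: "'v::ab_group_add voa \<Rightarrow> (complex \<Rightarrow> 'v) \<Rightarrow> bool" where
  "vholomorphic V f \<longleftrightarrow>
     (\<forall>\<phi>. Vector_Spaces.linear (smul V) (*) \<phi> \<longrightarrow> (\<lambda>\<tau>. \<phi> (f \<tau>)) holomorphic_on uhp)"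

definition vsums :: "'v::ab_group_add voa \<Rightarrow> (nat \<Rightarrow> 'v) \<Rightarrow> 'v \<Rightarrow> bool" where
  "vsums V a v \<longleftrightarrow>
     (\<forall>\<phi>. Vector_Spaces.linear (smul V) (*) \<phi> \<longrightarrow> (\<lambda>n. \<phi> (a n) :: complex) sums \<phi> v)"

definition vmodular_forms :: "'v::ab_group_add voa \<Rightarrow> (real^2^2) set \<Rightarrow> int \<Rightarrow> (complex \<Rightarrow> 'v) set" where
  "vmodular_forms V \<Gamma> k = {f.
     (\<forall>\<tau>. \<tau> \<notin> uhp \<longrightarrow> f \<tau> = 0) \<and>
     (\<exists>N. (\<forall>\<tau>\<in>uhp. f \<tau> \<in> filtration V N) \<and>
       vholomorphic V f \<and>
       (\<forall>\<gamma>\<in>\<Gamma>. \<forall>\<tau>\<in>uhp. vslash V k \<gamma> f \<tau> = f \<tau>) \<and>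
       (\<forall>\<sigma> h. cusp_at \<Gamma> \<sigma> \<and> cusp_width \<Gamma> \<sigma> h \<longrightarrow>
          (\<exists>a::nat \<Rightarrow> 'v. (\<forall>n. a n \<in> filtration V N) \<and>
             (\<forall>\<tau>\<in>uhp. vsums V (\<lambda>n. smul V (qpar h \<tau> ^ n) (a n)) (vslash V k \<sigma> f \<tau>)))) \<and>
       (\<forall>\<tau> \<gamma>. elliptic_with_generator \<Gamma> \<tau> \<gamma> \<longrightarrow>
          smul V (jfac \<gamma> \<tau> powi k) (Kfac V \<gamma> \<tau> (f \<tau>)) = f \<tau>))}"

definition vmodular_module :: "'v::ab_group_add voa \<Rightarrow> (real^2^2) set \<Rightarrow> (int \<Rightarrow> complex \<Rightarrow> 'v) set" where
  "vmodular_module V \<Gamma> = direct_sum (vmodular_forms V \<Gamma>)"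

text \<open>Graded objects are families indexed by the weight. For \<open>f\<close> of weight \<open>m\<close> and
  \<open>v \<in> V\<^sub>n = V\<^sup>(\<^sup>2\<^sup>)\<^sub>2\<^sub>n\<close> the element \<open>f \<otimes> v\<close> is the function \<open>\<tau> \<mapsto> f(\<tau>)v\<close>, placed in weight
  \<open>m + 2n\<close>; the following extends this bilinearly to all of \<open>M(\<Gamma>) \<times> V\<close>.\<close>

definition tens :: "'v::ab_group_add voa \<Rightarrow> (int \<Rightarrow> complex \<Rightarrow> complex) \<Rightarrow> 'v \<Rightarrow> int \<Rightarrow> complex \<Rightarrow> 'v" where
  "tens V f v = (\<lambda>k \<tau>. Sum_any (\<lambda>n. smul V (f (k - 2 * n) \<tau>) (hcomp V v n)))"

abbreviation famscale :: "'v::ab_group_add voa \<Rightarrow> complex \<Rightarrow> (int \<Rightarrow> complex \<Rightarrow> 'v) \<Rightarrow> int \<Rightarrow> complex \<Rightarrow> 'v" where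
  "famscale V \<equiv> pointwise (pointwise (smul V))"

definition tensor_module :: "'v::ab_group_add voa \<Rightarrow> (real^2^2) set \<Rightarrow> (int \<Rightarrow> complex \<Rightarrow> 'v) set" where
  "tensor_module V \<Gamma> = module.span (famscale V) {tens V f v | f v. f \<in> modular_ring \<Gamma>}"

definition ring_act :: "'v::ab_group_add voa \<Rightarrow> (int \<Rightarrow> complex \<Rightarrow> complex) \<Rightarrow> (int \<Rightarrow> complex \<Rightarrow> 'v) \<Rightarrow> int \<Rightarrow> complex \<Rightarrow> 'v" where
  "ring_act V g F = (\<lambda>k \<tau>. \<Sum>m | g m \<noteq> 0. smul V (g m \<tau>) (F (k - m) \<tau>))"

text \<open>\<open>exp(-(2\<pi>i/12) E \<otimes> L(1))\<close>: multiplication by \<open>E\<close> raises the weight by 2, while \<open>L(1)\<close>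
  lowers the degree in \<open>V\<^sup>(\<^sup>2\<^sup>)\<close> by 2, so the map acts separately in every weight.\<close>

definition Pmap :: "'v::ab_group_add voa \<Rightarrow> (complex \<Rightarrow> complex) \<Rightarrow> (int \<Rightarrow> complex \<Rightarrow> 'v) \<Rightarrow> int \<Rightarrow> complex \<Rightarrow> 'v" where
  "Pmap V E F = (\<lambda>k \<tau>. exp_L1 V (- (2 * of_real pi * \<i> / 12) * E \<tau>) (F k \<tau>))"

end

theory Submission
  imports Defs
begin

text \<open>Put \<open>c = -2\<pi>i/12\<close>. For \<open>\<gamma>\<close> in \<open>\<Gamma>\<close> with lower row \<open>(c\<^sub>\<gamma>, d\<^sub>\<gamma>)\<close> the transformation law of \<open>E\<close>
reads \<open>c E(\<gamma>\<tau>) = j\<^sup>2 c E(\<tau>) - c\<^sub>\<gamma> j\<close>, where \<open>j = j(\<gamma>,\<tau>)\<close>, and conjugation by \<open>j\<^bsup>-2L(0)\<^esup>\<close>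
multiplies \<open>L(1)\<close> by \<open>j\<^sup>2\<close>, because \<open>L(1)\<close> lowers the weight by one. So
\<open>exp(c E(\<gamma>\<tau>) L(1)) j\<^bsup>-2L(0)\<^esup> = K(\<gamma>,\<tau>) exp(c E(\<tau>) L(1))\<close>, and \<open>f = exp(c E L(1)) u\<close> transforms with
weight \<open>k\<close> under the vector-valued slash action if and only if the component of \<open>u\<close> in \<open>V\<^sub>n\<close>
transforms with weight \<open>k - 2n\<close>. For a general \<open>\<sigma>\<close> in \<open>SL\<^sub>2(\<real>)\<close> the same computation
(\<open>vslash_exp_L1\<close>) leaves the exponent \<open>X(\<sigma>,\<tau>) + c (E|\<^sub>2\<sigma>)(\<tau>)\<close>. At a cusp this function is periodic,
since \<open>X\<close> is a cocycle, and bounded, hence a power series in \<open>q\<close>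
(\<open>quasimodular_shift_q_expandable\<close>). As \<open>L(1)\<close> is nilpotent on \<open>F\<^sub>NV\<close>, the exponential and its
inverse are polynomials in that series, so the expansions of \<open>f\<close> and of the components of \<open>u\<close>
determine each other. The condition at an elliptic point is the transformation law at a fixed point.
This is \<open>expE_modular_iff\<close>; the assertions on \<open>P\<close> follow because \<open>exp(-c E L(1))\<close> is an inverse and
because the families with components of these weights are the sums of elements \<open>f \<otimes> v\<close>
(\<open>tensor_module_eq\<close>).\<close>

text \<open>Bases of the spaces \<open>V\<^sub>n\<close> now express the dimension in weight \<open>k\<close> as the sum over all \<open>n \<ge> 0\<close> of
\<open>dim M\<^bsub>k-2n\<^esub>(\<Gamma>) dim V\<^sub>n\<close>. The formula claims that nothing comes from \<open>2n > k\<close>, that is,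
\<open>M\<^sub>w(\<Gamma>) = 0\<close> for \<open>w < 0\<close> (\<open>modular_forms_negative_weight\<close>). If \<open>f\<close> has weight \<open>w < 0\<close>, then
\<open>|f| Im(\<tau>)\<^bsup>w/2\<^esup>\<close> is \<open>\<Gamma>\<close>-invariant. Once it is known to be bounded, \<open>f|\<^sub>w\<sigma>\<close> tends to 0 as \<open>Im \<tau>\<close> does,
and at a cusp this forces the holomorphic function of \<open>q\<close> on the unit disc to vanish by the maximum
principle.\<close>

text \<open>Boundedness needs reduction theory for a discrete group of finite covolume
(\<open>reduction_theory\<close>), carried out on \<open>SL\<^sub>2(\<real>)\<close> itself, with \<open>g\<close> standing for the point \<open>gi\<close>. Call \<open>g\<close>
thick if no \<open>\<gamma> \<noteq> 1\<close> in \<open>\<Gamma>\<close> makes \<open>g\<inverse>\<gamma>g\<close> close to 1. A packing argument with the invariant area shows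
that the thick part is compact modulo \<open>\<Gamma>\<close> (\<open>thick_part_cocompact\<close>). At a thin \<open>g\<close> all small elements
commute, because commutators contract near 1 (\<open>small_at_commute\<close>); following a unipotent path out of
the tube belonging to their common centraliser one meets a thick point on its boundary
(\<open>tube_boundary_thick\<close>), so up to \<open>\<Gamma>\<close> there are finitely many tubes. An elliptic tube is bounded, a
hyperbolic one is bounded modulo a cyclic group, and a parabolic one is a horoball at a cusp, where
\<open>f\<close> is bounded by its expansion.\<close>

no_notation fps_nth (infixl \<open>$\<close> 75)

section \<open>The group SL(2,R) and its action on the upper half-plane\<close>

text \<open>The inverse on \<open>SL\<^sub>2(\<real>)\<close>; as the adjugate it is linear and an isometry on all
matrices.\<close>

definition adj2 :: "real^2^2 \<Rightarrow> real^2^2" where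
  "adj2 A = vector [vector [A$2$2, - A$1$2], vector [- A$2$1, A$1$1]]"

lemma adj2_entries [simp]:
  "adj2 A $ 1 $ 1 = A$2$2" "adj2 A $ 1 $ 2 = - A$1$2"
  "adj2 A $ 2 $ 1 = - A$2$1" "adj2 A $ 2 $ 2 = A$1$1"
  by (simp_all add: adj2_def)

lemma matrix_mult_entries [simp]:
  fixes A B :: "real^2^2"
  shows "(A ** B) $ i $ k = A$i$1 * B$1$k + A$i$2 * B$2$k"
  by (simp add: matrix_matrix_mult_def sum_2)

lemma mat_entries [simp]:
  "(mat c :: real^2^2) $ 1 $ 1 = c" "(mat c :: real^2^2) $ 1 $ 2 = 0"
  "(mat c :: real^2^2) $ 2 $ 1 = 0" "(mat c :: real^2^2) $ 2 $ 2 = c"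
  by (simp_all add: mat_def)

lemma mat2_eq_iff:
  fixes A B :: "real^2^2"
  shows "A = B \<longleftrightarrow> A$1$1 = B$1$1 \<and> A$1$2 = B$1$2 \<and> A$2$1 = B$2$1 \<and> A$2$2 = B$2$2"
  by (simp only: vec_eq_iff forall_2) blast

lemma SL2R_iff: "A \<in> SL2R \<longleftrightarrow> A$1$1 * A$2$2 - A$1$2 * A$2$1 = 1"
  by (simp add: SL2R_def det_2)

lemma SL2R_mult [intro, simp]: "A \<in> SL2R \<Longrightarrow> B \<in> SL2R \<Longrightarrow> A ** B \<in> SL2R"
  by (simp add: SL2R_def det_mul)

lemma SL2R_one [intro, simp]: "mat 1 \<in> SL2R"
  by (simp add: SL2R_def)

lemma SL2R_adj2 [intro, simp]: "A \<in> SL2R \<Longrightarrow> adj2 A \<in> SL2R"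
  by (simp add: SL2R_iff algebra_simps)

lemma adj2_mult [simp]: "adj2 (A ** B) = adj2 B ** adj2 A"
  by (simp add: mat2_eq_iff algebra_simps)

lemma adj2_simps [simp]:
  "adj2 (adj2 A) = A" "adj2 (A - B) = adj2 A - adj2 B" "adj2 (- A) = - adj2 A" "adj2 (mat 1) = mat 1"
  by (simp_all add: mat2_eq_iff)

lemma adj2_inverse [simp]:
  assumes "A \<in> SL2R"
  shows "adj2 A ** A = mat 1" "A ** adj2 A = mat 1"
  using assms by (simp_all add: mat2_eq_iff SL2R_iff algebra_simps)

lemma adj2_cancel [simp]:
  assumes "A \<in> SL2R"
  shows "adj2 A ** (A ** B) = B" "A ** (adj2 A ** B) = B"
  using assms by (simp_all add: matrix_mul_assoc)

lemma matrix_inv_SL2R [simp]: "A \<in> SL2R \<Longrightarrow> matrix_inv A = adj2 A"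
proof -
  assume A: "A \<in> SL2R"
  then have "invertible A" unfolding invertible_def using adj2_inverse by blast
  then have "matrix_inv A ** A = mat 1"
    unfolding invertible_def matrix_inv_def by (metis (mono_tags, lifting) someI_ex)
  then have "matrix_inv A ** A ** adj2 A = adj2 A" by simp
  then show ?thesis using A by (simp add: matrix_mul_assoc [symmetric])
qed

lemma conj_by_SL2R: "g \<in> SL2R \<Longrightarrow> conj_by g A = adj2 g ** A ** g"
  by (simp add: conj_by_def)

lemma conj_by_mult: "g \<in> SL2R \<Longrightarrow> conj_by g (A ** B) = conj_by g A ** conj_by g B"
  by (simp add: conj_by_SL2R matrix_mul_assoc [symmetric])

lemma conj_by_one [simp]: "g \<in> SL2R \<Longrightarrow> conj_by g (mat 1) = mat 1"
  by (simp add: conj_by_SL2R)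

lemma conj_by_conj_by:
  assumes "g \<in> SL2R" "h \<in> SL2R"
  shows "conj_by h (conj_by g A) = conj_by (g ** h) A"
  using assms by (simp add: conj_by_SL2R matrix_mul_assoc)

lemma conj_by_in_SL2R [simp]: "g \<in> SL2R \<Longrightarrow> A \<in> SL2R \<Longrightarrow> conj_by g A \<in> SL2R"
  by (simp add: conj_by_SL2R)

lemma conj_by_diff: "g \<in> SL2R \<Longrightarrow> conj_by g (A - B) = conj_by g A - conj_by g B"
  by (simp add: conj_by_SL2R mat2_eq_iff algebra_simps)

lemma conj_by_cancel:
  assumes "g \<in> SL2R"
  shows "conj_by g A = conj_by g B \<longleftrightarrow> A = B"
proof
  assume "conj_by g A = conj_by g B"
  then have "conj_by (adj2 g) (conj_by g A) = conj_by (adj2 g) (conj_by g B)" by simp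
  then show "A = B" using assms by (simp add: conj_by_conj_by) (simp add: conj_by_SL2R)
qed simp

lemma adj2_conj_by: "g \<in> SL2R \<Longrightarrow> adj2 (conj_by g A) = conj_by g (adj2 A)"
  by (simp add: conj_by_SL2R matrix_mul_assoc)

lemma norm_sq_mat2:
  fixes A :: "real^2^2"
  shows "(norm A)\<^sup>2 = (A$1$1)\<^sup>2 + (A$1$2)\<^sup>2 + (A$2$1)\<^sup>2 + (A$2$2)\<^sup>2"
  by (simp add: norm_vec_def L2_set_def sum_2)

lemma norm_adj2 [simp]: "norm (adj2 A) = norm A"
proof -
  have "(norm (adj2 A))\<^sup>2 = (norm A)\<^sup>2" by (simp add: norm_sq_mat2)
  then show ?thesis by (simp add: power2_eq_iff_nonneg)
qed

lemma norm_mat2_mult_le: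
  fixes A B :: "real^2^2"
  shows "norm (A ** B) \<le> norm A * norm B"
proof -
  have cs: "(a * b + c * d)\<^sup>2 \<le> (a\<^sup>2 + c\<^sup>2) * (b\<^sup>2 + d\<^sup>2)" for a b c d :: real
  proof -
    have "0 \<le> (a * d - b * c)\<^sup>2" by simp
    then show ?thesis by (simp add: power2_eq_square algebra_simps)
  qed
  have "(norm (A ** B))\<^sup>2 \<le> (norm A * norm B)\<^sup>2"
    using cs[of "A$1$1" "B$1$1" "A$1$2" "B$2$1"] cs[of "A$1$1" "B$1$2" "A$1$2" "B$2$2"]
      cs[of "A$2$1" "B$1$1" "A$2$2" "B$2$1"] cs[of "A$2$1" "B$1$2" "A$2$2" "B$2$2"]
    by (simp add: norm_sq_mat2 power_mult_distrib algebra_simps)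
  then show ?thesis by (rule power2_le_imp_le) simp
qed

lemma entry_le_norm: "\<bar>(A :: real^2^2) $ i $ j\<bar> \<le> norm A"
  by (metis Finite_Cartesian_Product.norm_nth_le order_trans real_norm_def)

lemma norm_mat2_le:
  fixes A :: "real^2^2"
  assumes "\<bar>A$1$1\<bar> \<le> r" "\<bar>A$1$2\<bar> \<le> r" "\<bar>A$2$1\<bar> \<le> r" "\<bar>A$2$2\<bar> \<le> r"
  shows "norm A \<le> 2 * r"
proof -
  have "(norm A)\<^sup>2 \<le> (2 * r)\<^sup>2"
    using assms[THEN power_mono, of 2] by (simp add: norm_sq_mat2 power_mult_distrib)
  then show ?thesis by (rule power2_le_imp_le) (use assms(1) in linarith)
qed

text \<open>Twice the determinant is at most the sum of the squares of the entries.\<close>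

lemma norm_SL2R_ge: "A \<in> SL2R \<Longrightarrow> norm A \<ge> 1"
proof -
  assume "A \<in> SL2R"
  then have "1 = A$1$1 * A$2$2 - A$1$2 * A$2$1" by (simp add: SL2R_iff)
  moreover have "2 * (A$1$1 * A$2$2 - A$1$2 * A$2$1) \<le> (norm A)\<^sup>2"
    unfolding norm_sq_mat2
    using zero_le_power2[of "A$1$1 - A$2$2"] zero_le_power2[of "A$1$2 + A$2$1"]
    by (simp add: power2_eq_square algebra_simps)
  ultimately have "1\<^sup>2 \<le> (norm A)\<^sup>2" by simp
  then show ?thesis by (rule power2_le_imp_le) simp
qed

lemma norm_one_mat2_le: "norm (mat 1 :: real^2^2) \<le> 2"
  using norm_mat2_le[of "mat 1" 1] by simp

lemma norm_adj2_minus_one: "norm (adj2 A - mat 1) = norm (A - mat 1)"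
  by (metis adj2_simps(2,4) norm_adj2)

lemma matrix_diff_ldistrib:
  fixes A B C :: "real^2^2"
  shows "A ** (B - C) = A ** B - A ** C"
  by (simp add: mat2_eq_iff right_diff_distrib)
lemma matrix_diff_rdistrib:
  fixes A B C :: "real^2^2"
  shows "(B - C) ** A = B ** A - C ** A"
  by (simp add: mat2_eq_iff left_diff_distrib)

lemma uhp_iff: "\<tau> \<in> uhp \<longleftrightarrow> Im \<tau> > 0" by (simp add: uhp_def)

lemma open_uhp: "open uhp"
  unfolding uhp_def by (rule open_halfspace_Im_gt)

lemma jfac_nonzero [simp]:
  assumes "A \<in> SL2R" "\<tau> \<in> uhp"
  shows "jfac A \<tau> \<noteq> 0"
proof
  assume "jfac A \<tau> = 0"
  then have "A$2$1 * Re \<tau> + A$2$2 = 0" "A$2$1 * Im \<tau> = 0" by (auto simp: jfac_def complex_eq_iff)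
  then show False using assms by (auto simp: SL2R_iff uhp_iff)
qed

lemma jfac_mult:
  assumes "A \<in> SL2R" "B \<in> SL2R" "\<tau> \<in> uhp"
  shows "jfac (A ** B) \<tau> = jfac A (moeb B \<tau>) * jfac B \<tau>"
proof -
  have "jfac B \<tau> \<noteq> 0" using assms by simp
  then show ?thesis
    by (simp add: jfac_def moeb_def) (simp add: field_simps)
qed

lemma moeb_eq: "moeb A \<tau> = (of_real (A$1$1) * \<tau> + of_real (A$1$2)) / jfac A \<tau>"
  by (simp add: moeb_def jfac_def)

lemma Im_moeb:
  assumes "A \<in> SL2R" "\<tau> \<in> uhp"
  shows "Im (moeb A \<tau>) = Im \<tau> / (cmod (jfac A \<tau>))\<^sup>2"
proof -
  have "Im (moeb A \<tau>) = (A$1$1 * A$2$2 - A$1$2 * A$2$1) * Im \<tau> / (cmod (jfac A \<tau>))\<^sup>2"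
    by (simp add: moeb_eq Im_divide' jfac_def algebra_simps cmod_power2)
  then show ?thesis using assms by (simp add: SL2R_iff)
qed

lemma moeb_in_uhp [simp]: "A \<in> SL2R \<Longrightarrow> \<tau> \<in> uhp \<Longrightarrow> moeb A \<tau> \<in> uhp"
  using Im_moeb[of A \<tau>] by (auto simp: uhp_iff intro!: divide_pos_pos zero_less_power)

lemma moeb_mult:
  assumes "A \<in> SL2R" "B \<in> SL2R" "\<tau> \<in> uhp"
  shows "moeb (A ** B) \<tau> = moeb A (moeb B \<tau>)"
proof -
  have 1: "jfac B \<tau> \<noteq> 0" "jfac A (moeb B \<tau>) \<noteq> 0" using assms by simp_all
  have 2: "(of_real (A$1$1) * moeb B \<tau> + of_real (A$1$2)) * jfac B \<tau>
    = of_real ((A**B)$1$1) * \<tau> + of_real ((A**B)$1$2)"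
    using 1(1) by (simp add: moeb_eq field_simps) (simp add: jfac_def algebra_simps)
  show ?thesis
    unfolding moeb_eq[of "A ** B"] jfac_mult[OF assms] 2[symmetric] moeb_eq[of A "moeb B \<tau>"]
    using 1 by simp
qed

lemma moeb_one [simp]: "moeb (mat 1) \<tau> = \<tau>" by (simp add: moeb_def)
lemma slash_mult:
  assumes "A \<in> SL2R" "B \<in> SL2R" "\<tau> \<in> uhp"
  shows "slash k (A ** B) f \<tau> = slash k B (slash k A f) \<tau>"
  using assms by (simp add: slash_def jfac_mult moeb_mult power_int_mult_distrib)

lemma holomorphic_moeb: "A \<in> SL2R \<Longrightarrow> moeb A holomorphic_on uhp"
  unfolding moeb_def by (intro holomorphic_intros) (use jfac_nonzero in \<open>auto simp: jfac_def\<close>)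

lemma holomorphic_jfac: "jfac A holomorphic_on S"
  unfolding jfac_def by (intro holomorphic_intros)

lemma holomorphic_slash:
  assumes "A \<in> SL2R" "f holomorphic_on uhp"
  shows "slash k A f holomorphic_on uhp"
proof -
  have "(f \<circ> moeb A) holomorphic_on uhp"
    by (rule holomorphic_on_compose_gen[OF holomorphic_moeb assms(2)]) (use assms in auto)
  then show ?thesis unfolding slash_def using assms
    by (intro holomorphic_intros holomorphic_jfac) (auto simp: o_def)
qed

locale discrete_subgroup =
  fixes \<Gamma> :: "(real^2^2) set"
  assumes sub_SL2R: "\<Gamma> \<subseteq> SL2R"
    and mult_closed: "\<And>A B. A \<in> \<Gamma> \<Longrightarrow> B \<in> \<Gamma> \<Longrightarrow> A ** B \<in> \<Gamma>"
    and adj2_closed: "\<And>A. A \<in> \<Gamma> \<Longrightarrow> adj2 A \<in> \<Gamma>"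
    and minus_one_mem: "- mat 1 \<in> \<Gamma>"
    and discr: "discrete \<Gamma>"
begin

lemma SL2R_mem: "A \<in> \<Gamma> \<Longrightarrow> A \<in> SL2R" using sub_SL2R by blast

lemma one_mem: "mat 1 \<in> \<Gamma>"
  by (metis adj2_closed adj2_inverse(2) minus_one_mem mult_closed sub_SL2R subsetD)

lemma uminus_mem: "A \<in> \<Gamma> \<Longrightarrow> - A \<in> \<Gamma>"
proof -
  assume "A \<in> \<Gamma>"
  moreover have "- A = (- mat 1) ** A" by (simp add: mat2_eq_iff)
  ultimately show ?thesis using mult_closed[OF minus_one_mem] by metis
qed

lemma conj_mem: "A \<in> \<Gamma> \<Longrightarrow> B \<in> \<Gamma> \<Longrightarrow> conj_by A B \<in> \<Gamma>"
  by (simp add: conj_by_SL2R SL2R_mem mult_closed adj2_closed)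

text \<open>If two elements of norm at most \<open>R\<close> are close, then \<open>A\<inverse>B\<close> is close to 1,
hence equal to 1: bounded parts are uniformly discrete.\<close>

lemma finite_bounded_part: "finite {A \<in> \<Gamma>. norm A \<le> R}"
proof -
  obtain e where e: "e > 0" "\<And>A. A \<in> \<Gamma> \<Longrightarrow> dist (mat 1) A < e \<Longrightarrow> A = mat 1"
    using discr one_mem unfolding discrete_def isolated_in_dist_Ex_iff
    by (metis dist_commute)
  have "uniform_discrete {A \<in> \<Gamma>. norm A \<le> R}"
    unfolding uniform_discrete_def
  proof (intro exI[of _ "e / (\<bar>R\<bar> + 1)"] conjI ballI impI)
    show "e / (\<bar>R\<bar> + 1) > 0" using e(1) by simp
    fix A B assume A: "A \<in> {A \<in> \<Gamma>. norm A \<le> R}" and B: "B \<in> {A \<in> \<Gamma>. norm A \<le> R}"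
      and d: "dist A B < e / (\<bar>R\<bar> + 1)"
    have "adj2 A ** B - mat 1 = adj2 A ** (B - A)"
      using A by (simp add: matrix_diff_ldistrib SL2R_mem)
    then have "norm (adj2 A ** B - mat 1) \<le> norm A * norm (B - A)"
      by (metis norm_adj2 norm_mat2_mult_le)
    also have "\<dots> \<le> (\<bar>R\<bar> + 1) * norm (B - A)"
      using A by (intro mult_right_mono) auto
    also have "\<dots> < e" using d by (simp add: dist_norm norm_minus_commute field_simps)
    finally have "adj2 A ** B = mat 1"
      using A B e(2)[of "adj2 A ** B"] by (simp add: dist_norm norm_minus_commute mult_closed adj2_closed)
    then have "A ** (adj2 A ** B) = A" by simp
    then show "A = B" using A by (simp add: SL2R_mem)
  qed
  moreover have "bounded {A \<in> \<Gamma>. norm A \<le> R}" by (auto simp: bounded_iff)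
  ultimately show ?thesis using uniform_discrete_finite_iff by blast
qed

lemma countable_group: "countable \<Gamma>"
proof -
  have "\<Gamma> = (\<Union>n::nat. {A \<in> \<Gamma>. norm A \<le> real n})"
  proof (rule subset_antisym; rule subsetI)
    fix A assume "A \<in> \<Gamma>"
    moreover obtain n :: nat where "norm A \<le> real n" using real_arch_simple by blast
    ultimately show "A \<in> (\<Union>n::nat. {A \<in> \<Gamma>. norm A \<le> real n})" by blast
  qed blast
  also have "countable \<dots>"
    by (rule countable_UN) (auto intro: countable_finite finite_bounded_part)
  finally show ?thesis .
qed

end

lemma fuchsian_discrete_subgroup:
  assumes "fuchsian_first_kind \<Gamma>"
  shows "discrete_subgroup \<Gamma>"
proof -
  have sg: "subgroup \<Gamma> SL2R_group" and m1: "- mat 1 \<in> \<Gamma>" and d: "discrete \<Gamma>"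
    using assms by (auto simp: fuchsian_first_kind_def)
  have G: "Group.group SL2R_group"
  proof (rule groupI)
    show "\<exists>y\<in>carrier SL2R_group. y \<otimes>\<^bsub>SL2R_group\<^esub> x = \<one>\<^bsub>SL2R_group\<^esub>"
      if "x \<in> carrier SL2R_group" for x
      using that by (intro bexI[of _ "adj2 x"]) (simp_all add: SL2R_group_def)
  qed (simp_all add: SL2R_group_def matrix_mul_assoc)
  interpret S: Group.group SL2R_group by (rule G)
  have inv: "inv\<^bsub>SL2R_group\<^esub> A = adj2 A" if "A \<in> SL2R" for A
    by (rule S.inv_equality) (use that in \<open>auto simp: SL2R_group_def\<close>)
  have sub: "\<Gamma> \<subseteq> SL2R" using subgroup.subset[OF sg] by (simp add: SL2R_group_def)
  show ?thesis
  proof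
    show "\<Gamma> \<subseteq> SL2R" by (rule sub)
    show "A ** B \<in> \<Gamma>" if "A \<in> \<Gamma>" "B \<in> \<Gamma>" for A B
      using subgroup.m_closed[OF sg that] by (simp add: SL2R_group_def)
    show "adj2 A \<in> \<Gamma>" if "A \<in> \<Gamma>" for A
      using subgroup.m_inv_closed[OF sg that] inv[of A] that sub by auto
  qed (fact m1 d)+
qed

section \<open>Invariance of the hyperbolic area\<close>

definition to_complex :: "real^2 \<Rightarrow> complex" where
  "to_complex v = Complex (v$1) (v$2)"

definition of_complex2 :: "complex \<Rightarrow> real^2" where
  "of_complex2 z = vector [Re z, Im z]"

lemma to_complex_inverse [simp]: "to_complex (of_complex2 z) = z" "of_complex2 (to_complex v) = v"
  by (simp_all add: to_complex_def of_complex2_def complex_eq_iff vec_eq_iff forall_2)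

lemma of_complex2_entries [simp]: "of_complex2 z $ 1 = Re z" "of_complex2 z $ 2 = Im z"
  by (simp_all add: of_complex2_def)

lemma Re_Im_to_complex [simp]: "Re (to_complex v) = v$1" "Im (to_complex v) = v$2"
  by (simp_all add: to_complex_def)

lemma bounded_linear_to_complex: "bounded_linear to_complex"
  by (rule linear_conv_bounded_linear[THEN iffD1])
     (auto intro!: linearI simp: complex_eq_iff)

lemma bounded_linear_of_complex2: "bounded_linear of_complex2"
  by (rule linear_conv_bounded_linear[THEN iffD1])
     (auto intro!: linearI simp: vec_eq_iff forall_2)

lemma continuous_to_complex: "continuous_on S to_complex"
  by (rule linear_continuous_on[OF bounded_linear_to_complex])

lemma measurable_to_complex [measurable]: "to_complex \<in> borel_measurable borel"
  by (rule borel_measurable_continuous_onI[OF continuous_to_complex])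

lemma lborel_complex_eq_distr: "(lborel :: complex measure) = distr lborel borel to_complex"
proof (rule lborel_eqI)
  fix l u :: complex assume le: "\<And>b. b \<in> Basis \<Longrightarrow> l \<bullet> b \<le> u \<bullet> b"
  have le': "Re l \<le> Re u" "Im l \<le> Im u"
    using le[of 1] le[of \<i>] by (simp_all add: Basis_complex_def)
  have "to_complex -` box l u = box (of_complex2 l) (of_complex2 u)"
    by (auto simp: box_def Basis_complex_def Basis_vec_def inner_axis forall_2)
  then have "emeasure (distr lborel borel to_complex) (box l u) = emeasure lborel (box (of_complex2 l) (of_complex2 u))"
    by (subst emeasure_distr) auto
  also have "\<dots> = (\<Prod>b\<in>Basis. (of_complex2 u - of_complex2 l) \<bullet> b)"
  proof (rule emeasure_lborel_box)
    have "of_complex2 l $ i \<le> of_complex2 u $ i" for i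
      using le' exhaust_2[of i] by auto
    then show "of_complex2 l \<bullet> b \<le> of_complex2 u \<bullet> b" if "b \<in> Basis" for b
      using that by (auto simp: Basis_vec_def inner_axis)
  qed
  also have "(\<Prod>b\<in>Basis. (of_complex2 u - of_complex2 l) \<bullet> b) = (Re u - Re l) * (Im u - Im l)"
  proof -
    have B: "(Basis :: (real^2) set) = {axis 1 1, axis 2 1}"
      by (auto simp: Basis_vec_def) (metis exhaust_2)
    have ne: "axis 1 1 \<noteq> (axis 2 1 :: real^2)" by (simp add: axis_eq_axis)
    show ?thesis unfolding B by (subst prod.insert) (use ne in \<open>auto simp: inner_axis\<close>)
  qed
  also have "(Re u - Re l) * (Im u - Im l) = (\<Prod>b\<in>Basis. (u - l) \<bullet> b)"
    by (simp add: Basis_complex_def)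
  finally show "emeasure (distr lborel borel to_complex) (box l u) = ennreal (\<Prod>b\<in>Basis. (u - l) \<bullet> b)" .
qed simp

text \<open>The change of variables formula concerns absolutely integrable vector-valued functions. An equivalence for
every prospective value \<open>r\<close>, rather than an equation under an integrability hypothesis, lets it be
transferred to nonnegative integrals that may be infinite.\<close>

lemma nn_integral_iff_absolutely_integrable:
  fixes u :: "'a::euclidean_space \<Rightarrow> real"
  assumes [measurable]: "T \<in> sets borel" "u \<in> borel_measurable borel" and nonneg: "\<And>x. u x \<ge> 0"
  shows "(\<integral>\<^sup>+x\<in>T. ennreal (u x) \<partial>lborel) = ennreal r \<and> r \<ge> 0 \<longleftrightarrow>
    (\<lambda>x. u x *\<^sub>R (axis 1 1 :: real^1)) absolutely_integrable_on T \<and>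
    integral T (\<lambda>x. u x *\<^sub>R (axis 1 1 :: real^1)) = r *\<^sub>R axis 1 1"
    (is "?L \<longleftrightarrow> ?R")
proof -
  let ?e = "axis 1 1 :: real^1"
  have 1: "?L \<longleftrightarrow> (u has_integral r) T"
  proof -
    have "(\<integral>\<^sup>+x\<in>T. ennreal (u x) \<partial>lborel) = (\<integral>\<^sup>+x. ennreal (indicator T x * u x) \<partial>lborel)"
      by (intro nn_integral_cong) (auto simp: indicator_def)
    also have "\<dots> = (\<integral>\<^sup>+x. ennreal (indicator T x * u x) \<partial>lebesgue)"
      by (simp add: nn_integral_completion)
    finally have eq: "(\<integral>\<^sup>+x\<in>T. ennreal (u x) \<partial>lborel) = (\<integral>\<^sup>+x. ennreal (indicator T x * u x) \<partial>lebesgue)" .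
    have "(u has_integral r) T \<longleftrightarrow> ((\<lambda>x. indicator T x * u x) has_integral r) UNIV"
    proof -
      have "(\<lambda>x. indicator T x * u x) = (\<lambda>x. if x \<in> T then u x else 0)" by auto
      then show ?thesis by (simp only: has_integral_restrict_UNIV)
    qed
    also have "\<dots> \<longleftrightarrow> ?L"
      unfolding eq by (subst has_integral_iff_nn_integral_lebesgue)
        (use nonneg in \<open>auto intro!: measurable_completion\<close>)
    finally show ?thesis by simp
  qed
  also have "\<dots> \<longleftrightarrow> ?R"
  proof
    assume h: "(u has_integral r) T"
    then have "u absolutely_integrable_on T"
      by (intro nonnegative_absolutely_integrable_1) (use nonneg in auto)
    then have "(\<lambda>x. u x *\<^sub>R ?e) absolutely_integrable_on T"
      by (rule absolutely_integrable_scaleR_right)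
    moreover have "((\<lambda>x. u x *\<^sub>R ?e) has_integral r *\<^sub>R ?e) T"
      by (rule has_integral_scaleR_left[OF h])
    ultimately show ?R by (auto intro: integral_unique)
  next
    assume ?R
    then have "((\<lambda>x. u x *\<^sub>R ?e) has_integral r *\<^sub>R ?e) T"
      by (metis absolutely_integrable_on_def integrable_integral)
    from has_integral_linear[OF this bounded_linear_vec_nth[of 1]]
    show "(u has_integral r) T" by (simp add: o_def axis_def)
  qed
  finally show ?thesis .
qed

definition hyp_area :: "complex measure" where
  "hyp_area = density lborel (\<lambda>\<tau>. indicator uhp \<tau> * ennreal (1 / (Im \<tau>)\<^sup>2))"

lemma sets_hyp_area [simp, measurable_cong]: "sets hyp_area = sets borel"
  by (simp add: hyp_area_def)
lemma uhp_borel [measurable, simp]: "uhp \<in> sets borel"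
  by (simp add: borel_open open_uhp)

lemma emeasure_hyp_area:
  assumes [measurable]: "S \<in> sets borel" and "S \<subseteq> uhp"
  shows "emeasure hyp_area S = (\<integral>\<^sup>+\<tau>\<in>S. ennreal (1 / (Im \<tau>)\<^sup>2) \<partial>lborel)"
proof -
  have "emeasure hyp_area S = (\<integral>\<^sup>+\<tau>\<in>S. (indicator uhp \<tau> * ennreal (1 / (Im \<tau>)\<^sup>2)) \<partial>lborel)"
    unfolding hyp_area_def by (rule emeasure_density) auto
  also have "\<dots> = (\<integral>\<^sup>+\<tau>\<in>S. ennreal (1 / (Im \<tau>)\<^sup>2) \<partial>lborel)"
    by (intro nn_integral_cong) (use assms(2) in \<open>auto simp: indicator_def\<close>)
  finally show ?thesis .
qed

lemma borel_moeb_vimage: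
  assumes "A \<in> SL2R" "S \<in> sets borel"
  shows "{w \<in> uhp. moeb A w \<in> S} \<in> sets borel"
proof -
  have "continuous_on uhp (moeb A)"
    by (intro holomorphic_on_imp_continuous_on holomorphic_moeb assms)
  then have "moeb A \<in> borel_measurable (restrict_space borel uhp)"
    by (rule borel_measurable_continuous_on_restrict)
  from measurable_sets[OF this assms(2)]
  show ?thesis by (auto simp: sets_restrict_space_iff space_restrict_space vimage_def Int_def conj_commute)
qed

lemma moeb_image_eq:
  assumes "A \<in> SL2R" "S \<subseteq> uhp"
  shows "moeb A ` S = {w \<in> uhp. moeb (adj2 A) w \<in> S}"
proof -
  have "moeb (adj2 A) (moeb A w) = w" if "w \<in> uhp" for w
    using that assms moeb_mult[of "adj2 A" A w] by simp
  moreover have "moeb A (moeb (adj2 A) w) = w" if "w \<in> uhp" for w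
    using that assms moeb_mult[of A "adj2 A" w] by simp
  ultimately show ?thesis using assms by (force simp: image_iff)
qed

lemma moeb_has_field_derivative:
  assumes "A \<in> SL2R" "\<tau> \<in> uhp"
  shows "(moeb A has_field_derivative 1 / (jfac A \<tau>)\<^sup>2) (at \<tau>)"
proof -
  have nz: "of_real (A$2$1) * \<tau> + of_real (A$2$2) \<noteq> 0"
    using jfac_nonzero[OF assms] by (simp add: jfac_def)
  have det: "complex_of_real (A$1$1) * of_real (A$2$2) - of_real (A$1$2) * of_real (A$2$1) = 1"
    using assms(1) by (simp add: SL2R_iff flip: of_real_mult of_real_diff)
  have "((\<lambda>\<tau>. (of_real (A$1$1) * \<tau> + of_real (A$1$2)) / (of_real (A$2$1) * \<tau> + of_real (A$2$2)))
    has_field_derivative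
     (of_real (A$1$1) * (of_real (A$2$1) * \<tau> + of_real (A$2$2)) - (of_real (A$1$1) * \<tau> + of_real (A$1$2)) * of_real (A$2$1))
      / ((of_real (A$2$1) * \<tau> + of_real (A$2$2)) * (of_real (A$2$1) * \<tau> + of_real (A$2$2)))) (at \<tau>)"
    using nz by (auto intro!: derivative_eq_intros)
  also have "of_real (A$1$1) * (of_real (A$2$1) * \<tau> + of_real (A$2$2)) - (of_real (A$1$1) * \<tau> + of_real (A$1$2)) * of_real (A$2$1)
     = complex_of_real (A$1$1) * of_real (A$2$2) - of_real (A$1$2) * of_real (A$2$1)"
    by (simp add: algebra_simps)
  finally show ?thesis unfolding det by (simp add: moeb_def [abs_def] jfac_def power2_eq_square)
qed

lemma det_complex_mult: "det (matrix (of_complex2 \<circ> (*) m \<circ> to_complex)) = (cmod m)\<^sup>2"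
  unfolding cmod_power2 by (simp add: det_2 matrix_def power2_eq_square axis_def)

text \<open>The Jacobian \<open>|j|\<^bsup>-4\<^esup>\<close> of a Moebius map is the square of the factor by which it
changes the imaginary part, which is exactly what the density \<open>1/y\<^sup>2\<close> compensates.\<close>

lemma emeasure_hyp_area_image:
  assumes A: "A \<in> SL2R" and S [measurable]: "S \<in> sets borel" and sub: "S \<subseteq> uhp"
  shows "emeasure hyp_area (moeb A ` S) = emeasure hyp_area S"
proof -
  define g where "g = of_complex2 \<circ> moeb A \<circ> to_complex"
  define T where "T = to_complex -` S"
  define g' where "g' = (\<lambda>x. of_complex2 \<circ> (*) (1 / (jfac A (to_complex x))\<^sup>2) \<circ> to_complex)"
  define u :: "real^2 \<Rightarrow> real" where "u = (\<lambda>x. 1 / (x$2)\<^sup>2)"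
  have [measurable]: "u \<in> borel_measurable borel"
    unfolding u_def by measurable
  have image_borel [measurable]: "moeb A ` S \<in> sets borel"
    unfolding moeb_image_eq[OF A sub] by (rule borel_moeb_vimage) (use A S in auto)
  have T [measurable]: "T \<in> sets borel"
    unfolding T_def using measurable_sets[OF measurable_to_complex S] by simp
  have gT: "g ` T = to_complex -` (moeb A ` S)"
  proof (rule Set.set_eqI)
    fix y
    have "y \<in> g ` T \<longleftrightarrow> (\<exists>x. to_complex x \<in> S \<and> y = of_complex2 (moeb A (to_complex x)))"
      by (auto simp: g_def T_def image_iff)
    also have "\<dots> \<longleftrightarrow> (\<exists>z\<in>S. y = of_complex2 (moeb A z))"
      by (metis to_complex_inverse(1))
    also have "\<dots> \<longleftrightarrow> y \<in> to_complex -` (moeb A ` S)"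
      by (auto simp: image_iff) (metis to_complex_inverse(2))
    finally show "y \<in> g ` T \<longleftrightarrow> y \<in> to_complex -` (moeb A ` S)" .
  qed
  have gTb [measurable]: "g ` T \<in> sets borel"
    unfolding gT using measurable_sets[OF measurable_to_complex image_borel] by simp
  have xT: "to_complex x \<in> uhp" if "x \<in> T" for x using that sub by (auto simp: T_def)
  have transfer: "emeasure hyp_area R = (\<integral>\<^sup>+x\<in>to_complex -` R. ennreal (u x) \<partial>lborel)"
    if [measurable]: "R \<in> sets borel" and "R \<subseteq> uhp" for R
  proof -
    have "emeasure hyp_area R = (\<integral>\<^sup>+\<tau>\<in>R. ennreal (1 / (Im \<tau>)\<^sup>2) \<partial>distr lborel borel to_complex)"
      using that by (simp add: emeasure_hyp_area lborel_complex_eq_distr [symmetric])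
    also have "\<dots> = (\<integral>\<^sup>+x. (ennreal (1 / (Im (to_complex x))\<^sup>2) * indicator R (to_complex x)) \<partial>lborel)"
      by (subst nn_integral_distr) auto
    also have "\<dots> = (\<integral>\<^sup>+x\<in>to_complex -` R. ennreal (u x) \<partial>lborel)"
      by (intro nn_integral_cong) (auto simp: u_def indicator_def)
    finally show ?thesis .
  qed
  have der: "(g has_derivative g' x) (at x within T)" if "x \<in> T" for x
    unfolding g_def g'_def comp_assoc
    apply (rule diff_chain_within)
     apply (rule diff_chain_within)
      apply (rule bounded_linear_imp_has_derivative[OF bounded_linear_to_complex])
    using moeb_has_field_derivative[OF A xT[OF that]]
     apply (simp add: has_field_derivative_def has_derivative_at_withinI)
    apply (rule bounded_linear_imp_has_derivative[OF bounded_linear_of_complex2])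
    done
  have inj: "inj_on g T"
  proof (rule inj_onI)
    fix x y assume xy: "x \<in> T" "y \<in> T" "g x = g y"
    then have "moeb A (to_complex x) = moeb A (to_complex y)"
      unfolding g_def by (metis comp_apply to_complex_inverse(1))
    then have "moeb (adj2 A) (moeb A (to_complex x)) = moeb (adj2 A) (moeb A (to_complex y))" by simp
    then have "to_complex x = to_complex y"
      using A xT xy by (simp add: moeb_mult[symmetric])
    then show "x = y" by (metis to_complex_inverse(2))
  qed
  have det: "\<bar>det (matrix (g' x))\<bar> * u (g x) = u x" if "x \<in> T" for x
  proof -
    let ?m = "1 / (jfac A (to_complex x))\<^sup>2"
    have "det (matrix (g' x)) = (cmod ?m)\<^sup>2"
      unfolding g'_def by (rule det_complex_mult)
    also have "\<dots> = 1 / (cmod (jfac A (to_complex x)))^4"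
      by (simp add: norm_divide norm_power power_divide)
    finally have d: "det (matrix (g' x)) = 1 / (cmod (jfac A (to_complex x)))^4" .
    have "g x $ 2 = x$2 / (cmod (jfac A (to_complex x)))\<^sup>2"
      using Im_moeb[OF A xT[OF that]] by (simp add: g_def)
    moreover have "cmod (jfac A (to_complex x)) \<noteq> 0" using A xT[OF that] by simp
    moreover have "x$2 \<noteq> 0" using xT[OF that] by (simp add: uhp_iff)
    ultimately show ?thesis unfolding d u_def
      by (simp add: power_divide)
  qed
  let ?f = "\<lambda>x. u x *\<^sub>R (axis 1 1 :: real^1)"
  have cong1: "(\<lambda>x. \<bar>det (matrix (g' x))\<bar> *\<^sub>R ?f (g x)) absolutely_integrable_on T \<longleftrightarrow> ?f absolutely_integrable_on T"
    by (rule set_integrable_cong) (use det in auto)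
  have cong2: "integral T (\<lambda>x. \<bar>det (matrix (g' x))\<bar> *\<^sub>R ?f (g x)) = integral T ?f"
    by (rule integral_cong) (use det in auto)
  have key: "?f absolutely_integrable_on T \<and> integral T ?f = b \<longleftrightarrow>
    ?f absolutely_integrable_on g ` T \<and> integral (g ` T) ?f = b" for b
    using has_absolute_integral_change_of_variables[OF _ der inj, of ?f b] cong1 cong2 T by auto
  have key2: "(\<integral>\<^sup>+x\<in>T. ennreal (u x) \<partial>lborel) = ennreal r \<and> r \<ge> 0 \<longleftrightarrow>
     (\<integral>\<^sup>+x\<in>g ` T. ennreal (u x) \<partial>lborel) = ennreal r \<and> r \<ge> 0" for r
    using nn_integral_iff_absolutely_integrable[OF T, of u r] nn_integral_iff_absolutely_integrable[OF gTb, of u r]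
      key[of "r *\<^sub>R axis 1 1"] by (simp add: u_def)
  have "(\<integral>\<^sup>+x\<in>T. ennreal (u x) \<partial>lborel) = (\<integral>\<^sup>+x\<in>g ` T. ennreal (u x) \<partial>lborel)"
    (is "?a = ?b")
  proof (cases ?a rule: ennreal_cases)
    case (real r)
    then show ?thesis using key2[of r] by auto
  next
    case top
    have "?b \<noteq> ennreal r" if "r \<ge> 0" for r
      using key2[of r] that top by (metis ennreal_neq_top)
    then have "?b = \<infinity>" by (cases ?b rule: ennreal_cases) auto
    then show ?thesis using top by simp
  qed
  moreover have "moeb A ` S \<subseteq> uhp" using A sub by auto
  ultimately show ?thesis
    using transfer[OF S sub] transfer[OF image_borel] by (simp only: gT[symmetric] T_def[symmetric])
qed

section \<open>The thick part is compact modulo the group\<close>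

text \<open>Every ball of radius \<open>d/2\<close> of a finite cover contains at most one point of a
\<open>d\<close>-separated set.\<close>

lemma separated_card_bound:
  fixes K :: "'a::metric_space set"
  assumes K: "compact K" and d: "d > 0"
  shows "\<exists>M. \<forall>S\<subseteq>K. (\<forall>x\<in>S. \<forall>y\<in>S. dist x y < d \<longrightarrow> x = y) \<longrightarrow> finite S \<and> card S \<le> M"
proof -
  have "K \<subseteq> (\<Union>c\<in>K. ball c (d/2))" using d by auto
  then obtain C where C: "C \<subseteq> K" "finite C" "K \<subseteq> (\<Union>c\<in>C. ball c (d/2))"
    using compactE_image[OF K, of K "\<lambda>c. ball c (d/2)"] by auto
  show ?thesis
  proof (intro exI[of _ "card C"] allI impI)
    fix S assume S: "S \<subseteq> K" and sep: "\<forall>x\<in>S. \<forall>y\<in>S. dist x y < d \<longrightarrow> x = y"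
    have "\<forall>x\<in>S. \<exists>c\<in>C. dist c x < d/2"
    proof
      fix x assume "x \<in> S"
      then have "x \<in> (\<Union>c\<in>C. ball c (d/2))" using S C(3) by blast
      then show "\<exists>c\<in>C. dist c x < d/2" unfolding UN_iff mem_ball .
    qed
    then obtain f where f: "\<And>x. x \<in> S \<Longrightarrow> f x \<in> C \<and> dist (f x) x < d/2" by metis
    have inj: "inj_on f S"
    proof (rule inj_onI)
      fix x y assume xy: "x \<in> S" "y \<in> S" "f x = f y"
      have "dist x y \<le> dist (f x) x + dist (f x) y" by (rule dist_triangle3)
      then have "dist x y < d" using f[OF xy(1)] f[OF xy(2)] xy(3) by simp
      then show "x = y" using sep xy by blast
    qed
    have "f ` S \<subseteq> C" using f by auto
    with inj C(2) show "finite S \<and> card S \<le> card C"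
      by (meson card_inj_on_le inj_on_finite)
  qed
qed

lemma measurable_nn_integral_count_space:
  fixes f :: "'i \<Rightarrow> 'a \<Rightarrow> ennreal"
  assumes "countable I" and [measurable]: "\<And>i. i \<in> I \<Longrightarrow> f i \<in> borel_measurable M"
  shows "(\<lambda>x. \<integral>\<^sup>+i. f i x \<partial>count_space I) \<in> borel_measurable M"
proof (cases "finite I")
  case True
  then show ?thesis by (simp add: nn_integral_count_space_finite)
next
  case False
  then have [simp]: "I \<noteq> {}" by auto
  note * = bij_betw_from_nat_into[OF \<open>countable I\<close> False]
  have **: "(\<integral>\<^sup>+i. f i x \<partial>count_space I) = suminf (\<lambda>n. f (from_nat_into I n) x)" for x
    by (simp add: nn_integral_bij_count_space[symmetric, OF *] nn_integral_count_space_nat)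
  show ?thesis unfolding ** by (rule borel_measurable_suminf_order) (simp add: from_nat_into)
qed

text \<open>Witness: the composition of the dilation by \<open>Im w\<close> with the translation by \<open>Re
w\<close>.\<close>

lemma SL2R_transitive:
  assumes "w \<in> uhp"
  obtains h where "h \<in> SL2R" "moeb h \<i> = w"
proof
  define y where "y = Im w"
  have y: "y > 0" using assms by (simp add: y_def uhp_iff)
  let ?h = "vector [vector [sqrt y, Re w / sqrt y], vector [0, 1 / sqrt y]] :: real^2^2"
  show "?h \<in> SL2R" using y by (simp add: SL2R_iff)
  have "sqrt y * sqrt y = y" using y by simp
  then show "moeb ?h \<i> = w" using y
    by (simp add: moeb_def complex_eq_iff y_def field_simps Re_divide_of_real Im_divide_of_real)
qed

text \<open>The stabiliser of \<open>i\<close> is compact, so \<open>A\<close> is bounded when \<open>Ai\<close> stays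
in a compact set; explicitly \<open>Im(Ai)\<close> and \<open>|Ai|\<^sup>2\<close> control the sums of squares of the
two rows.\<close>

lemma norm_le_of_moeb_i:
  assumes A: "A \<in> SL2R" and B: "moeb A \<i> \<in> ball \<i> (1/2)"
  shows "norm A \<le> 3"
proof -
  let ?z = "moeb A \<i>"
  have i: "\<i> \<in> uhp" by (simp add: uhp_iff)
  have c: "cmod (?z - \<i>) < 1/2" using B by (simp add: dist_norm norm_minus_commute)
  have "\<bar>Im (?z - \<i>)\<bar> < 1/2" using abs_Im_le_cmod[of "?z - \<i>"] c by linarith
  then have im: "Im ?z > 1/2" unfolding minus_complex.sel imaginary_unit.sel by arith
  have n: "(cmod (jfac A \<i>))\<^sup>2 = (A$2$1)\<^sup>2 + (A$2$2)\<^sup>2"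
    by (simp add: jfac_def cmod_power2)
  have pos: "(cmod (jfac A \<i>))\<^sup>2 > 0" using A i by simp
  have cd: "(A$2$1)\<^sup>2 + (A$2$2)\<^sup>2 < 2"
    using im pos Im_moeb[OF A i] unfolding n by (simp add: field_simps)
  have "cmod ?z \<le> cmod (?z - \<i>) + cmod \<i>" by (metis diff_add_cancel norm_triangle_ineq)
  then have z: "cmod ?z \<le> 3/2" using c by simp
  have "of_real (A$1$1) * \<i> + of_real (A$1$2) = ?z * jfac A \<i>"
    using A i by (simp add: moeb_eq)
  then have "(cmod (of_real (A$1$1) * \<i> + of_real (A$1$2)))\<^sup>2 = (cmod ?z)\<^sup>2 * (cmod (jfac A \<i>))\<^sup>2"
    by (simp add: norm_mult power_mult_distrib)
  then have "(A$1$1)\<^sup>2 + (A$1$2)\<^sup>2 = (cmod ?z)\<^sup>2 * ((A$2$1)\<^sup>2 + (A$2$2)\<^sup>2)"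
    unfolding n by (simp add: cmod_power2)
  also have "\<dots> \<le> (3/2)\<^sup>2 * 2"
    using z cd by (intro mult_mono power_mono) auto
  finally have "(norm A)\<^sup>2 \<le> 3\<^sup>2"
    using cd unfolding norm_sq_mat2 by (simp add: power2_eq_square)
  then show ?thesis by (rule power2_le_imp_le) simp
qed

lemma hyp_area_ball: "0 < emeasure hyp_area (ball \<i> (1/2))" "emeasure hyp_area (ball \<i> (1/2)) < \<infinity>"
  "ball \<i> (1/2) \<subseteq> uhp"
proof -
  have im: "1/2 \<le> Im z \<and> Im z \<le> 3/2" if "z \<in> ball \<i> (1/2)" for z
    using that abs_Im_le_cmod[of "z - \<i>"] by (auto simp: dist_norm norm_minus_commute)
  then show sub: "ball \<i> (1/2) \<subseteq> uhp" by (force simp: uhp_iff)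
  have eq: "emeasure hyp_area (ball \<i> (1/2)) = (\<integral>\<^sup>+\<tau>\<in>ball \<i> (1/2). ennreal (1 / (Im \<tau>)\<^sup>2) \<partial>lborel)"
    by (rule emeasure_hyp_area) (use sub in auto)
  have sq: "1/4 \<le> (Im z)\<^sup>2 \<and> (Im z)\<^sup>2 \<le> 9/4" if "z \<in> ball \<i> (1/2)" for z
    using im[OF that] power_mono[of "1/2" "Im z" 2] power_mono[of "Im z" "3/2" 2]
    by (auto simp: power2_eq_square)
  have "emeasure lborel (ball \<i> (1/2)) > 0"
    by (simp add: emeasure_ball)
  have "(\<integral>\<^sup>+\<tau>\<in>ball \<i> (1/2). ennreal (4/9) \<partial>lborel) \<le> emeasure hyp_area (ball \<i> (1/2))"
    unfolding eq
  proof (intro nn_integral_mono)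
    fix z show "ennreal (4/9) * indicator (ball \<i> (1/2)) z \<le> ennreal (1 / (Im z)\<^sup>2) * indicator (ball \<i> (1/2)) z"
    proof (cases "z \<in> ball \<i> (1/2)")
      case True
      have "4/9 \<le> 1 / (Im z)\<^sup>2" by (subst pos_le_divide_eq) (use sq[OF True] in linarith)+
      then show ?thesis by (intro mult_right_mono ennreal_leI) auto
    qed (auto simp: indicator_def)
  qed
  moreover have "(\<integral>\<^sup>+\<tau>\<in>ball \<i> (1/2). ennreal (4/9) \<partial>lborel) > 0"
    using \<open>emeasure lborel (ball \<i> (1/2)) > 0\<close>
    by (simp add: nn_integral_cmult_indicator ennreal_zero_less_mult_iff)
  ultimately show "0 < emeasure hyp_area (ball \<i> (1/2))" by order
  have "emeasure hyp_area (ball \<i> (1/2)) \<le> (\<integral>\<^sup>+\<tau>\<in>ball \<i> (1/2). ennreal 4 \<partial>lborel)"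
    unfolding eq
  proof (intro nn_integral_mono)
    fix z show "ennreal (1 / (Im z)\<^sup>2) * indicator (ball \<i> (1/2)) z \<le> ennreal 4 * indicator (ball \<i> (1/2)) z"
    proof (cases "z \<in> ball \<i> (1/2)")
      case True
      have "1 / (Im z)\<^sup>2 \<le> 4" by (subst pos_divide_le_eq) (use sq[OF True] in linarith)+
      then show ?thesis by (intro mult_right_mono ennreal_leI) auto
    qed (auto simp: indicator_def)
  qed
  also have "\<dots> < \<infinity>"
    using emeasure_lborel_ball_finite[of \<i> "1/2"]
    by (subst nn_integral_cmult_indicator) (auto simp: ennreal_mult_less_top)
  finally show "emeasure hyp_area (ball \<i> (1/2)) < \<infinity>" .
qed

locale finite_covolume = discrete_subgroup +
  fixes D
  assumes fd: "fundamental_domain \<Gamma> D"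
    and finite_area: "emeasure hyp_area D < \<infinity>"
begin

lemma D_borel [measurable]: "D \<in> sets borel" and D_sub: "D \<subseteq> uhp"
  and D_cover: "(\<Union>\<gamma>\<in>\<Gamma>. moeb \<gamma> ` D) = uhp"
  using fd by (auto simp: fundamental_domain_def)

text \<open>Unfolding: the sets \<open>gU\<close> all have the area of \<open>U\<close>; cut into the pieces \<open>gU
\<inter> \<gamma>D\<close> and moved back into \<open>D\<close> they cover each point at most \<open>M\<close>
times.\<close>

lemma translates_area_le:
  assumes X: "finite X" "X \<subseteq> SL2R" and U [measurable]: "U \<in> sets borel" and Usub: "U \<subseteq> uhp"
    and M: "\<And>w. w \<in> uhp \<Longrightarrow> (\<Sum>g\<in>X. \<integral>\<^sup>+\<gamma>. indicator U (moeb (adj2 g ** \<gamma>) w) \<partial>count_space \<Gamma>) \<le> M"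
  shows "of_nat (card X) * emeasure hyp_area U \<le> M * emeasure hyp_area D"
proof -
  have meas: "(\<lambda>w. indicator D w * indicator U (moeb A w) :: ennreal) \<in> borel_measurable borel" if "A \<in> SL2R" for A
  proof -
    have "(\<lambda>w. indicator D w * indicator U (moeb A w) :: ennreal) = indicator (D \<inter> {w \<in> uhp. moeb A w \<in> U})"
      using D_sub by (auto simp: indicator_def fun_eq_iff)
    then show ?thesis using borel_moeb_vimage[OF that U] by simp
  qed
  have one: "emeasure hyp_area U \<le> (\<integral>\<^sup>+w. indicator D w * (\<integral>\<^sup>+\<gamma>. indicator U (moeb (adj2 g ** \<gamma>) w) \<partial>count_space \<Gamma>) \<partial>hyp_area)"
    if g: "g \<in> X" for g
  proof -
    have gS: "g \<in> SL2R" "adj2 g \<in> SL2R" using g X by auto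
    define gU where "gU = moeb g ` U"
    have gU: "gU = {w \<in> uhp. moeb (adj2 g) w \<in> U}"
      unfolding gU_def by (rule moeb_image_eq[OF gS(1) Usub])
    have [measurable]: "gU \<in> sets borel" unfolding gU by (rule borel_moeb_vimage[OF gS(2) U])
    have tr [measurable]: "moeb \<gamma> ` D \<in> sets borel" if "\<gamma> \<in> \<Gamma>" for \<gamma>
      unfolding moeb_image_eq[OF SL2R_mem[OF that] D_sub] by (rule borel_moeb_vimage) (use that SL2R_mem in auto)
    have img: "moeb \<gamma> ` (D \<inter> {w \<in> uhp. moeb (adj2 g ** \<gamma>) w \<in> U}) = gU \<inter> moeb \<gamma> ` D" if "\<gamma> \<in> \<Gamma>" for \<gamma>
      using that D_sub gS SL2R_mem[OF that] by (auto simp: gU moeb_mult intro!: image_eqI)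
    have "emeasure hyp_area U = emeasure hyp_area gU"
      unfolding gU_def by (rule emeasure_hyp_area_image[OF gS(1) U Usub, symmetric])
    also have "\<dots> = (\<integral>\<^sup>+w. indicator gU w \<partial>hyp_area)" by simp
    also have "\<dots> \<le> (\<integral>\<^sup>+w. \<integral>\<^sup>+\<gamma>. indicator (gU \<inter> moeb \<gamma> ` D) w \<partial>count_space \<Gamma> \<partial>hyp_area)"
    proof (rule nn_integral_mono)
      fix w
      show "indicator gU w \<le> (\<integral>\<^sup>+\<gamma>. indicator (gU \<inter> moeb \<gamma> ` D) w \<partial>count_space \<Gamma> :: ennreal)"
      proof (cases "w \<in> gU")
        case True
        then have "w \<in> uhp" by (auto simp: gU)
        then obtain \<gamma> where \<gamma>: "\<gamma> \<in> \<Gamma>" "w \<in> moeb \<gamma> ` D" using D_cover by blast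
        have "(indicator gU w :: ennreal) = (\<integral>\<^sup>+\<gamma>'. indicator {\<gamma>} \<gamma>' \<partial>count_space \<Gamma>)"
          using True \<gamma>(1) by (simp add: one_ennreal_def)
        also have "\<dots> \<le> (\<integral>\<^sup>+\<gamma>. indicator (gU \<inter> moeb \<gamma> ` D) w \<partial>count_space \<Gamma>)"
          by (rule nn_integral_mono) (use True \<gamma> in \<open>auto simp: indicator_def\<close>)
        finally show ?thesis .
      qed simp
    qed
    also have "\<dots> = (\<integral>\<^sup>+\<gamma>. \<integral>\<^sup>+w. indicator (gU \<inter> moeb \<gamma> ` D) w \<partial>hyp_area \<partial>count_space \<Gamma>)"
      by (rule nn_integral_count_space_nn_integral[OF countable_group]) measurable
    also have "\<dots> = (\<integral>\<^sup>+\<gamma>. \<integral>\<^sup>+w. (indicator D w * indicator U (moeb (adj2 g ** \<gamma>) w)) \<partial>hyp_area \<partial>count_space \<Gamma>)"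
    proof (rule nn_integral_cong)
      fix \<gamma> assume "\<gamma> \<in> space (count_space \<Gamma>)"
      then have \<gamma>: "\<gamma> \<in> \<Gamma>" by simp
      have S: "adj2 g ** \<gamma> \<in> SL2R" using gS \<gamma> SL2R_mem by auto
      have B: "D \<inter> {w \<in> uhp. moeb (adj2 g ** \<gamma>) w \<in> U} \<in> sets borel"
        using borel_moeb_vimage[OF S U] by simp
      have "(\<integral>\<^sup>+w. indicator (gU \<inter> moeb \<gamma> ` D) w \<partial>hyp_area) = emeasure hyp_area (gU \<inter> moeb \<gamma> ` D)"
        using tr[OF \<gamma>] by simp
      also have "\<dots> = emeasure hyp_area (D \<inter> {w \<in> uhp. moeb (adj2 g ** \<gamma>) w \<in> U})"
        unfolding img[OF \<gamma>, symmetric] using emeasure_hyp_area_image[OF SL2R_mem[OF \<gamma>] B] D_sub by auto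
      also have "\<dots> = (\<integral>\<^sup>+w. indicator (D \<inter> {w \<in> uhp. moeb (adj2 g ** \<gamma>) w \<in> U}) w \<partial>hyp_area)"
        using B by simp
      also have "\<dots> = (\<integral>\<^sup>+w. (indicator D w * indicator U (moeb (adj2 g ** \<gamma>) w)) \<partial>hyp_area)"
        by (rule nn_integral_cong) (use D_sub in \<open>auto simp: indicator_def\<close>)
      finally show "(\<integral>\<^sup>+w. indicator (gU \<inter> moeb \<gamma> ` D) w \<partial>hyp_area) = \<dots>" .
    qed
    also have "\<dots> = (\<integral>\<^sup>+w. \<integral>\<^sup>+\<gamma>. (indicator D w * indicator U (moeb (adj2 g ** \<gamma>) w)) \<partial>count_space \<Gamma> \<partial>hyp_area)"
      by (rule nn_integral_count_space_nn_integral[OF countable_group, symmetric])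
        (use gS SL2R_mem meas in auto)
    also have "\<dots> = (\<integral>\<^sup>+w. indicator D w * (\<integral>\<^sup>+\<gamma>. indicator U (moeb (adj2 g ** \<gamma>) w) \<partial>count_space \<Gamma>) \<partial>hyp_area)"
      by (intro nn_integral_cong nn_integral_cmult) auto
    finally show ?thesis .
  qed
  have "of_nat (card X) * emeasure hyp_area U = (\<Sum>g\<in>X. emeasure hyp_area U)" by simp
  also have "\<dots> \<le> (\<Sum>g\<in>X. \<integral>\<^sup>+w. indicator D w * (\<integral>\<^sup>+\<gamma>. indicator U (moeb (adj2 g ** \<gamma>) w) \<partial>count_space \<Gamma>) \<partial>hyp_area)"
    by (intro sum_mono one)
  also have "\<dots> = (\<integral>\<^sup>+w. (\<Sum>g\<in>X. indicator D w * (\<integral>\<^sup>+\<gamma>. indicator U (moeb (adj2 g ** \<gamma>) w) \<partial>count_space \<Gamma>)) \<partial>hyp_area)"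
  proof (rule nn_integral_sum [symmetric])
    fix g assume g: "g \<in> X"
    have "(\<lambda>w. \<integral>\<^sup>+\<gamma>. indicator D w * indicator U (moeb (adj2 g ** \<gamma>) w) \<partial>count_space \<Gamma>) \<in> borel_measurable borel"
      by (rule measurable_nn_integral_count_space) (use countable_group meas X g SL2R_mem in auto)
    then show "(\<lambda>w. indicator D w * (\<integral>\<^sup>+\<gamma>. indicator U (moeb (adj2 g ** \<gamma>) w) \<partial>count_space \<Gamma>)) \<in> borel_measurable hyp_area"
      by (simp add: nn_integral_cmult measurable_cong_sets[OF sets_hyp_area refl])
  qed
  also have "\<dots> \<le> (\<integral>\<^sup>+w. M * indicator D w \<partial>hyp_area)"
  proof (rule nn_integral_mono)
    fix w
    show "(\<Sum>g\<in>X. indicator D w * (\<integral>\<^sup>+\<gamma>. indicator U (moeb (adj2 g ** \<gamma>) w) \<partial>count_space \<Gamma>)) \<le> M * indicator D w"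
      using M[of w] D_sub by (auto simp: indicator_def sum_distrib_left[symmetric])
  qed
  also have "\<dots> = M * emeasure hyp_area D" by (simp add: nn_integral_cmult_indicator)
  finally show ?thesis .
qed

text \<open>Choose a maximal set \<open>X\<close> of thick elements whose \<open>\<Gamma>\<close>-translates are
mutually far apart. By separation the matrices \<open>g\<inverse>\<gamma>h\<close> that map \<open>i\<close> into a
fixed ball are separated and bounded, so there are at most \<open>M\<close> of them, and the area inequality bounds
\<open>card X\<close>. By maximality every thick element is, modulo \<open>\<Gamma>\<close>, close to one of the
finitely many elements of \<open>X\<close>.\<close>

lemma thick_part_cocompact:
  assumes e: "e > 0"
  shows "\<exists>R. \<forall>g\<in>SL2R. (\<forall>\<gamma>\<in>\<Gamma>. norm (conj_by g \<gamma> - mat 1) < e \<longrightarrow> \<gamma> = mat 1) \<longrightarrow>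
           (\<exists>\<gamma>\<in>\<Gamma>. norm (\<gamma> ** g) \<le> R)"
proof -
  define sep where "sep X \<longleftrightarrow> X \<subseteq> SL2R \<and>
    (\<forall>g\<in>X. \<forall>g'\<in>X. \<forall>\<gamma>\<in>\<Gamma>. norm (adj2 g ** \<gamma> ** g' - mat 1) < e \<longrightarrow> g = g' \<and> \<gamma> = mat 1)" for X
  let ?U = "ball \<i> (1/2)"
  have "compact (cball 0 3 :: (real^2^2) set)" by simp
  moreover have "e/3 > 0" using e by simp
  ultimately obtain M where
    M: "\<forall>S\<subseteq>(cball 0 3 :: (real^2^2) set). (\<forall>x\<in>S. \<forall>y\<in>S. dist x y < e/3 \<longrightarrow> x = y) \<longrightarrow> finite S \<and> card S \<le> M"
    using separated_card_bound[of "cball 0 3 :: (real^2^2) set" "e/3"] by blast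
  \<comment> \<open>At most \<open>M\<close> pairs \<open>(g, \<gamma>)\<close> send \<open>\<gamma>w\<close> into \<open>gU\<close>: by separation of \<open>X\<close> they give separated bounded matrices \<open>F(g, \<gamma>)\<close>.\<close>
  have count: "(\<Sum>g\<in>X. \<integral>\<^sup>+\<gamma>. indicator ?U (moeb (adj2 g ** \<gamma>) w) \<partial>count_space \<Gamma>) \<le> of_nat M"
    if X: "finite X" "sep X" and w: "w \<in> uhp" for X w
  proof -
    obtain h where h: "h \<in> SL2R" "moeb h \<i> = w" using SL2R_transitive[OF w] .
    have i: "\<i> \<in> uhp" by (simp add: uhp_iff)
    define P where "P = (SIGMA g:X. {\<gamma> \<in> \<Gamma>. moeb (adj2 g ** \<gamma>) w \<in> ?U})"
    define F where "F = (\<lambda>(g, \<gamma>). adj2 g ** \<gamma> ** h)"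
    have XS: "X \<subseteq> SL2R" using X by (simp add: sep_def)
    have FS: "F p \<in> SL2R \<and> norm (F p) \<le> 3" if "p \<in> P" for p
    proof -
      obtain g \<gamma> where p: "p = (g, \<gamma>)" "g \<in> X" "\<gamma> \<in> \<Gamma>" "moeb (adj2 g ** \<gamma>) w \<in> ?U"
        using \<open>p \<in> P\<close> by (auto simp: P_def)
      have S: "adj2 g ** \<gamma> \<in> SL2R" using p XS SL2R_mem by auto
      have "moeb (adj2 g ** \<gamma> ** h) \<i> = moeb (adj2 g ** \<gamma>) w"
        using moeb_mult[OF S h(1) i] h(2) by simp
      then show ?thesis using norm_le_of_moeb_i[of "adj2 g ** \<gamma> ** h"] S h(1) p by (simp add: F_def)
    qed
    have key: "p = p'" if pp: "p \<in> P" "p' \<in> P" "dist (F p) (F p') < e/3" for p p'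
    proof -
      obtain g \<gamma> where p: "p = (g, \<gamma>)" "g \<in> X" "\<gamma> \<in> \<Gamma>" using pp(1) by (auto simp: P_def)
      obtain g' \<gamma>' where p': "p' = (g', \<gamma>')" "g' \<in> X" "\<gamma>' \<in> \<Gamma>" using pp(2) by (auto simp: P_def)
      have "F p ** adj2 (F p') - mat 1 = (F p - F p') ** adj2 (F p')"
        using FS[OF that(2)] by (simp add: matrix_diff_rdistrib)
      then have "norm (F p ** adj2 (F p') - mat 1) \<le> norm (F p - F p') * norm (F p')"
        by (metis norm_adj2 norm_mat2_mult_le)
      also have "\<dots> \<le> norm (F p - F p') * 3"
        using FS[OF that(2)] by (intro mult_left_mono) auto
      also have "\<dots> < e" using that(3) by (simp add: dist_norm)
      finally have "norm (F p ** adj2 (F p') - mat 1) < e" .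
      moreover have "F p ** adj2 (F p') = adj2 g ** (\<gamma> ** adj2 \<gamma>') ** g'"
        using h(1) by (simp add: F_def p p' matrix_mul_assoc[symmetric])
      ultimately have "g = g' \<and> \<gamma> ** adj2 \<gamma>' = mat 1"
        using X(2) p(2,3) p'(2,3) mult_closed[OF p(3) adj2_closed[OF p'(3)]] unfolding sep_def by metis
      moreover from this have "\<gamma> ** adj2 \<gamma>' ** \<gamma>' = \<gamma>'" by simp
      then have "\<gamma> = \<gamma>'" using p'(3) SL2R_mem by (simp add: matrix_mul_assoc[symmetric])
      ultimately show ?thesis using p p' by simp
    qed
    have inj: "inj_on F P" using key e by (intro inj_onI) auto
    have fin: "finite (F ` P) \<and> card (F ` P) \<le> M"
    proof (rule M[rule_format])
      show "F ` P \<subseteq> cball 0 3" using FS by auto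
      show "x = y" if "x \<in> F ` P" "y \<in> F ` P" "dist x y < e/3" for x y
        using that key by blast
    qed
    then have finP: "finite P" and cardP: "card P \<le> M"
      using inj by (auto simp: finite_image_iff card_image)
    have finS: "finite {\<gamma> \<in> \<Gamma>. moeb (adj2 g ** \<gamma>) w \<in> ?U}" if "g \<in> X" for g
      using finP that unfolding P_def
      by (rule_tac finite_subset[of _ "snd ` P"]) (force simp: P_def image_iff)+
    have "(\<Sum>g\<in>X. \<integral>\<^sup>+\<gamma>. indicator ?U (moeb (adj2 g ** \<gamma>) w) \<partial>count_space \<Gamma>)
       = (\<Sum>g\<in>X. of_nat (card {\<gamma> \<in> \<Gamma>. moeb (adj2 g ** \<gamma>) w \<in> ?U}))"
    proof (rule sum.cong[OF refl])
      fix g assume "g \<in> X"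
      have "(\<integral>\<^sup>+\<gamma>. indicator ?U (moeb (adj2 g ** \<gamma>) w) \<partial>count_space \<Gamma>)
        = (\<integral>\<^sup>+\<gamma>. indicator {\<gamma> \<in> \<Gamma>. moeb (adj2 g ** \<gamma>) w \<in> ?U} \<gamma> \<partial>count_space \<Gamma>)"
        by (rule nn_integral_cong) (auto simp: indicator_def)
      also have "\<dots> = emeasure (count_space \<Gamma>) {\<gamma> \<in> \<Gamma>. moeb (adj2 g ** \<gamma>) w \<in> ?U}"
        by (rule nn_integral_indicator) auto
      also have "\<dots> = of_nat (card {\<gamma> \<in> \<Gamma>. moeb (adj2 g ** \<gamma>) w \<in> ?U})"
        using finS[OF \<open>g \<in> X\<close>] by (subst emeasure_count_space_finite) auto
      finally show "(\<integral>\<^sup>+\<gamma>. indicator ?U (moeb (adj2 g ** \<gamma>) w) \<partial>count_space \<Gamma>) = \<dots>" .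
    qed
    also have "\<dots> = of_nat (card P)"
      unfolding P_def using X(1) finS by (subst card_SigmaI) auto
    also have "\<dots> \<le> of_nat M" using cardP by simp
    finally show ?thesis .
  qed
  have "\<exists>N. \<forall>X. finite X \<and> sep X \<longrightarrow> card X \<le> N"
  proof -
    have area: "of_nat (card X) * emeasure hyp_area ?U \<le> of_nat M * emeasure hyp_area D"
      if "finite X" "sep X" for X
      by (rule translates_area_le) (use that count hyp_area_ball in \<open>auto simp: sep_def\<close>)
    obtain u where u: "emeasure hyp_area ?U = ennreal u" "u > 0"
      using hyp_area_ball by (cases "emeasure hyp_area ?U" rule: ennreal_cases) auto
    obtain a where a: "emeasure hyp_area D = ennreal a" "a \<ge> 0"
      using finite_area by (cases "emeasure hyp_area D" rule: ennreal_cases) auto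
    have "real (card X) \<le> M * a / u" if "finite X" "sep X" for X
    proof -
      have "ennreal (real (card X) * u) \<le> ennreal (real M * a)"
        using area[OF that] u a by (simp add: ennreal_mult ennreal_of_nat_eq_real_of_nat)
      then show ?thesis using u a by (simp add: ennreal_le_iff field_simps)
    qed
    then have "card X \<le> nat \<lfloor>M * a / u\<rfloor>" if "finite X" "sep X" for X
      using that by (simp add: le_nat_floor)
    then show ?thesis by blast
  qed
  then obtain N where N: "\<And>X. finite X \<Longrightarrow> sep X \<Longrightarrow> card X \<le> N" by blast
  have "finite {} \<and> sep {}" by (simp add: sep_def)
  then obtain X where X: "finite X" "sep X" and max: "\<And>Y. finite Y \<Longrightarrow> sep Y \<Longrightarrow> card Y \<le> card X"
  proof -
    have "\<exists>X. (finite X \<and> sep X) \<and> (\<forall>Y. finite Y \<and> sep Y \<longrightarrow> card Y \<le> card X)"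
      using \<open>finite {} \<and> sep {}\<close> by (rule ex_has_greatest_nat[where b = "Suc N"]) (use N in \<open>auto intro: le_imp_less_Suc\<close>)
    then show ?thesis using that by auto
  qed
  have XS: "X \<subseteq> SL2R" using X by (simp add: sep_def)
  show ?thesis
  proof (intro exI[of _ "(\<Sum>g\<in>X. norm g) * (e + 2)"] ballI impI)
    fix g assume g: "g \<in> SL2R" and thick: "\<forall>\<gamma>\<in>\<Gamma>. norm (conj_by g \<gamma> - mat 1) < e \<longrightarrow> \<gamma> = mat 1"
    \<comment> \<open>Otherwise \<open>g\<close> could be added to \<open>X\<close>; the case distinction treats a violation of separation in either order.\<close>
    have close: "\<exists>g'\<in>X. \<exists>\<gamma>\<in>\<Gamma>. norm (adj2 g' ** \<gamma> ** g - mat 1) < e"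
    proof (cases "g \<in> X")
      case True
      then show ?thesis using g e one_mem by (intro bexI[of _ g] bexI[of _ "mat 1"]) auto
    next
      case False
      then have "\<not> sep (insert g X)" using max[of "insert g X"] X by auto
      then obtain g1 g2 \<gamma> where h: "g1 \<in> insert g X" "g2 \<in> insert g X" "\<gamma> \<in> \<Gamma>"
        "norm (adj2 g1 ** \<gamma> ** g2 - mat 1) < e" "\<not> (g1 = g2 \<and> \<gamma> = mat 1)"
      proof -
        have "insert g X \<subseteq> SL2R" using g XS by blast
        with \<open>\<not> sep (insert g X)\<close> show ?thesis using that unfolding sep_def by blast
      qed
      show ?thesis
      proof (cases "g1 = g")
        case True
        show ?thesis
        proof (cases "g2 = g")
          case True
          then have "\<gamma> = mat 1" using h \<open>g1 = g\<close> thick g by (simp add: conj_by_SL2R)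
          then show ?thesis using True \<open>g1 = g\<close> h by simp
        next
          case False
          have "adj2 (adj2 g1 ** \<gamma> ** g2) = adj2 g2 ** adj2 \<gamma> ** g1" by (simp add: matrix_mul_assoc)
          then have "norm (adj2 g2 ** adj2 \<gamma> ** g - mat 1) < e"
            using h(4) norm_adj2_minus_one[of "adj2 g1 ** \<gamma> ** g2"] True by simp
          then show ?thesis using False h adj2_closed by blast
        qed
      next
        case False
        then have g1: "g1 \<in> X" using h by simp
        show ?thesis
        proof (cases "g2 = g")
          case True then show ?thesis using g1 h by blast
        next
          case False
          then have "g2 \<in> X" using h by simp
          then show ?thesis using X(2) g1 h unfolding sep_def by blast
        qed
      qed
    qed
    then obtain g' \<gamma> where g': "g' \<in> X" "\<gamma> \<in> \<Gamma>" "norm (adj2 g' ** \<gamma> ** g - mat 1) < e" by blast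
    let ?Y = "adj2 g' ** \<gamma> ** g"
    have "norm ?Y \<le> norm (?Y - mat 1) + norm (mat 1 :: real^2^2)"
      by (metis diff_add_cancel norm_triangle_ineq)
    then have Y: "norm ?Y \<le> e + 2" using g'(3) norm_one_mat2_le by linarith
    have "\<gamma> ** g = g' ** ?Y" using g'(1) XS by (auto simp: matrix_mul_assoc[symmetric])
    then have "norm (\<gamma> ** g) \<le> norm g' * norm ?Y" by (metis norm_mat2_mult_le)
    also have "\<dots> \<le> (\<Sum>g\<in>X. norm g) * (e + 2)"
      using Y X(1) g'(1) by (intro mult_mono member_le_sum) (auto intro: sum_nonneg)
    finally show "\<exists>\<gamma>\<in>\<Gamma>. norm (\<gamma> ** g) \<le> (\<Sum>g\<in>X. norm g) * (e + 2)" using g'(2) by blast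
  qed
qed

end

section \<open>Elements close to the identity commute\<close>

text \<open>The trace-free part. It vanishes exactly on scalar matrices, commutes with conjugation, and commuting
nonscalar matrices have proportional trace-free parts.\<close>

definition traceless :: "real^2^2 \<Rightarrow> real^2^2" where
  "traceless A = A - mat ((A$1$1 + A$2$2) / 2)"

lemma traceless_entries [simp]:
  "traceless A $ 1 $ 1 = (A$1$1 - A$2$2) / 2" "traceless A $ 1 $ 2 = A$1$2"
  "traceless A $ 2 $ 1 = A$2$1" "traceless A $ 2 $ 2 = - ((A$1$1 - A$2$2) / 2)"
  by (simp_all add: traceless_def field_simps)

lemma traceless_conj_by: "g \<in> SL2R \<Longrightarrow> traceless (conj_by g A) = conj_by g (traceless A)"
proof -
  assume g: "g \<in> SL2R"
  have "conj_by g (mat c) = mat c" for c :: real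
  proof -
    have "mat c ** g = g ** mat c" by (simp add: mat2_eq_iff)
    then have "conj_by g (mat c) = adj2 g ** (g ** mat c)"
      using g by (simp add: conj_by_SL2R matrix_mul_assoc[symmetric])
    then show ?thesis using g by simp
  qed
  moreover have "conj_by g A $ 1 $ 1 + conj_by g A $ 2 $ 2 = (A$1$1 + A$2$2) * (g$1$1 * g$2$2 - g$1$2 * g$2$1)"
    using g by (simp add: conj_by_SL2R algebra_simps)
  ultimately show ?thesis
    using g unfolding traceless_def by (simp add: conj_by_diff SL2R_iff)
qed

lemma norm_traceless_le: "norm (traceless A) \<le> norm (A - mat 1)"
proof -
  have "(norm (traceless A))\<^sup>2 \<le> (norm (A - mat 1))\<^sup>2"
    unfolding norm_sq_mat2 using zero_le_power2[of "A$1$1 + A$2$2 - 2"]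
    by (simp add: power2_eq_square field_simps)
  then show ?thesis by (rule power2_le_imp_le) simp
qed

lemma traceless_eq_0_SL2R:
  assumes "A \<in> SL2R"
  shows "traceless A = 0 \<longleftrightarrow> A = mat 1 \<or> A = - mat 1"
proof
  assume "traceless A = 0"
  then have e: "A$1$1 = A$2$2" "A$1$2 = 0" "A$2$1 = 0"
    using traceless_entries[of A] by auto
  then have "(A$2$2)\<^sup>2 = 1" using assms by (simp add: SL2R_iff power2_eq_square)
  then have "A$2$2 = 1 \<or> A$2$2 = -1" by (simp add: power2_eq_1_iff)
  then show "A = mat 1 \<or> A = - mat 1" using e by (auto simp: mat2_eq_iff)
qed (auto simp: mat2_eq_iff)

lemma commute_iff:
  fixes A B :: "real^2^2"
  shows "A ** B = B ** A \<longleftrightarrow>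
    A$1$2 * B$2$1 = A$2$1 * B$1$2 \<and> A$1$2 * (B$1$1 - B$2$2) = (A$1$1 - A$2$2) * B$1$2 \<and>
    A$2$1 * (B$1$1 - B$2$2) = (A$1$1 - A$2$2) * B$2$1"
  unfolding mat2_eq_iff matrix_mult_entries by (simp add: algebra_simps) argo

lemma commute_imp_proportional:
  fixes A B :: "real^2^2"
  assumes "A ** B = B ** A" "traceless A \<noteq> 0"
  obtains \<alpha> where "traceless B = \<alpha> *\<^sub>R traceless A"
proof -
  note c = assms(1)[unfolded commute_iff]
  have "A$1$2 \<noteq> 0 \<or> A$2$1 \<noteq> 0 \<or> A$1$1 - A$2$2 \<noteq> 0"
    using assms(2) by (auto simp: mat2_eq_iff)
  then consider "A$1$2 \<noteq> 0" | "A$2$1 \<noteq> 0" | "A$1$1 - A$2$2 \<noteq> 0" by blast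
  then show ?thesis
  proof cases
    case 1
    then have "traceless B = (B$1$2 / A$1$2) *\<^sub>R traceless A"
      using c by (simp add: mat2_eq_iff field_simps)
    then show ?thesis by (rule that)
  next
    case 2
    then have "traceless B = (B$2$1 / A$2$1) *\<^sub>R traceless A"
      using c by (simp add: mat2_eq_iff field_simps)
    then show ?thesis by (rule that)
  next
    case 3
    then have "traceless B = ((B$1$1 - B$2$2) / (A$1$1 - A$2$2)) *\<^sub>R traceless A"
      using c by (simp add: mat2_eq_iff field_simps)
    then show ?thesis by (rule that)
  qed
qed

lemma commute_trans:
  fixes A B C :: "real^2^2"
  assumes "A ** B = B ** A" "A ** C = C ** A" "traceless A \<noteq> 0"
  shows "B ** C = C ** B"
proof -
  obtain \<alpha> where "traceless B = \<alpha> *\<^sub>R traceless A" using commute_imp_proportional assms by metis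
  then have b: "B$1$2 = \<alpha> * A$1$2" "B$2$1 = \<alpha> * A$2$1" "B$1$1 - B$2$2 = \<alpha> * (A$1$1 - A$2$2)"
    by (simp_all add: mat2_eq_iff)
  obtain \<beta> where "traceless C = \<beta> *\<^sub>R traceless A" using commute_imp_proportional assms by metis
  then have c: "C$1$2 = \<beta> * A$1$2" "C$2$1 = \<beta> * A$2$1" "C$1$1 - C$2$2 = \<beta> * (A$1$1 - A$2$2)"
    by (simp_all add: mat2_eq_iff)
  show ?thesis unfolding commute_iff b c by simp
qed

lemma conj_by_norm_le: "g \<in> SL2R \<Longrightarrow> norm (conj_by g A) \<le> (norm g)\<^sup>2 * norm A"
proof -
  assume g: "g \<in> SL2R"
  have "norm (conj_by g A) \<le> norm (adj2 g ** A) * norm g"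
    unfolding conj_by_SL2R[OF g] by (rule norm_mat2_mult_le)
  also have "\<dots> \<le> (norm (adj2 g) * norm A) * norm g"
    by (intro mult_right_mono norm_mat2_mult_le) auto
  finally show ?thesis by (simp add: power2_eq_square mult.commute mult.left_commute)
qed

lemma norm_le_near_one: "norm (A - mat 1 :: real^2^2) \<le> 1/10 \<Longrightarrow> norm A \<le> 21/10"
  using norm_one_mat2_le norm_triangle_ineq[of "A - mat 1" "mat 1"] by simp

text \<open>\<open>AB - BA = (A-1)(B-1) - (B-1)(A-1)\<close> is quadratically small. With distances below
\<open>1/10\<close> the resulting factor \<open>2 \<cdot> (1/10) \<cdot> (21/10)\<^sup>2\<close> is less than 1.\<close>

lemma commutator_contracts:
  assumes S: "A \<in> SL2R" "B \<in> SL2R" and A: "norm (A - mat 1) < 1/10" and B: "norm (B - mat 1) < 1/10" and ne: "A \<noteq> mat 1"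
  shows "norm (A ** B ** adj2 A ** adj2 B - mat 1) < norm (A - mat 1)"
proof -
  let ?X = "A - mat 1" and ?Y = "B - mat 1"
  have eq: "A ** B ** adj2 A ** adj2 B - mat 1 = (?X ** ?Y - ?Y ** ?X) ** (adj2 A ** adj2 B)"
  proof -
    have "?X ** ?Y - ?Y ** ?X = A ** B - B ** A"
      by (simp add: matrix_diff_ldistrib matrix_diff_rdistrib)
    then show ?thesis using S by (simp add: matrix_diff_rdistrib matrix_mul_assoc[symmetric])
  qed
  have nA: "norm A \<le> 21/10" "norm B \<le> 21/10" using A B norm_le_near_one by auto
  have x: "norm ?X > 0" using ne by simp
  have 1: "norm (?X ** ?Y - ?Y ** ?X) \<le> norm ?X * norm ?Y + norm ?Y * norm ?X"
    by (rule order_trans[OF norm_triangle_ineq4]) (intro add_mono norm_mat2_mult_le)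
  have 2: "norm (adj2 A ** adj2 B) \<le> 21/10 * (21/10)"
    by (rule order_trans[OF norm_mat2_mult_le]) (intro mult_mono; use nA in simp)
  have "norm (A ** B ** adj2 A ** adj2 B - mat 1) \<le> norm (?X ** ?Y - ?Y ** ?X) * norm (adj2 A ** adj2 B)"
    unfolding eq by (rule norm_mat2_mult_le)
  also have "\<dots> \<le> (norm ?X * norm ?Y + norm ?Y * norm ?X) * (21/10 * (21/10))"
    by (intro mult_mono 1 2) auto
  also have "\<dots> = norm ?X * (norm ?Y * (882/100))" by (simp add: algebra_simps)
  also have "\<dots> < norm ?X * 1"
    using B x by (intro mult_strict_left_mono) auto
  finally show ?thesis by simp
qed

context discrete_subgroup
begin

abbreviation small_at :: "real^2^2 \<Rightarrow> real^2^2 \<Rightarrow> bool" where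
  "small_at g A \<equiv> norm (conj_by g A - mat 1) < 1/10"

lemma small_at_nontrivial:
  assumes "g \<in> SL2R" "A \<in> \<Gamma>" "small_at g A" "A \<noteq> mat 1"
  shows "traceless A \<noteq> 0"
proof
  assume "traceless A = 0"
  then have "A = - mat 1" using assms traceless_eq_0_SL2R SL2R_mem by blast
  then have "conj_by g A = - mat 1"
    using assms(1) by (simp add: conj_by_SL2R) (simp add: mat2_eq_iff SL2R_iff algebra_simps)
  then have "conj_by g A - mat 1 = (-2) *\<^sub>R mat 1" by (simp add: mat2_eq_iff)
  then have "norm (conj_by g A - mat 1) = 2 * norm (mat 1 :: real^2^2)" by simp
  moreover have "norm (mat 1 :: real^2^2) \<ge> 1" by (rule norm_SL2R_ge) simp
  ultimately show False using assms by simp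
qed

lemma finite_small_at:
  assumes g: "g \<in> SL2R"
  shows "finite {A \<in> \<Gamma>. norm (conj_by g A - mat 1) \<le> c}"
proof (rule finite_subset[OF _ finite_bounded_part])
  show "{A \<in> \<Gamma>. norm (conj_by g A - mat 1) \<le> c} \<subseteq> {A \<in> \<Gamma>. norm A \<le> (norm g)\<^sup>2 * (c + 2)}"
  proof safe
    fix A assume "norm (conj_by g A - mat 1) \<le> c"
    then have c: "norm (conj_by g A) \<le> c + 2"
      using norm_one_mat2_le norm_triangle_ineq[of "conj_by g A - mat 1" "mat 1"] by simp
    have "conj_by (adj2 g) (conj_by g A) = A"
      using g by (subst conj_by_conj_by) (simp_all add: conj_by_SL2R)
    then have "norm A \<le> (norm (adj2 g))\<^sup>2 * norm (conj_by g A)"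
      using conj_by_norm_le[of "adj2 g" "conj_by g A"] g by simp
    also have "\<dots> \<le> (norm g)\<^sup>2 * (c + 2)" using c by (simp add: mult_left_mono)
    finally show "norm A \<le> (norm g)\<^sup>2 * (c + 2)" .
  qed
qed

text \<open>Let \<open>M \<noteq> 1\<close> be as close to 1 as possible at \<open>g\<close>. Its commutator with any
small element is still closer, hence trivial; so all small elements lie in the centraliser of \<open>M\<close>, which is
commutative.\<close>

lemma small_at_commute:
  assumes g: "g \<in> SL2R" and A: "A \<in> \<Gamma>" "small_at g A" and B: "B \<in> \<Gamma>" "small_at g B"
  shows "A ** B = B ** A"
proof (cases "A = mat 1")
  case False
  define S where "S = {A \<in> \<Gamma>. small_at g A \<and> A \<noteq> mat 1}"
  have "finite S"
    by (rule finite_subset[OF _ finite_small_at[OF g, of "1/10"]]) (auto simp: S_def)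
  moreover have "A \<in> S" using A False by (simp add: S_def)
  ultimately obtain M where M: "M \<in> S" and min: "\<And>C. C \<in> S \<Longrightarrow> norm (conj_by g M - mat 1) \<le> norm (conj_by g C - mat 1)"
    using arg_min_if_finite[of S "\<lambda>A. norm (conj_by g A - mat 1)"] by (metis empty_iff not_le)
  have com: "M ** C = C ** M" if C: "C \<in> \<Gamma>" "small_at g C" for C
  proof -
    let ?K = "M ** C ** adj2 M ** adj2 C"
    have MS: "M \<in> \<Gamma>" "small_at g M" "M \<noteq> mat 1" using M by (auto simp: S_def)
    have K: "?K \<in> \<Gamma>" using MS C by (intro mult_closed adj2_closed)
    have "conj_by g ?K = conj_by g M ** conj_by g C ** adj2 (conj_by g M) ** adj2 (conj_by g C)"
      using g by (simp add: conj_by_mult adj2_conj_by)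
    moreover have "conj_by g M \<noteq> mat 1" using MS g conj_by_cancel[OF g, of M "mat 1"] by simp
    ultimately have lt: "norm (conj_by g ?K - mat 1) < norm (conj_by g M - mat 1)"
      using commutator_contracts[of "conj_by g M" "conj_by g C"] MS C g SL2R_mem by simp
    then have "?K \<notin> S" using min by force
    then have "?K = mat 1" using K lt MS by (auto simp: S_def)
    then have "?K ** (C ** M) = C ** M" by simp
    moreover have "?K ** (C ** M) = M ** C"
      using MS C SL2R_mem by (simp add: matrix_mul_assoc[symmetric])
    ultimately show ?thesis by simp
  qed
  have "traceless M \<noteq> 0" using M small_at_nontrivial[OF g] by (auto simp: S_def)
  then show ?thesis using commute_trans com A B by blast
qed simp

text \<open>An element \<open>B\<close> commuting with \<open>A\<close> has trace-free part \<open>\<alpha>\<close>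
times that of \<open>A\<close>. The determinant bounds the trace of \<open>B\<close> in terms of
\<open>\<alpha>\<close>, so by discreteness \<open>|\<alpha>|\<close> is bounded away from 0; smallness of the conjugate
of \<open>B\<close> then bounds the conjugate of the trace-free part of \<open>A\<close>.\<close>

lemma traceless_bound_of_commuting_small:
  assumes A: "A \<in> \<Gamma>" "traceless A \<noteq> 0"
  shows "\<exists>R. \<forall>g\<in>SL2R. \<forall>B\<in>\<Gamma>. A ** B = B ** A \<longrightarrow> traceless B \<noteq> 0 \<longrightarrow> norm (conj_by g B - mat 1) \<le> 1 \<longrightarrow>
     norm (conj_by g (traceless A)) \<le> R"
proof -
  define \<rho> where "\<rho> = 2 * (1 + \<bar>det (traceless A)\<bar>) + norm (traceless A)"
  define F where "F = {B \<in> \<Gamma>. norm B \<le> \<rho> \<and> traceless B \<noteq> 0}"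
  define c where "c = Min (insert (norm (traceless A)) ((\<lambda>B. norm (traceless B)) ` F))"
  have "finite F" unfolding F_def by (rule finite_subset[OF _ finite_bounded_part[of \<rho>]]) auto
  then have cpos: "c > 0" and cA: "c \<le> norm (traceless A)" and cF: "\<And>B. B \<in> F \<Longrightarrow> c \<le> norm (traceless B)"
    using A unfolding c_def by (auto simp: F_def)
  show ?thesis
  proof (intro exI[of _ "norm (traceless A) / c"] ballI impI)
    fix g B assume g: "g \<in> SL2R" and B: "B \<in> \<Gamma>" "A ** B = B ** A" "traceless B \<noteq> 0"
      and small: "norm (conj_by g B - mat 1) \<le> 1"
    obtain \<alpha> where \<alpha>: "traceless B = \<alpha> *\<^sub>R traceless A" using commute_imp_proportional B A by metis
    have nB: "norm (traceless B) = \<bar>\<alpha>\<bar> * norm (traceless A)" by (simp add: \<alpha>)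
    have cB: "c \<le> norm (traceless B)"
    proof (cases "\<bar>\<alpha>\<bar> \<le> 1")
      case True
      define b where "b = (B$1$1 + B$2$2) / 2"
      have "B$1$1 * B$2$2 - B$1$2 * B$2$1 = 1" using SL2R_mem[OF B(1)] by (simp add: SL2R_iff)
      then have "b\<^sup>2 + det (traceless B) = 1"
        by (simp add: det_2 b_def power2_eq_square field_simps)
      moreover have "det (traceless B) = \<alpha>\<^sup>2 * det (traceless A)"
        unfolding \<alpha> det_2 by (simp add: power2_eq_square algebra_simps)
      moreover have "\<bar>\<alpha>\<^sup>2 * det (traceless A)\<bar> \<le> 1 * \<bar>det (traceless A)\<bar>"
        unfolding abs_mult using True by (intro mult_right_mono) (auto simp: abs_square_le_1)
      ultimately have "b\<^sup>2 \<le> 1 + \<bar>det (traceless A)\<bar>" by linarith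
      also have "\<dots> \<le> (1 + \<bar>det (traceless A)\<bar>)\<^sup>2" by (simp add: power2_eq_square algebra_simps)
      finally have "\<bar>b\<bar>\<^sup>2 \<le> (1 + \<bar>det (traceless A)\<bar>)\<^sup>2" by (simp only: power2_abs)
      then have b: "\<bar>b\<bar> \<le> 1 + \<bar>det (traceless A)\<bar>" by (rule power2_le_imp_le) linarith
      have "B = b *\<^sub>R mat 1 + traceless B" by (simp add: mat2_eq_iff b_def field_simps)
      then have "norm B \<le> \<bar>b\<bar> * norm (mat 1 :: real^2^2) + norm (traceless B)"
        by (metis norm_scaleR norm_triangle_ineq)
      also have "\<dots> \<le> (1 + \<bar>det (traceless A)\<bar>) * 2 + norm (traceless A)"
      proof (intro add_mono mult_mono b norm_one_mat2_le)
        show "norm (traceless B) \<le> norm (traceless A)" unfolding nB using True by (simp add: mult_left_le_one_le)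
      qed auto
      finally have "B \<in> F" using B by (simp add: F_def \<rho>_def)
      then show ?thesis by (rule cF)
    next
      case False
      then have "1 * norm (traceless A) \<le> \<bar>\<alpha>\<bar> * norm (traceless A)" by (intro mult_right_mono) auto
      then show ?thesis using cA nB by simp
    qed
    have "\<bar>\<alpha>\<bar> * norm (conj_by g (traceless A)) = norm (conj_by g (traceless B))"
    proof -
      have "conj_by g (traceless B) = \<alpha> *\<^sub>R conj_by g (traceless A)"
        using g by (simp add: \<alpha> conj_by_SL2R mat2_eq_iff algebra_simps)
      then show ?thesis by simp
    qed
    also have "\<dots> \<le> 1" using norm_traceless_le[of "conj_by g B"] small g by (simp add: traceless_conj_by)
    finally have 1: "\<bar>\<alpha>\<bar> * norm (conj_by g (traceless A)) \<le> 1" .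
    have "c * norm (conj_by g (traceless A)) \<le> norm (traceless B) * norm (conj_by g (traceless A))"
      using cB by (intro mult_right_mono) auto
    also have "\<dots> = norm (traceless A) * (\<bar>\<alpha>\<bar> * norm (conj_by g (traceless A)))" by (simp add: nB)
    also have "\<dots> \<le> norm (traceless A) * 1" using 1 by (intro mult_left_mono) auto
    finally show "norm (conj_by g (traceless A)) \<le> norm (traceless A) / c"
      using cpos by (simp add: field_simps)
  qed
qed

end

section \<open>The boundary of the thin part is thick\<close>

lemma continuous_on_mat2:
  fixes f :: "'a::topological_space \<Rightarrow> real^2^2"
  assumes "continuous_on S (\<lambda>x. f x $ 1 $ 1)" "continuous_on S (\<lambda>x. f x $ 1 $ 2)"
    "continuous_on S (\<lambda>x. f x $ 2 $ 1)" "continuous_on S (\<lambda>x. f x $ 2 $ 2)"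
  shows "continuous_on S f"
proof -
  have "continuous_on S (\<lambda>x. \<chi> i j. f x $ i $ j)"
  proof (intro continuous_on_vec_lambda)
    show "continuous_on S (\<lambda>x. f x $ i $ j)" for i j
      using assms exhaust_2[of i] exhaust_2[of j] by auto
  qed
  then show ?thesis by simp
qed

lemma continuous_on_conj_by:
  fixes p :: "'a::topological_space \<Rightarrow> real^2^2"
  assumes p: "continuous_on S p" and "\<And>x. x \<in> S \<Longrightarrow> p x \<in> SL2R"
  shows "continuous_on S (\<lambda>x. conj_by (p x) A)"
proof -
  have "continuous_on S (\<lambda>x. adj2 (p x) ** A ** p x)"
    by (rule continuous_on_mat2; simp only: matrix_mult_entries adj2_entries; intro continuous_intros p)
  then show ?thesis by (rule continuous_on_eq) (simp add: conj_by_SL2R assms)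
qed

text \<open>Conjugation by \<open>1 + sN\<close> changes some entry of \<open>X\<close> by an unbounded polynomial in
\<open>s\<close>: upper unipotents do this unless \<open>X\<close> is itself strictly upper triangular, and then lower
unipotents do.\<close>

lemma unipotent_path_escape:
  assumes tr: "X$1$1 + X$2$2 = 0" and ne: "X \<noteq> 0"
  obtains u :: "real \<Rightarrow> real^2^2" where "continuous_on {0..1} u" "u 0 = mat 1"
    "\<And>t. u t \<in> SL2R" "norm (conj_by (u 1) X) > R"
proof (cases "X$1$1 = 0 \<and> X$2$1 = 0")
  case False
  define u :: "real \<Rightarrow> real \<Rightarrow> real^2^2" where "u s t = vector [vector [1, s * t], vector [0, 1]]" for s t
  have S: "u s t \<in> SL2R" for s t by (simp add: u_def SL2R_iff)
  have cont: "continuous_on {0..1} (u s)" for s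
    by (rule continuous_on_mat2; simp add: u_def; intro continuous_intros)
  have one: "u s 0 = mat 1" for s by (simp add: u_def mat2_eq_iff)
  have c11: "conj_by (u s 1) X $ 1 $ 1 = X$1$1 - s * X$2$1" for s
    using S[of s 1] by (simp add: conj_by_SL2R u_def)
  have c12: "conj_by (u s 1) X $ 1 $ 2 = X$1$2 + 2 * X$1$1 * s - s^2 * X$2$1" for s
    using S[of s 1] tr by (simp add: conj_by_SL2R u_def algebra_simps power2_eq_square)
      (metis add.inverse_unique add.right_inverse mult_minus_right)
  have "\<exists>s. norm (conj_by (u s 1) X) > R"
  proof (cases "X$2$1 = 0")
    case True
    then have p: "X$1$1 \<noteq> 0" using False by simp
    define s where "s = (\<bar>R\<bar> + 1 - X$1$2) / (2 * X$1$1)"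
    have "conj_by (u s 1) X $ 1 $ 2 = \<bar>R\<bar> + 1" using p True by (simp add: c12 s_def)
    then have "norm (conj_by (u s 1) X) \<ge> \<bar>R\<bar> + 1" using entry_le_norm[of "conj_by (u s 1) X" 1 2] by simp
    then show ?thesis by (intro exI[of _ s]) linarith
  next
    case False
    define s where "s = (X$1$1 - \<bar>R\<bar> - 1) / X$2$1"
    have "conj_by (u s 1) X $ 1 $ 1 = \<bar>R\<bar> + 1" using False by (simp add: c11 s_def)
    then have "norm (conj_by (u s 1) X) \<ge> \<bar>R\<bar> + 1" using entry_le_norm[of "conj_by (u s 1) X" 1 1] by simp
    then show ?thesis by (intro exI[of _ s]) linarith
  qed
  then show ?thesis using that S cont one by blast
next
  case True
  then have q: "X$1$2 \<noteq> 0" using tr ne by (auto simp: mat2_eq_iff)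
  define s where "s = (\<bar>R\<bar> + 1) / X$1$2"
  define u :: "real \<Rightarrow> real^2^2" where "u t = vector [vector [1, 0], vector [s * t, 1]]" for t
  have S: "u t \<in> SL2R" for t by (simp add: u_def SL2R_iff)
  have cont: "continuous_on {0..1} u"
    by (rule continuous_on_mat2; simp add: u_def; intro continuous_intros)
  have one: "u 0 = mat 1" by (simp add: u_def mat2_eq_iff)
  have "conj_by (u 1) X $ 1 $ 1 = \<bar>R\<bar> + 1"
    using S[of 1] q True by (simp add: conj_by_SL2R u_def s_def)
  then have "norm (conj_by (u 1) X) \<ge> \<bar>R\<bar> + 1" using entry_le_norm[of "conj_by (u 1) X" 1 1] by simp
  then have "norm (conj_by (u 1) X) > R" by linarith
  then show ?thesis using that S cont one by blast
qed

lemma continuous_on_mat2_mult: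
  fixes p :: "'a::topological_space \<Rightarrow> real^2^2"
  assumes p: "continuous_on S p"
  shows "continuous_on S (\<lambda>x. (g :: real^2^2) ** p x)"
  by (rule continuous_on_mat2; unfold matrix_mult_entries; intro continuous_intros p)

context discrete_subgroup
begin

definition tube :: "real^2^2 \<Rightarrow> (real^2^2) set" where
  "tube A = {h \<in> SL2R. \<exists>B\<in>\<Gamma>. B \<noteq> mat 1 \<and> A ** B = B ** A \<and> small_at h B}"

definition thick :: "real^2^2 \<Rightarrow> bool" where
  "thick g \<longleftrightarrow> (\<forall>A\<in>\<Gamma>. small_at g A \<longrightarrow> A = mat 1)"

text \<open>On the tube the conjugate of the trace-free part of \<open>A\<close> is bounded, so a unipotent path
starting at \<open>g\<close> leaves it. At a point \<open>w\<close> of the path outside the tube but in its closure, a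
small element would also be small at nearby points of the tube, would commute there with elements commuting with
\<open>A\<close>, and would put \<open>w\<close> into the tube; hence \<open>w\<close> is thick. An element that is
small nearby moves \<open>w\<close> by at most 1.\<close>

lemma tube_boundary_thick:
  assumes A: "A \<in> \<Gamma>" "traceless A \<noteq> 0" and g: "g \<in> tube A"
  obtains w B where "w \<in> SL2R" "thick w" "B \<in> \<Gamma>" "traceless B \<noteq> 0" "A ** B = B ** A"
    "norm (conj_by w B - mat 1) \<le> 1"
proof -
  have gS: "g \<in> SL2R" using g by (simp add: tube_def)
  obtain R where R: "\<And>h B. h \<in> SL2R \<Longrightarrow> B \<in> \<Gamma> \<Longrightarrow> A ** B = B ** A \<Longrightarrow> traceless B \<noteq> 0 \<Longrightarrow>
      norm (conj_by h B - mat 1) \<le> 1 \<Longrightarrow> norm (conj_by h (traceless A)) \<le> R"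
    using traceless_bound_of_commuting_small[OF A] by blast
  have "conj_by g (traceless A) \<noteq> 0"
    using A(2) gS conj_by_cancel[OF gS, of "traceless A" 0] by (simp add: conj_by_SL2R)
  moreover have "conj_by g (traceless A) $ 1 $ 1 + conj_by g (traceless A) $ 2 $ 2 = 0"
    unfolding traceless_conj_by[OF gS, symmetric] by simp
  ultimately obtain u :: "real \<Rightarrow> real^2^2" where u: "continuous_on {0..1} u" "u 0 = mat 1" "\<And>t. u t \<in> SL2R"
    "norm (conj_by (u 1) (conj_by g (traceless A))) > R"
    using unipotent_path_escape[of "conj_by g (traceless A)", where R = R] by blast
  define p where "p t = g ** u t" for t
  have pS: "p t \<in> SL2R" for t using gS u by (simp add: p_def)
  have pc: "continuous_on {0..1} p" unfolding p_def by (rule continuous_on_mat2_mult[OF u(1)])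
  have small_pt: "traceless B \<noteq> 0" if "B \<in> \<Gamma>" "small_at (p t) B" "B \<noteq> mat 1" for B t
    using small_at_nontrivial pS that by blast
  define Ob where "Ob B = {t \<in> {0..1}. small_at (p t) B}" for B
  have oOb: "openin (top_of_set {0..1}) (Ob B)" for B
  proof -
    have "continuous_on {0..1} (\<lambda>t. norm (conj_by (p t) B - mat 1))"
      by (intro continuous_intros continuous_on_conj_by pc pS)
    from continuous_openin_preimage_gen[OF this, of "{..<1/10}"]
    show ?thesis by (simp add: Ob_def vimage_def Int_def)
  qed
  define I where "I = {t \<in> {0..1}. p t \<in> tube A}"
  have I_eq: "I = (\<Union>B\<in>{B \<in> \<Gamma>. B \<noteq> mat 1 \<and> A ** B = B ** A}. Ob B)"
    using pS by (auto simp: I_def Ob_def tube_def)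
  have oI: "openin (top_of_set {0..1}) I"
    unfolding I_eq by (intro openin_Union) (use oOb in auto)
  have "0 \<in> I" using g u(2) by (simp add: I_def p_def)
  have "1 \<notin> I"
  proof
    assume "1 \<in> I"
    then obtain B where B: "B \<in> \<Gamma>" "B \<noteq> mat 1" "A ** B = B ** A" "small_at (p 1) B"
      by (auto simp: I_def tube_def)
    have "norm (conj_by (p 1) (traceless A)) \<le> R"
      by (rule R[OF pS B(1,3) small_pt[OF B(1,4,2)]]) (use B(4) in simp)
    then show False using u(4) gS u(3) by (simp add: conj_by_conj_by p_def)
  qed
  \<comment> \<open>Otherwise \<open>I\<close> would be open and closed in the unit interval.\<close>
  have "\<exists>s\<in>{0..1}. s \<in> closure I \<and> s \<notin> I"
  proof (rule ccontr)
    assume "\<not> ?thesis"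
    moreover have "I \<subseteq> {0..1}" by (auto simp: I_def)
    ultimately have "I = {0..1} \<inter> closure I" using closure_subset[of I] by blast
    then have "closedin (top_of_set {0..1}) I" by (metis closed_closure closedin_closed_Int)
    then have "I = {} \<or> I = {0..1}"
      using connected_clopen[of "{0..1::real}"] oI connected_Icc by blast
    then show False using \<open>0 \<in> I\<close> \<open>1 \<notin> I\<close> by auto
  qed
  then obtain s where s: "s \<in> {0..1}" "s \<in> closure I" "s \<notin> I" by blast
  have approx: "\<exists>t\<in>W. t \<in> I" if W: "openin (top_of_set {0..1}) W" "s \<in> W" for W
  proof -
    obtain T where T: "open T" "W = {0..1} \<inter> T" using W(1) by (auto simp: openin_open)
    then have "T \<inter> closure I \<noteq> {}" using s(2) W(2) by auto
    then have "T \<inter> I \<noteq> {}" using open_Int_closure_eq_empty[OF T(1), of I] by simp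
    then show ?thesis using T(2) by (auto simp: I_def)
  qed
  have thick: "thick (p s)"
    unfolding thick_def
  proof (intro ballI impI)
    fix C assume C: "C \<in> \<Gamma>" "small_at (p s) C"
    show "C = mat 1"
    proof (rule ccontr)
      assume ne: "C \<noteq> mat 1"
      have "s \<in> Ob C" using s(1) C by (simp add: Ob_def)
      then obtain t where t: "t \<in> Ob C" "t \<in> I" using approx[OF oOb] by blast
      then obtain B where B: "B \<in> \<Gamma>" "B \<noteq> mat 1" "A ** B = B ** A" "small_at (p t) B"
        by (auto simp: I_def tube_def)
      have "B ** C = C ** B"
        using small_at_commute[OF pS B(1,4) C(1)] t(1) by (simp add: Ob_def)
      then have "A ** C = C ** A"
        using commute_trans[of B A C] B small_pt by metis
      then have "s \<in> I" using s(1) C ne pS by (auto simp: I_def tube_def)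
      then show False using s(3) by simp
    qed
  qed
  define W where "W = {t \<in> {0..1}. norm (adj2 (p t) ** p s - mat 1) < 1/10}"
  have "openin (top_of_set {0..1}) W"
  proof -
    have "continuous_on {0..1} (\<lambda>t. norm (adj2 (adj2 (p s) ** p t) - mat 1))"
      unfolding norm_adj2_minus_one
      by (intro continuous_intros continuous_on_mat2_mult pc)
    from continuous_openin_preimage_gen[OF this, of "{..<1/10}"]
    show ?thesis by (simp add: W_def vimage_def Int_def)
  qed
  moreover have "s \<in> W" using s(1) pS by (simp add: W_def)
  ultimately obtain t where t: "t \<in> W" "t \<in> I" using approx by blast
  then obtain B where B: "B \<in> \<Gamma>" "B \<noteq> mat 1" "A ** B = B ** A" "small_at (p t) B"
    by (auto simp: I_def tube_def)
  define k where "k = adj2 (p t) ** p s"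
  have k: "k \<in> SL2R" "norm (k - mat 1) < 1/10" using t(1) pS by (auto simp: k_def W_def)
  have "p t ** k = p s" using pS by (simp add: k_def)
  then have "conj_by (p s) B = conj_by k (conj_by (p t) B)" using pS k by (simp add: conj_by_conj_by)
  then have "norm (conj_by (p s) B - mat 1) = norm (conj_by k (conj_by (p t) B - mat 1))"
    using k by (simp add: conj_by_diff)
  also have "\<dots> \<le> (norm k)\<^sup>2 * norm (conj_by (p t) B - mat 1)" by (rule conj_by_norm_le[OF k(1)])
  also have "\<dots> \<le> (21/10)\<^sup>2 * (1/10)"
    using norm_le_near_one[of k] k B(4) by (intro mult_mono power_mono) auto
  also have "\<dots> \<le> 1" by (simp add: power2_eq_square)
  finally have "norm (conj_by (p s) B - mat 1) \<le> 1" .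
  then show ?thesis using that[OF pS thick B(1) small_pt[OF B(1,4,2)] B(3)] by blast
qed

end

context finite_covolume
begin

text \<open>The thick boundary point supplied by the tube can be moved into a bounded set by \<open>\<Gamma>\<close>.
There the commuting element \<open>B\<close> lies in a finite set \<open>S\<close>, and it bounds the tube containing
\<open>g\<close>.\<close>

lemma thin_part_reduction:
  "\<exists>S R. finite S \<and> S \<subseteq> \<Gamma> \<and> (\<forall>B\<in>S. traceless B \<noteq> 0) \<and>
    (\<forall>g\<in>SL2R. \<exists>\<gamma>\<in>\<Gamma>. norm (\<gamma> ** g) \<le> R \<or> (\<exists>B\<in>S. norm (conj_by (\<gamma> ** g) (traceless B)) \<le> R))"
proof -
  obtain R0 where R0: "\<And>g. g \<in> SL2R \<Longrightarrow> thick g \<Longrightarrow> \<exists>\<gamma>\<in>\<Gamma>. norm (\<gamma> ** g) \<le> R0"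
    using thick_part_cocompact[of "1/10"] unfolding thick_def by auto
  define S where "S = {B \<in> \<Gamma>. norm B \<le> R0\<^sup>2 * 3 \<and> traceless B \<noteq> 0}"
  have S: "finite S" "S \<subseteq> \<Gamma>"
    unfolding S_def by (auto intro: finite_subset[OF _ finite_bounded_part[of "R0\<^sup>2 * 3"]])
  have "\<forall>B\<in>S. \<exists>R. \<forall>g\<in>SL2R. \<forall>C\<in>\<Gamma>. B ** C = C ** B \<longrightarrow> traceless C \<noteq> 0 \<longrightarrow> norm (conj_by g C - mat 1) \<le> 1 \<longrightarrow>
     norm (conj_by g (traceless B)) \<le> R"
    using traceless_bound_of_commuting_small by (auto simp: S_def)
  then obtain r where r: "\<And>B g C. B \<in> S \<Longrightarrow> g \<in> SL2R \<Longrightarrow> C \<in> \<Gamma> \<Longrightarrow> B ** C = C ** B \<Longrightarrow> traceless C \<noteq> 0 \<Longrightarrow>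
     norm (conj_by g C - mat 1) \<le> 1 \<Longrightarrow> norm (conj_by g (traceless B)) \<le> r B"
    by metis
  define R where "R = Max (insert R0 (r ` S))"
  have RR: "R0 \<le> R" "\<And>B. B \<in> S \<Longrightarrow> r B \<le> R" using S by (auto simp: R_def)
  have "\<exists>\<gamma>\<in>\<Gamma>. norm (\<gamma> ** g) \<le> R \<or> (\<exists>B\<in>S. norm (conj_by (\<gamma> ** g) (traceless B)) \<le> R)" if g: "g \<in> SL2R" for g
  proof (cases "thick g")
    case True
    then show ?thesis using R0[OF g] RR by force
  next
    case False
    then obtain A where A: "A \<in> \<Gamma>" "small_at g A" "A \<noteq> mat 1" by (auto simp: thick_def)
    have trA: "traceless A \<noteq> 0" using small_at_nontrivial g A by blast
    have "g \<in> tube A" using g A by (auto simp: tube_def)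
    then obtain w B where w: "w \<in> SL2R" "thick w" and B: "B \<in> \<Gamma>" "traceless B \<noteq> 0" "A ** B = B ** A"
      "norm (conj_by w B - mat 1) \<le> 1"
      using tube_boundary_thick[OF A(1) trA] by blast
    obtain \<gamma> where \<gamma>: "\<gamma> \<in> \<Gamma>" "norm (\<gamma> ** w) \<le> R0" using R0 w by blast
    have \<gamma>S: "\<gamma> \<in> SL2R" using \<gamma> SL2R_mem by blast
    define B' where "B' = conj_by (adj2 \<gamma>) B"
    define A' where "A' = conj_by (adj2 \<gamma>) A"
    have transport: "conj_by (\<gamma> ** h) (conj_by (adj2 \<gamma>) C) = conj_by h C" if "h \<in> SL2R" for h C
      using that \<gamma>S by (simp add: conj_by_conj_by)
    have B'\<Gamma>: "B' \<in> \<Gamma>" "A' \<in> \<Gamma>" using \<gamma> A B by (auto simp: B'_def A'_def intro: conj_mem adj2_closed)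
    have tr': "traceless (conj_by (adj2 \<gamma>) C) \<noteq> 0" if "traceless C \<noteq> 0" for C
    proof -
      have "traceless (conj_by (adj2 \<gamma>) C) = conj_by (adj2 \<gamma>) (traceless C)" using \<gamma>S by (simp add: traceless_conj_by)
      moreover have "conj_by (adj2 \<gamma>) (traceless C) \<noteq> conj_by (adj2 \<gamma>) 0"
        using that \<gamma>S conj_by_cancel[of "adj2 \<gamma>" "traceless C" 0] by simp
      moreover have "conj_by (adj2 \<gamma>) 0 = 0" using \<gamma>S by (simp add: conj_by_SL2R)
      ultimately show ?thesis by simp
    qed
    have com: "B' ** A' = A' ** B'"
      using B(3) \<gamma>S unfolding A'_def B'_def by (simp add: conj_by_mult[symmetric])
    have "conj_by (adj2 (\<gamma> ** w)) (conj_by (\<gamma> ** w) B') = B'"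
      using \<gamma>S w by (subst conj_by_conj_by) (simp_all add: conj_by_SL2R matrix_mul_assoc[symmetric])
    then have "norm B' \<le> (norm (\<gamma> ** w))\<^sup>2 * norm (conj_by (\<gamma> ** w) B')"
      using conj_by_norm_le[of "adj2 (\<gamma> ** w)" "conj_by (\<gamma> ** w) B'"] \<gamma>S w
      by (metis SL2R_adj2 SL2R_mult norm_adj2)
    also have "conj_by (\<gamma> ** w) B' = conj_by w B" unfolding B'_def by (rule transport[OF w(1)])
    also have "(norm (\<gamma> ** w))\<^sup>2 * norm (conj_by w B) \<le> R0\<^sup>2 * 3"
    proof (intro mult_mono power_mono)
      show "norm (conj_by w B) \<le> 3"
        using B(4) norm_one_mat2_le norm_triangle_ineq[of "conj_by w B - mat 1" "mat 1"] by simp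
    qed (use \<gamma> in auto)
    finally have B'S: "B' \<in> S" using B'\<Gamma> tr'[OF B(2)] by (simp add: S_def B'_def)
    have "norm (conj_by (\<gamma> ** g) (traceless B')) \<le> r B'"
    proof (rule r[OF B'S _ B'\<Gamma>(2) com])
      show "traceless A' \<noteq> 0" unfolding A'_def by (rule tr'[OF trA])
      show "norm (conj_by (\<gamma> ** g) A' - mat 1) \<le> 1"
        unfolding A'_def using transport[OF g] A by simp
    qed (use \<gamma>S g in auto)
    then show ?thesis using RR(2)[OF B'S] B'S \<gamma>(1) by force
  qed
  then show ?thesis using S by (intro exI[of _ S] exI[of _ R]) (auto simp: S_def)
qed

end

section \<open>Elliptic, hyperbolic and parabolic tubes\<close>

text \<open>When the trace-free part has determinant at most 0 there is a real eigenvector \<open>(p + l,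
B\<^sub>2\<^sub>1)\<close>; it becomes the first column of \<open>\<sigma>\<close>.\<close>

lemma upper_triangularizable:
  assumes "det (traceless B) \<le> 0"
  obtains \<sigma> where "\<sigma> \<in> SL2R" "conj_by \<sigma> B $ 2 $ 1 = 0"
proof (cases "B$2$1 = 0")
  case True
  then show ?thesis using that[of "mat 1"] by (simp add: conj_by_SL2R)
next
  case False
  define p where "p = (B$1$1 - B$2$2) / 2"
  define l where "l = sqrt (p\<^sup>2 + B$1$2 * B$2$1)"
  have "0 \<le> p\<^sup>2 + B$1$2 * B$2$1" using assms by (simp add: det_2 p_def power2_eq_square)
  then have l2: "l\<^sup>2 = p\<^sup>2 + B$1$2 * B$2$1" by (simp add: l_def)
  define v where "v = p + l"
  define c where "c = B$2$1"
  define n where "n = v\<^sup>2 + c\<^sup>2"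
  have n: "n > 0" using False by (simp add: n_def c_def sum_power2_gt_zero_iff)
  let ?s = "vector [vector [v, - c / n], vector [c, v / n]] :: real^2^2"
  have "v * (v / n) + c / n * c = (v\<^sup>2 + c\<^sup>2) / n"
    by (simp add: add_divide_distrib power2_eq_square)
  also have "\<dots> = 1" using n unfolding n_def[symmetric] by simp
  finally have "v * (v / n) + c / n * c = 1" .
  then have S: "?s \<in> SL2R" using n by (simp add: SL2R_iff)
  have "conj_by ?s B $ 2 $ 1 = c * (v\<^sup>2 - 2 * p * v - B$1$2 * c)"
  proof -
    have "B$1$1 = B$2$2 + 2 * p" by (simp add: p_def field_simps)
    then show ?thesis using S by (simp add: conj_by_SL2R c_def power2_eq_square algebra_simps)
  qed
  also have "v\<^sup>2 - 2 * p * v - B$1$2 * c = 0"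
    using l2 by (simp add: v_def c_def power2_eq_square algebra_simps)
  finally have "conj_by ?s B $ 2 $ 1 = 0" by simp
  with S show ?thesis by (rule that)
qed

text \<open>The off-diagonal entries of \<open>g\<inverse>Xg\<close> are the values at the columns of \<open>g\<close>
of the quadratic form attached to \<open>X\<close>, which is definite because \<open>det X > 0\<close>.\<close>

lemma elliptic_bounded:
  assumes tr: "X$1$1 + X$2$2 = 0" and pos: "det X > 0"
  shows "\<exists>R'. \<forall>g\<in>SL2R. norm (conj_by g X) \<le> R \<longrightarrow> norm g \<le> R'"
proof -
  define p q r where "p = X$1$1" "q = X$1$2" "r = X$2$1"
  have X22: "X$2$2 = - p" using tr by (simp add: p_q_r_def)
  define \<Delta> where "\<Delta> = det X"
  have \<Delta>: "\<Delta> = - p * p - q * r" using X22 by (simp add: \<Delta>_def det_2 p_q_r_def)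
  define Q where "Q x y = r * x\<^sup>2 - 2 * p * x * y - q * y\<^sup>2" for x y
  have Q1: "\<Delta> * y\<^sup>2 \<le> \<bar>r\<bar> * \<bar>Q x y\<bar>" for x y
  proof -
    have "r * Q x y = (r * x - p * y)\<^sup>2 + \<Delta> * y\<^sup>2"
      by (simp add: Q_def \<Delta> power2_eq_square algebra_simps)
    then have "\<Delta> * y\<^sup>2 \<le> r * Q x y" by simp
    also have "\<dots> \<le> \<bar>r * Q x y\<bar>" by simp
    finally show ?thesis by (simp add: abs_mult)
  qed
  have Q2: "\<Delta> * x\<^sup>2 \<le> \<bar>q\<bar> * \<bar>Q x y\<bar>" for x y
  proof -
    have "- q * Q x y = (q * y + p * x)\<^sup>2 + \<Delta> * x\<^sup>2"
      by (simp add: Q_def \<Delta> power2_eq_square algebra_simps)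
    then have "\<Delta> * x\<^sup>2 \<le> - q * Q x y" by simp
    also have "\<dots> \<le> \<bar>q * Q x y\<bar>" by simp
    finally show ?thesis by (simp add: abs_mult)
  qed
  show ?thesis
  proof (intro exI[of _ "sqrt (2 * (\<bar>r\<bar> + \<bar>q\<bar>) * R / \<Delta>)"] ballI impI)
    fix g assume g: "g \<in> SL2R" and le: "norm (conj_by g X) \<le> R"
    have "conj_by g X $ 2 $ 1 = Q (g$1$1) (g$2$1)" "conj_by g X $ 1 $ 2 = - Q (g$1$2) (g$2$2)"
      using g X22 by (simp_all add: conj_by_SL2R Q_def p_q_r_def[symmetric] power2_eq_square algebra_simps)
    then have R: "\<bar>Q (g$1$1) (g$2$1)\<bar> \<le> R" "\<bar>Q (g$1$2) (g$2$2)\<bar> \<le> R"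
      using entry_le_norm[of "conj_by g X" 2 1] entry_le_norm[of "conj_by g X" 1 2] le by auto
    have "\<Delta> * (g$2$1)\<^sup>2 \<le> \<bar>r\<bar> * R" "\<Delta> * (g$2$2)\<^sup>2 \<le> \<bar>r\<bar> * R"
      "\<Delta> * (g$1$1)\<^sup>2 \<le> \<bar>q\<bar> * R" "\<Delta> * (g$1$2)\<^sup>2 \<le> \<bar>q\<bar> * R"
      using Q1[of "g$2$1" "g$1$1"] Q1[of "g$2$2" "g$1$2"] Q2[of "g$1$1" "g$2$1"] Q2[of "g$1$2" "g$2$2"]
        mult_left_mono[OF R(1), of "\<bar>r\<bar>"] mult_left_mono[OF R(2), of "\<bar>r\<bar>"]
        mult_left_mono[OF R(1), of "\<bar>q\<bar>"] mult_left_mono[OF R(2), of "\<bar>q\<bar>"] by linarith+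
    then have "\<Delta> * (norm g)\<^sup>2 \<le> 2 * (\<bar>r\<bar> + \<bar>q\<bar>) * R"
      unfolding norm_sq_mat2 by (simp add: algebra_simps)
    then have "(norm g)\<^sup>2 \<le> 2 * (\<bar>r\<bar> + \<bar>q\<bar>) * R / \<Delta>"
      using pos by (simp add: \<Delta>_def field_simps)
    then show "norm g \<le> sqrt (2 * (\<bar>r\<bar> + \<bar>q\<bar>) * R / \<Delta>)" by (rule real_le_rsqrt)
  qed
qed

text \<open>The powers of \<open>s\<close> form a geometric progression, so one of them brings \<open>m\<close> into the
fundamental interval \<open>[1, |s|]\<close>.\<close>

lemma power_scaling:
  fixes s m :: real
  assumes s: "\<bar>s\<bar> > 1" and m: "m > 0"
  shows "\<exists>n::nat. (1 \<le> \<bar>s ^ n\<bar> * m \<and> \<bar>s ^ n\<bar> * m \<le> \<bar>s\<bar>) \<or> (1 \<le> \<bar>(1 / s) ^ n\<bar> * m \<and> \<bar>(1 / s) ^ n\<bar> * m \<le> \<bar>s\<bar>)"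
proof (cases "m \<ge> 1")
  case True
  define k where "k = (LEAST k. m < \<bar>s\<bar> ^ k)"
  obtain k0 where "m < \<bar>s\<bar> ^ k0" using real_arch_pow[OF s] by blast
  then have k: "m < \<bar>s\<bar> ^ k" unfolding k_def by (rule LeastI)
  then have "k \<noteq> 0" using True by (metis leD power_0)
  then obtain n where n: "k = Suc n" using not0_implies_Suc by blast
  have "\<not> m < \<bar>s\<bar> ^ n" using not_less_Least[of n "\<lambda>k. m < \<bar>s\<bar> ^ k"] n by (simp add: k_def)
  then have "1 \<le> \<bar>(1 / s) ^ n\<bar> * m \<and> \<bar>(1 / s) ^ n\<bar> * m \<le> \<bar>s\<bar>"
    using k n s by (simp add: power_abs power_divide abs_divide field_simps)
  then show ?thesis by blast
next
  case False
  define k where "k = (LEAST k. 1 / m \<le> \<bar>s\<bar> ^ k)"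
  obtain k0 where "1 / m < \<bar>s\<bar> ^ k0" using real_arch_pow[OF s] by blast
  then have "1 / m \<le> \<bar>s\<bar> ^ k0" by simp
  then have k: "1 / m \<le> \<bar>s\<bar> ^ k" unfolding k_def by (rule LeastI)
  then have "k \<noteq> 0" using False m by (metis divide_le_eq_1_pos power_0)
  then obtain n where n: "k = Suc n" using not0_implies_Suc by blast
  have "\<not> 1 / m \<le> \<bar>s\<bar> ^ n" using not_less_Least[of n "\<lambda>k. 1 / m \<le> \<bar>s\<bar> ^ k"] n by (simp add: k_def)
  then have "\<bar>s\<bar> ^ n * m < 1" using m by (simp add: field_simps)
  then have "\<bar>s\<bar> * (\<bar>s\<bar> ^ n * m) \<le> \<bar>s\<bar> * 1" by (intro mult_left_mono) auto
  then have "1 \<le> \<bar>s ^ k\<bar> * m \<and> \<bar>s ^ k\<bar> * m \<le> \<bar>s\<bar>"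
    using k n m by (simp add: power_abs abs_mult field_simps)
  then show ?thesis by blast
qed

definition diag2 :: "real \<Rightarrow> real \<Rightarrow> real^2^2" where
  "diag2 a d = vector [vector [a, 0], vector [0, d]]"

lemma diag2_entries [simp]: "diag2 a d $ 1 $ 1 = a" "diag2 a d $ 1 $ 2 = 0" "diag2 a d $ 2 $ 1 = 0" "diag2 a d $ 2 $ 2 = d"
  by (simp_all add: diag2_def)

lemma det_traceless_conj_by:
  assumes "\<sigma> \<in> SL2R"
  shows "det (traceless (conj_by \<sigma> B)) = det (traceless B)"
proof -
  have "det \<sigma> = 1" "det (adj2 \<sigma>) = 1" using assms SL2R_adj2[OF assms] by (simp_all add: SL2R_def)
  then show ?thesis
    unfolding traceless_conj_by[OF assms] unfolding conj_by_SL2R[OF assms] det_mul by simp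
qed

lemma diagonalizable:
  assumes B: "B \<in> SL2R" and neg: "det (traceless B) < 0"
  obtains \<sigma> t where "\<sigma> \<in> SL2R" "t \<noteq> 0" "\<bar>t\<bar> \<noteq> 1" "conj_by \<sigma> B = diag2 t (1 / t)"
proof -
  obtain \<sigma> where \<sigma>: "\<sigma> \<in> SL2R" "conj_by \<sigma> B $ 2 $ 1 = 0"
    using upper_triangularizable[of B] neg by (metis less_imp_le)
  define C where "C = conj_by \<sigma> B"
  define t u s where "t = C$1$1" "u = C$2$2" "s = C$1$2"
  have C: "C \<in> SL2R" "C$2$1 = 0" using \<sigma> B by (simp_all add: C_def)
  then have tu: "t * u = 1" by (simp add: SL2R_iff t_u_s_def)
  then have "t \<noteq> 0" by auto
  with tu have t0: "t \<noteq> 0" "u = 1 / t" by (auto simp: eq_divide_eq mult.commute)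
  have "det (traceless C) < 0" using neg \<sigma> by (simp add: C_def det_traceless_conj_by)
  then have ne: "t \<noteq> u" using C(2) by (auto simp: det_2 t_u_s_def)
  define \<tau> where "\<tau> = (vector [vector [1, - s / (t - u)], vector [0, 1]] :: real^2^2)"
  have \<tau>: "\<tau> \<in> SL2R" by (simp add: \<tau>_def SL2R_iff)
  have "conj_by \<tau> C = diag2 t u"
    using \<tau> C(2) ne by (simp add: conj_by_SL2R mat2_eq_iff \<tau>_def t_u_s_def[symmetric] field_simps)
  then have "conj_by (\<sigma> ** \<tau>) B = diag2 t (1 / t)"
    using \<sigma> \<tau> t0 by (simp add: conj_by_conj_by[symmetric] C_def)
  moreover have "\<bar>t\<bar> \<noteq> 1" using ne tu by (auto simp: abs_if split: if_splits)
  ultimately show ?thesis using that[of "\<sigma> ** \<tau>" t] \<sigma> \<tau> t0 by simp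
qed

context discrete_subgroup
begin

lemma diagonal_powers:
  assumes B: "B \<in> \<Gamma>" and \<sigma>: "\<sigma> \<in> SL2R" and eq: "conj_by \<sigma> B = diag2 t u"
  shows "\<exists>\<gamma>\<in>\<Gamma>. conj_by \<sigma> \<gamma> = diag2 (t ^ n) (u ^ n)"
proof (induction n)
  case 0
  have eq1: "diag2 1 1 = mat 1" by (simp add: mat2_eq_iff)
  have "conj_by \<sigma> (mat 1) = diag2 (t ^ 0) (u ^ 0)" unfolding power_0 eq1 using \<sigma> by simp
  then show ?case using one_mem by blast
next
  case (Suc n)
  then obtain \<gamma> where \<gamma>: "\<gamma> \<in> \<Gamma>" "conj_by \<sigma> \<gamma> = diag2 (t ^ n) (u ^ n)" by blast
  have "conj_by \<sigma> (B ** \<gamma>) = diag2 (t ^ Suc n) (u ^ Suc n)"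
    using \<sigma> eq \<gamma> by (simp add: conj_by_mult mat2_eq_iff)
  then show ?case using mult_closed[OF B \<gamma>(1)] by blast
qed

text \<open>In coordinates that diagonalise \<open>B\<close> the hypothesis bounds the products of entries from
different rows. A power of \<open>B\<close> scales the first row to size between 1 and \<open>|s|\<close>, and the
products then bound the second row.\<close>

lemma hyperbolic_cocompact:
  assumes B: "B \<in> \<Gamma>" and neg: "det (traceless B) < 0"
  shows "\<exists>R'. \<forall>g\<in>SL2R. norm (conj_by g (traceless B)) \<le> R \<longrightarrow> (\<exists>\<gamma>\<in>\<Gamma>. norm (\<gamma> ** g) \<le> R')"
proof -
  obtain \<sigma> t where \<sigma>: "\<sigma> \<in> SL2R" and t: "t \<noteq> 0" "\<bar>t\<bar> \<noteq> 1" and eq: "conj_by \<sigma> B = diag2 t (1 / t)"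
    using diagonalizable[OF SL2R_mem[OF B] neg] .
  have eq': "conj_by \<sigma> (adj2 B) = diag2 (1 / t) t"
    using eq \<sigma> by (simp add: adj2_conj_by[symmetric] mat2_eq_iff)
  define s where "s = (if \<bar>t\<bar> > 1 then t else 1 / t)"
  have s: "\<bar>s\<bar> > 1" using t by (auto simp: s_def abs_divide field_simps)
  have pw: "\<exists>\<gamma>\<in>\<Gamma>. conj_by \<sigma> \<gamma> = diag2 (s ^ n) ((1 / s) ^ n)"
    "\<exists>\<gamma>\<in>\<Gamma>. conj_by \<sigma> \<gamma> = diag2 ((1 / s) ^ n) (s ^ n)" for n
    using diagonal_powers[OF B \<sigma> eq, of n] diagonal_powers[OF adj2_closed[OF B] \<sigma> eq', of n]
    by (auto simp: s_def)
  define \<delta> where "\<delta> = (t - 1 / t) / 2"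
  have \<delta>: "\<delta> \<noteq> 0"
  proof
    assume "\<delta> = 0"
    then have "t\<^sup>2 = 1" using t(1) by (simp add: \<delta>_def power2_eq_square field_simps)
    then show False using t(2) by (simp add: power2_eq_1_iff) auto
  qed
  have tr: "conj_by \<sigma> (traceless B) = diag2 \<delta> (- \<delta>)"
    using \<sigma> by (simp add: traceless_conj_by[symmetric] eq mat2_eq_iff \<delta>_def)
  define r where "r = \<bar>R\<bar> / \<bar>\<delta>\<bar> + 1"
  show ?thesis
  proof (intro exI[of _ "norm \<sigma> * (2 * max \<bar>s\<bar> r)"] ballI impI)
    fix g assume g: "g \<in> SL2R" and le: "norm (conj_by g (traceless B)) \<le> R"
    define h where "h = adj2 \<sigma> ** g"
    have h: "h \<in> SL2R" "g = \<sigma> ** h" using \<sigma> g by (simp_all add: h_def)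
    define a b c d where "a = h$1$1" "b = h$1$2" "c = h$2$1" "d = h$2$2"
    note abcd = this
    have det: "a * d - b * c = 1" using h(1) by (simp add: SL2R_iff abcd)
    have conj: "conj_by g (traceless B) = conj_by h (diag2 \<delta> (- \<delta>))"
      unfolding h(2) using \<sigma> h(1) by (simp add: conj_by_conj_by[symmetric] tr)
    have e: "conj_by g (traceless B) $ 1 $ 1 = \<delta> * (a * d + b * c)"
      "conj_by g (traceless B) $ 2 $ 1 = - (2 * \<delta> * (a * c))" "conj_by g (traceless B) $ 1 $ 2 = 2 * \<delta> * (b * d)"
      unfolding conj using h(1) by (simp_all add: conj_by_SL2R abcd algebra_simps)
    have bnd: "\<bar>\<delta> * x\<bar> \<le> R \<Longrightarrow> \<bar>x\<bar> \<le> r - 1" for x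
      using \<delta> by (simp add: r_def abs_mult field_simps)
    have k1: "\<bar>a * d + b * c\<bar> \<le> r - 1"
      using bnd[of "a * d + b * c"] e(1) entry_le_norm[of "conj_by g (traceless B)" 1 1] le by simp
    have k2: "\<bar>2 * (a * c)\<bar> \<le> r - 1"
      using bnd[of "2 * (a * c)"] e(2) entry_le_norm[of "conj_by g (traceless B)" 2 1] le by (simp add: mult_ac)
    have k3: "\<bar>2 * (b * d)\<bar> \<le> r - 1"
      using bnd[of "2 * (b * d)"] e(3) entry_le_norm[of "conj_by g (traceless B)" 1 2] le by (simp add: mult_ac)
    have prods: "\<bar>a * c\<bar> \<le> r" "\<bar>b * d\<bar> \<le> r" "\<bar>a * d\<bar> \<le> r" "\<bar>b * c\<bar> \<le> r"
      using k1 k2 k3 det unfolding abs_le_iff by linarith+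
    define m where "m = max \<bar>a\<bar> \<bar>b\<bar>"
    have "m > 0" using det by (auto simp: m_def less_max_iff_disj)
    obtain x \<gamma> where x: "1 \<le> \<bar>x\<bar> * m" "\<bar>x\<bar> * m \<le> \<bar>s\<bar>" and \<gamma>: "\<gamma> \<in> \<Gamma>" "conj_by \<sigma> \<gamma> = diag2 x (1 / x)"
    proof -
      obtain n where "(1 \<le> \<bar>s ^ n\<bar> * m \<and> \<bar>s ^ n\<bar> * m \<le> \<bar>s\<bar>) \<or> (1 \<le> \<bar>(1 / s) ^ n\<bar> * m \<and> \<bar>(1 / s) ^ n\<bar> * m \<le> \<bar>s\<bar>)"
        using power_scaling[OF s \<open>m > 0\<close>] by blast
      moreover have "(1 / s) ^ n = 1 / s ^ n" "s ^ n = 1 / (1 / s) ^ n" by (simp_all add: power_divide)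
      ultimately show ?thesis using pw[of n] that[of "s ^ n"] that[of "(1 / s) ^ n"] by metis
    qed
    have x0: "x \<noteq> 0" using x by auto
    have ab: "\<bar>x * a\<bar> \<le> \<bar>s\<bar>" "\<bar>x * b\<bar> \<le> \<bar>s\<bar>"
      using x(2) mult_left_mono[of "\<bar>a\<bar>" m "\<bar>x\<bar>"] mult_left_mono[of "\<bar>b\<bar>" m "\<bar>x\<bar>"]
      by (auto simp: abs_mult m_def)
    have cd: "\<bar>y / x\<bar> \<le> r" if y: "\<bar>a * y\<bar> \<le> r" "\<bar>b * y\<bar> \<le> r" for y
    proof -
      have "m * \<bar>y\<bar> \<le> r" using y by (auto simp: m_def max_def abs_mult)
      have "\<bar>y / x\<bar> * 1 \<le> \<bar>y / x\<bar> * (\<bar>x\<bar> * m)" using x(1) by (intro mult_left_mono) auto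
      also have "\<dots> = m * \<bar>y\<bar>" using x0 by (simp add: abs_divide)
      finally show ?thesis using \<open>m * \<bar>y\<bar> \<le> r\<close> by simp
    qed
    let ?Y = "diag2 x (1 / x) ** h"
    have "\<sigma> ** conj_by \<sigma> \<gamma> ** h = \<gamma> ** g"
      using \<sigma> h by (simp add: conj_by_SL2R matrix_mul_assoc[symmetric])
    then have "norm (\<gamma> ** g) \<le> norm \<sigma> * norm ?Y"
      using norm_mat2_mult_le[of \<sigma> ?Y] \<gamma> by (simp add: matrix_mul_assoc)
    also have "\<dots> \<le> norm \<sigma> * (2 * max \<bar>s\<bar> r)"
    proof (intro mult_left_mono norm_mat2_le)
      show "\<bar>?Y $ 1 $ 1\<bar> \<le> max \<bar>s\<bar> r" "\<bar>?Y $ 1 $ 2\<bar> \<le> max \<bar>s\<bar> r"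
        using ab by (simp_all add: abcd[symmetric] le_max_iff_disj)
      show "\<bar>?Y $ 2 $ 1\<bar> \<le> max \<bar>s\<bar> r" "\<bar>?Y $ 2 $ 2\<bar> \<le> max \<bar>s\<bar> r"
        using cd[of c] cd[of d] prods by (simp_all add: abcd[symmetric] le_max_iff_disj)
    qed auto
    finally show "\<exists>\<gamma>\<in>\<Gamma>. norm (\<gamma> ** g) \<le> norm \<sigma> * (2 * max \<bar>s\<bar> r)" using \<gamma>(1) by blast
  qed
qed

text \<open>In coordinates that make \<open>B\<close> upper triangular the conjugate of its trace-free part has
off-diagonal entries proportional to the squares of the entries of the second row of \<open>\<sigma>\<inverse>g\<close>.
Their sum is \<open>1 / Im(\<sigma>\<inverse>gi)\<close>, so the conclusion describes a horoball at
\<open>\<sigma>\<infinity>\<close>.\<close>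

lemma parabolic_horoball:
  assumes B: "B \<in> \<Gamma>" "traceless B \<noteq> 0" and zero: "det (traceless B) = 0"
  shows "\<exists>\<sigma> R'. cusp_at \<Gamma> \<sigma> \<and> (\<forall>g\<in>SL2R. norm (conj_by g (traceless B)) \<le> R \<longrightarrow>
     ((adj2 \<sigma> ** g)$2$1)\<^sup>2 + ((adj2 \<sigma> ** g)$2$2)\<^sup>2 \<le> R')"
proof -
  obtain \<sigma> where \<sigma>: "\<sigma> \<in> SL2R" "conj_by \<sigma> B $ 2 $ 1 = 0"
    using upper_triangularizable[of B] zero by auto
  define X where "X = conj_by \<sigma> (traceless B)"
  have XC: "X = traceless (conj_by \<sigma> B)" using \<sigma> by (simp add: X_def traceless_conj_by)
  have X21: "X$2$1 = 0" using \<sigma>(2) by (simp add: XC)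
  have "det X = 0" unfolding XC using zero \<sigma>(1) by (simp add: det_traceless_conj_by)
  then have X11: "X$1$1 = 0" "X$2$2 = 0" using X21 unfolding XC by (simp_all add: det_2)
  have "X \<noteq> 0" using B(2) \<sigma>(1) conj_by_cancel[of \<sigma> "traceless B" 0]
    by (auto simp: X_def conj_by_SL2R)
  then have s: "X$1$2 \<noteq> 0" using X11 X21 by (auto simp: mat2_eq_iff)
  have BS: "B \<in> SL2R" using B SL2R_mem by blast
  have "parabolic B"
  proof -
    have "(B$1$1 + B$2$2)\<^sup>2 = 4"
    proof -
      have "det (traceless B) = B$1$1 * B$2$2 - B$1$2 * B$2$1 - ((B$1$1 + B$2$2) / 2)\<^sup>2"
        by (simp add: det_2 power2_eq_square field_simps)
      then show ?thesis using zero BS by (simp add: SL2R_iff power2_eq_square)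
    qed
    then have "(B$1$1 + B$2$2 - 2) * (B$1$1 + B$2$2 + 2) = 0" by (simp add: power2_eq_square algebra_simps)
    then have "\<bar>B$1$1 + B$2$2\<bar> = 2" unfolding mult_eq_0_iff by arith
    then have "\<bar>trace B\<bar> = 2" by (simp add: trace_def sum_2)
    then show ?thesis using BS B(2) by (auto simp: parabolic_def traceless_eq_0_SL2R)
  qed
  then have cusp: "cusp_at \<Gamma> \<sigma>" using \<sigma> B(1) by (auto simp: cusp_at_def)
  show ?thesis
  proof (intro exI[of _ \<sigma>] exI[of _ "2 * R / \<bar>X$1$2\<bar>"] conjI cusp ballI impI)
    fix g assume g: "g \<in> SL2R" and le: "norm (conj_by g (traceless B)) \<le> R"
    define h where "h = adj2 \<sigma> ** g"
    have h: "h \<in> SL2R" "g = \<sigma> ** h" using \<sigma> g by (simp_all add: h_def)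
    have eq: "conj_by g (traceless B) = conj_by h X"
      unfolding h(2) using \<sigma> h(1) by (simp add: conj_by_conj_by[symmetric] X_def)
    have "conj_by h X $ 2 $ 1 = - (X$1$2 * (h$2$1)\<^sup>2)" "conj_by h X $ 1 $ 2 = X$1$2 * (h$2$2)\<^sup>2"
      using h(1) X11 X21 by (simp_all add: conj_by_SL2R power2_eq_square)
    then have "\<bar>X$1$2\<bar> * (h$2$1)\<^sup>2 \<le> R" "\<bar>X$1$2\<bar> * (h$2$2)\<^sup>2 \<le> R"
      using entry_le_norm[of "conj_by h X" 2 1] entry_le_norm[of "conj_by h X" 1 2] le eq by (simp_all add: abs_mult)
    then show "((adj2 \<sigma> ** g)$2$1)\<^sup>2 + ((adj2 \<sigma> ** g)$2$2)\<^sup>2 \<le> 2 * R / \<bar>X$1$2\<bar>"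
      unfolding h_def[symmetric] using s by (simp add: field_simps)
  qed
qed

end

section \<open>Expansions in the parameter at a cusp\<close>

text \<open>Equivalent to the existence of a convergent power series in \<open>q\<close>, and visibly closed under sums
and products.\<close>

definition q_expandable :: "real \<Rightarrow> (complex \<Rightarrow> complex) \<Rightarrow> bool" where
  "q_expandable h u \<longleftrightarrow> (\<exists>G. G holomorphic_on ball 0 1 \<and> (\<forall>\<tau>\<in>uhp. u \<tau> = G (qpar h \<tau>)))"

text \<open>The point of the upper half-plane with parameter \<open>exp w\<close>.\<close>

definition qlog :: "real \<Rightarrow> complex \<Rightarrow> complex" where
  "qlog h w = of_real h * w / (2 * of_real pi * \<i>)"

lemma norm_qpar: "norm (qpar h \<tau>) = exp (- (2 * pi * Im \<tau> / h))"
  by (simp add: qpar_def norm_exp_eq_Re Re_divide_of_real)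

lemma qpar_nonzero [simp]: "qpar h \<tau> \<noteq> 0"
  by (simp add: qpar_def)

lemma norm_qpar_less_1: "h > 0 \<Longrightarrow> \<tau> \<in> uhp \<Longrightarrow> norm (qpar h \<tau>) < 1"
  by (simp add: norm_qpar uhp_iff)

lemma qpar_qlog: "h > 0 \<Longrightarrow> qpar h (qlog h w) = exp w"
  by (simp add: qpar_def qlog_def)

lemma Im_qlog: "Im (qlog h w) = - (h * Re w / (2 * pi))"
  by (simp add: qlog_def Im_divide power2_eq_square)

lemma Re_qlog: "Re (qlog h w) = h * Im w / (2 * pi)"
  by (simp add: qlog_def Re_divide power2_eq_square)

lemma qlog_in_uhp: "h > 0 \<Longrightarrow> norm w < 1 \<Longrightarrow> w \<noteq> 0 \<Longrightarrow> exp l = w \<Longrightarrow> qlog h l \<in> uhp"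
proof -
  assume a: "h > 0" "norm w < 1" "w \<noteq> 0" "exp l = w"
  have "exp (Re l) < exp 0" using a by (metis norm_exp_eq_Re exp_zero)
  then have "Re l < 0" by (subst (asm) exp_less_cancel_iff)
  then show ?thesis using a(1) by (simp add: uhp_iff Im_qlog mult_pos_neg divide_neg_pos)
qed

text \<open>Every nonzero point of the unit disc is the parameter of a point of the upper half-plane, so convergence on
the half-plane is convergence on the disc.\<close>

lemma q_expandable_iff_power_series:
  assumes h: "h > 0"
  shows "q_expandable h u \<longleftrightarrow> (\<exists>a. \<forall>\<tau>\<in>uhp. (\<lambda>n. a n * qpar h \<tau> ^ n) sums u \<tau>)"
proof
  assume "q_expandable h u"
  then obtain G where G: "G holomorphic_on ball 0 1" "\<And>\<tau>. \<tau> \<in> uhp \<Longrightarrow> u \<tau> = G (qpar h \<tau>)"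
    by (auto simp: q_expandable_def)
  have "(\<lambda>n. (deriv ^^ n) G 0 / fact n * qpar h \<tau> ^ n) sums u \<tau>" if "\<tau> \<in> uhp" for \<tau>
    using holomorphic_power_series[OF G(1), of "qpar h \<tau>"] norm_qpar_less_1[OF h that] G(2)[OF that] by simp
  then show "\<exists>a. \<forall>\<tau>\<in>uhp. (\<lambda>n. a n * qpar h \<tau> ^ n) sums u \<tau>"
    by (intro exI[of _ "\<lambda>n. (deriv ^^ n) G 0 / fact n"]) auto
next
  assume "\<exists>a. \<forall>\<tau>\<in>uhp. (\<lambda>n. a n * qpar h \<tau> ^ n) sums u \<tau>"
  then obtain a where a: "\<And>\<tau>. \<tau> \<in> uhp \<Longrightarrow> (\<lambda>n. a n * qpar h \<tau> ^ n) sums u \<tau>" by blast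
  define G where "G w = suminf (\<lambda>n. a n * w ^ n)" for w
  have "(\<lambda>n. a n * (w - 0) ^ n) sums G w" if w: "w \<in> ball 0 1" for w
  proof (cases "w = 0")
    case True
    then have "summable (\<lambda>n. a n * w ^ n)" by (simp add: summable_0_powser)
    then show ?thesis by (simp add: G_def summable_sums)
  next
    case False
    then have "qlog h (Ln w) \<in> uhp" using w qlog_in_uhp[OF h] by auto
    from a[OF this] have "(\<lambda>n. a n * w ^ n) sums u (qlog h (Ln w))"
      using False by (simp add: qpar_qlog[OF h])
    then show ?thesis unfolding G_def by (simp add: sums_unique[symmetric])
  qed
  then have "G holomorphic_on ball 0 1" by (rule power_series_holomorphic)
  moreover have "u \<tau> = G (qpar h \<tau>)" if "\<tau> \<in> uhp" for \<tau>
    using a[OF that] by (simp add: G_def sums_unique)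
  ultimately show "q_expandable h u" by (auto simp: q_expandable_def)
qed

lemma q_expandable_const: "q_expandable h (\<lambda>_. c)"
  unfolding q_expandable_def by (intro exI[of _ "\<lambda>_. c"]) auto

lemma q_expandable_add: "q_expandable h u \<Longrightarrow> q_expandable h v \<Longrightarrow> q_expandable h (\<lambda>\<tau>. u \<tau> + v \<tau>)"
  unfolding q_expandable_def
proof safe
  fix G H assume "G holomorphic_on ball 0 1" "H holomorphic_on ball 0 1"
    "\<forall>\<tau>\<in>uhp. u \<tau> = G (qpar h \<tau>)" "\<forall>\<tau>\<in>uhp. v \<tau> = H (qpar h \<tau>)"
  then show "\<exists>G. G holomorphic_on ball 0 1 \<and> (\<forall>\<tau>\<in>uhp. u \<tau> + v \<tau> = G (qpar h \<tau>))"
    by (intro exI[of _ "\<lambda>z. G z + H z"]) (auto intro: holomorphic_intros)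
qed

lemma q_expandable_mult: "q_expandable h u \<Longrightarrow> q_expandable h v \<Longrightarrow> q_expandable h (\<lambda>\<tau>. u \<tau> * v \<tau>)"
  unfolding q_expandable_def
proof safe
  fix G H assume "G holomorphic_on ball 0 1" "H holomorphic_on ball 0 1"
    "\<forall>\<tau>\<in>uhp. u \<tau> = G (qpar h \<tau>)" "\<forall>\<tau>\<in>uhp. v \<tau> = H (qpar h \<tau>)"
  then show "\<exists>G. G holomorphic_on ball 0 1 \<and> (\<forall>\<tau>\<in>uhp. u \<tau> * v \<tau> = G (qpar h \<tau>))"
    by (intro exI[of _ "\<lambda>z. G z * H z"]) (auto intro: holomorphic_intros)
qed

lemma q_expandable_cong: "(\<And>\<tau>. \<tau> \<in> uhp \<Longrightarrow> u \<tau> = v \<tau>) \<Longrightarrow> q_expandable h u = q_expandable h v"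
  unfolding q_expandable_def by simp

text \<open>A periodic function descends to the punctured disc; it is holomorphic there because it can be computed with
a branch of the logarithm cut along either half of the real axis. Boundedness makes the singularity at 0
removable.\<close>

lemma periodic_bounded_imp_q_expandable:
  assumes h: "h > 0" and hol: "u holomorphic_on uhp"
    and per: "\<And>\<tau>. \<tau> \<in> uhp \<Longrightarrow> u (\<tau> + of_real h) = u \<tau>"
    and bnd: "y0 > 0" "\<And>\<tau>. \<bar>Re \<tau>\<bar> \<le> h \<Longrightarrow> Im \<tau> \<ge> y0 \<Longrightarrow> norm (u \<tau>) \<le> B"
  shows "q_expandable h u"
proof -
  have per_nat: "u (\<tau> + of_nat n * of_real h) = u \<tau>" if "\<tau> \<in> uhp" for \<tau> n
  proof (induction n)
    case (Suc n)
    have "\<tau> + of_nat n * of_real h \<in> uhp" using that by (simp add: uhp_iff)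
    from per[OF this] Suc show ?case by (simp add: algebra_simps)
  qed simp
  have per_int: "u (\<tau> + of_int n * of_real h) = u \<tau>" if "\<tau> \<in> uhp" for \<tau> n
  proof (cases "n \<ge> 0")
    case True
    then show ?thesis using per_nat[OF that, of "nat n"] by simp
  next
    case False
    have "\<tau> + of_int n * of_real h \<in> uhp" using that by (simp add: uhp_iff)
    from per_nat[OF this, of "nat (- n)"] show ?thesis using False by simp
  qed
  have qeq: "u \<tau> = u \<tau>'" if qq: "qpar h \<tau> = qpar h \<tau>'" "\<tau> \<in> uhp" for \<tau> \<tau>'
  proof -
    obtain n :: int where n: "2 * of_real pi * \<i> * \<tau>' / of_real h = 2 * of_real pi * \<i> * \<tau> / of_real h + (of_int (2 * n) * pi) * \<i>"
      using qq(1)[symmetric] unfolding qpar_def exp_eq by blast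
    have "(2 * of_real pi * \<i>) * \<tau>' = (2 * of_real pi * \<i>) * (\<tau> + of_int n * of_real h)"
      using n h by (simp add: field_simps)
    then have "\<tau>' = \<tau> + of_int n * of_real h" by (subst (asm) mult_cancel_left) auto
    then show ?thesis using per_int[OF qq(2)] by simp
  qed
  define G where "G w = u (qlog h (Ln w))" for w
  define D1 D2 where "D1 = ball (0::complex) 1 \<inter> - \<real>\<^sub>\<le>\<^sub>0" "D2 = ball (0::complex) 1 \<inter> - \<real>\<^sub>\<ge>\<^sub>0"
  have nz: "w \<noteq> 0 \<and> norm w < 1" if "w \<in> D1 \<union> D2" for w
    using that by (auto simp: D1_D2_def)
  have o: "open D1" "open D2" unfolding D1_D2_def by (intro open_Int open_Compl open_ball closed_nonpos_Reals_complex closed_nonneg_Reals_complex)+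
  have qh: "qlog h holomorphic_on S" for S unfolding qlog_def by (intro holomorphic_intros) auto
  have "(u \<circ> (qlog h \<circ> Ln)) holomorphic_on D1"
  proof (rule holomorphic_on_compose_gen[OF _ hol])
    show "(qlog h \<circ> Ln) holomorphic_on D1"
      by (rule holomorphic_on_compose[OF _ qh]) (auto simp: D1_D2_def intro!: holomorphic_intros)
    show "(qlog h \<circ> Ln) ` D1 \<subseteq> uhp"
    proof (rule image_subsetI)
      fix w assume "w \<in> D1"
      then have "w \<noteq> 0" "norm w < 1" using nz[of w] by auto
      then show "(qlog h \<circ> Ln) w \<in> uhp" using qlog_in_uhp[OF h, of w "Ln w"] by simp
    qed
  qed
  then have h1: "G holomorphic_on D1" unfolding G_def o_def .
  \<comment> \<open>A logarithm with branch cut along the positive real axis.\<close>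
  define k where "k w = Ln (- w) + of_real pi * \<i>" for w
  have ek: "exp (k w) = w" if "w \<noteq> 0" for w using that by (simp add: k_def exp_add)
  have "(u \<circ> (qlog h \<circ> k)) holomorphic_on D2"
  proof (rule holomorphic_on_compose_gen[OF _ hol])
    have "(\<lambda>w. Ln (- w) + of_real pi * \<i>) holomorphic_on D2"
      by (intro holomorphic_intros) (auto simp: D1_D2_def complex_nonpos_Reals_iff complex_nonneg_Reals_iff)
    then show "(qlog h \<circ> k) holomorphic_on D2"
      by (intro holomorphic_on_compose[OF _ qh]) (simp add: k_def [abs_def])
    show "(qlog h \<circ> k) ` D2 \<subseteq> uhp"
    proof (rule image_subsetI)
      fix w assume "w \<in> D2"
      then have "w \<noteq> 0" "norm w < 1" using nz[of w] by auto
      then show "(qlog h \<circ> k) w \<in> uhp" using qlog_in_uhp[OF h, of w "k w"] ek by simp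
    qed
  qed
  then have "(\<lambda>w. u (qlog h (k w))) holomorphic_on D2" unfolding o_def .
  moreover have "u (qlog h (k w)) = G w" if "w \<in> D2" for w
  proof -
    have w: "w \<noteq> 0" "norm w < 1" using that by (auto simp: D1_D2_def)
    show ?thesis unfolding G_def
      by (rule qeq) (use w ek qlog_in_uhp[OF h] in \<open>auto simp: qpar_qlog[OF h]\<close>)
  qed
  ultimately have h2: "G holomorphic_on D2" by (metis (no_types, lifting) holomorphic_transform)
  have "D1 \<union> D2 = ball 0 1 - {0}"
    by (auto simp: D1_D2_def complex_nonpos_Reals_iff complex_nonneg_Reals_iff complex_eq_iff)
  then have hol_punct: "G holomorphic_on (ball 0 1 - {0})"
    using holomorphic_on_Un[OF h1 h2 o] by simp
  have "\<forall>\<^sub>F w in at 0. norm (G w) \<le> B"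
  proof -
    define r where "r = exp (- (2 * pi * y0 / h))"
    have "r > 0" by (simp add: r_def)
    then have "\<forall>\<^sub>F w in at 0. w \<noteq> 0 \<and> dist w 0 < r" unfolding eventually_at by auto
    then show ?thesis
    proof (rule eventually_mono)
      fix w :: complex assume w: "w \<noteq> 0 \<and> dist w 0 < r"
      have "ln (norm w) < ln r" using w \<open>r > 0\<close> by (subst ln_less_cancel_iff) auto
      then have "Re (Ln w) < - (2 * pi * y0 / h)" using w by (simp add: r_def)
      then have im: "Im (qlog h (Ln w)) \<ge> y0" using h by (simp add: Im_qlog field_simps)
      have "\<bar>Im (Ln w)\<bar> \<le> pi" using w mpi_less_Im_Ln[of w] Im_Ln_le_pi[of w] by auto
      then have "\<bar>h * Im (Ln w)\<bar> \<le> h * pi" using h by (simp add: abs_mult)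
      then have "\<bar>h * Im (Ln w)\<bar> / (2 * pi) \<le> h * pi / (2 * pi)" by (rule divide_right_mono) simp
      moreover have "\<bar>Re (qlog h (Ln w))\<bar> = \<bar>h * Im (Ln w)\<bar> / (2 * pi)" by (simp add: Re_qlog abs_divide)
      ultimately have "\<bar>Re (qlog h (Ln w))\<bar> \<le> h * pi / (2 * pi)" by simp
      also have "\<dots> \<le> h" using h by simp
      finally show "norm (G w) \<le> B" unfolding G_def using im by (intro bnd(2))
    qed
  qed
  then obtain F where F: "F holomorphic_on ball 0 1" "\<And>z. z \<in> ball 0 1 - {0} \<Longrightarrow> F z = G z"
    using holomorphic_on_extend_bounded[OF hol_punct] by auto
  have "u \<tau> = F (qpar h \<tau>)" if "\<tau> \<in> uhp" for \<tau>
  proof -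
    have "F (qpar h \<tau>) = G (qpar h \<tau>)" using norm_qpar_less_1[OF h that] by (intro F(2)) auto
    also have "\<dots> = u \<tau>" unfolding G_def
      by (rule qeq[symmetric]) (use that in \<open>auto simp: qpar_qlog[OF h]\<close>)
    finally show ?thesis by simp
  qed
  then show ?thesis using F(1) by (auto simp: q_expandable_def)
qed

lemma q_expandable_bounded:
  assumes h: "h > 0" and u: "q_expandable h u" and y: "y > 0"
  shows "\<exists>C. \<forall>\<tau>. Im \<tau> \<ge> y \<longrightarrow> norm (u \<tau>) \<le> C"
proof -
  obtain G where G: "G holomorphic_on ball 0 1" "\<And>\<tau>. \<tau> \<in> uhp \<Longrightarrow> u \<tau> = G (qpar h \<tau>)"
    using u by (auto simp: q_expandable_def)
  define r where "r = exp (- (2 * pi * y / h))"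
  have r: "r < 1" using h y by (simp add: r_def)
  have "compact (G ` cball 0 r)"
    by (intro compact_continuous_image holomorphic_on_imp_continuous_on holomorphic_on_subset[OF G(1)])
      (use r in auto)
  then obtain C where C: "\<And>w. w \<in> cball 0 r \<Longrightarrow> norm (G w) \<le> C"
    by (meson bounded_iff compact_imp_bounded imageI)
  have "norm (u \<tau>) \<le> C" if "Im \<tau> \<ge> y" for \<tau>
  proof -
    have "\<tau> \<in> uhp" using that y by (simp add: uhp_iff)
    moreover have "norm (qpar h \<tau>) \<le> r"
      unfolding norm_qpar r_def using that h by (simp add: divide_right_mono)
    ultimately show ?thesis using G(2) C by simp
  qed
  then show ?thesis by blast
qed

text \<open>Small imaginary part means \<open>|q|\<close> close to 1. The maximum principle on the discs \<open>|q| <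
r\<close> carries the bound inside.\<close>

lemma q_expandable_small_near_boundary_imp_zero:
  assumes h: "h > 0" and u: "q_expandable h u"
    and small: "\<And>e. e > 0 \<Longrightarrow> \<exists>d>0. \<forall>\<tau>\<in>uhp. Im \<tau> < d \<longrightarrow> norm (u \<tau>) \<le> e"
    and \<tau>: "\<tau> \<in> uhp"
  shows "u \<tau> = 0"
proof -
  obtain G where G: "G holomorphic_on ball 0 1" "\<And>\<tau>. \<tau> \<in> uhp \<Longrightarrow> u \<tau> = G (qpar h \<tau>)"
    using u by (auto simp: q_expandable_def)
  have "norm (u \<tau>) \<le> e" if e: "e > 0" for e
  proof -
    obtain d where d: "d > 0" "\<And>z. z \<in> uhp \<Longrightarrow> Im z < d \<Longrightarrow> norm (u z) \<le> e" using small[OF e] by blast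
    define y where "y = min d (Im \<tau>) / 2"
    have y: "y > 0" "y < d" "y < Im \<tau>" using d \<tau> by (auto simp: y_def uhp_iff)
    define r where "r = exp (- (2 * pi * y / h))"
    have r: "0 < r" "r < 1" using h y by (auto simp: r_def)
    have sub: "closure (ball 0 r) \<subseteq> ball (0::complex) 1" using r by (simp add: closure_ball) auto
    have "norm (G (qpar h \<tau>)) \<le> e"
    proof (rule maximum_modulus_frontier[of G "ball 0 r"])
      show "G holomorphic_on interior (ball 0 r)"
        by (rule holomorphic_on_subset[OF G(1)]) (use r in auto)
      show "continuous_on (closure (ball 0 r)) G"
        by (rule continuous_on_subset[OF holomorphic_on_imp_continuous_on[OF G(1)] sub])
      show "bounded (ball (0::complex) r)" by simp
      show "qpar h \<tau> \<in> ball 0 r"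
        using y h by (simp add: norm_qpar r_def divide_strict_right_mono)
      fix w assume "w \<in> frontier (ball (0::complex) r)"
      then have w: "norm w = r" using r by (simp add: frontier_ball)
      then have w0: "w \<noteq> 0" "norm w < 1" using r by auto
      let ?z = "qlog h (Ln w)"
      have z: "?z \<in> uhp" using qlog_in_uhp[OF h w0(2,1)] w0 by simp
      have "Re (Ln w) = - (2 * pi * y / h)" using w w0 by (simp add: r_def)
      then have "Im ?z = y" using h by (simp add: Im_qlog)
      then have "norm (u ?z) \<le> e" using d(2)[OF z] y by simp
      then show "norm (G w) \<le> e" using G(2)[OF z] w0 by (simp add: qpar_qlog[OF h])
    qed
    then show ?thesis using G(2)[OF \<tau>] by simp
  qed
  then show ?thesis by (metis dense norm_le_zero_iff not_le)
qed

section \<open>Reduction theory and the vanishing of forms of negative weight\<close>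

context finite_covolume
begin

text \<open>The sum of squares in the last alternative is \<open>1 / Im(\<sigma>\<inverse>\<gamma>gi)\<close>: modulo
\<open>\<Gamma>\<close>, every element is bounded or lies in one of finitely many horoballs at cusps.\<close>

theorem reduction_theory:
  "\<exists>R C. finite C \<and> (\<forall>\<sigma>\<in>C. cusp_at \<Gamma> \<sigma>) \<and>
    (\<forall>g\<in>SL2R. \<exists>\<gamma>\<in>\<Gamma>. norm (\<gamma> ** g) \<le> R \<or>
      (\<exists>\<sigma>\<in>C. ((adj2 \<sigma> ** (\<gamma> ** g))$2$1)\<^sup>2 + ((adj2 \<sigma> ** (\<gamma> ** g))$2$2)\<^sup>2 \<le> R))"
proof -
  from thin_part_reduction obtain S R0 where "finite S \<and> S \<subseteq> \<Gamma> \<and> (\<forall>B\<in>S. traceless B \<noteq> 0) \<and>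
    (\<forall>g\<in>SL2R. \<exists>\<gamma>\<in>\<Gamma>. norm (\<gamma> ** g) \<le> R0 \<or> (\<exists>B\<in>S. norm (conj_by (\<gamma> ** g) (traceless B)) \<le> R0))"
    by (elim exE)
  then have S: "finite S" "S \<subseteq> \<Gamma>" "\<And>B. B \<in> S \<Longrightarrow> traceless B \<noteq> 0" and
    red: "\<And>g. g \<in> SL2R \<Longrightarrow> \<exists>\<gamma>\<in>\<Gamma>. norm (\<gamma> ** g) \<le> R0 \<or> (\<exists>B\<in>S. norm (conj_by (\<gamma> ** g) (traceless B)) \<le> R0)"
    by simp_all
  define low where "low \<sigma> h r \<longleftrightarrow> ((adj2 \<sigma> ** h)$2$1)\<^sup>2 + ((adj2 \<sigma> ** h)$2$2)\<^sup>2 \<le> r" for \<sigma> h :: "real^2^2" and r :: real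
  define covers where "covers B R C \<longleftrightarrow> finite C \<and> (\<forall>\<sigma>\<in>C. cusp_at \<Gamma> \<sigma>) \<and> (\<forall>g\<in>SL2R. norm (conj_by g (traceless B)) \<le> R0 \<longrightarrow>
     (\<exists>\<gamma>\<in>\<Gamma>. norm (\<gamma> ** g) \<le> R \<or> (\<exists>\<sigma>\<in>C. low \<sigma> (\<gamma> ** g) R)))" for B R C
  have "\<forall>B\<in>S. \<exists>R C. covers B R C"
  proof
    fix B assume B: "B \<in> S"
    then have B\<Gamma>: "B \<in> \<Gamma>" "traceless B \<noteq> 0" using S by auto
    consider "det (traceless B) > 0" | "det (traceless B) < 0" | "det (traceless B) = 0" by linarith
    then show "\<exists>R C. covers B R C"
    proof cases
      case 1
      obtain R where R: "\<And>g. g \<in> SL2R \<Longrightarrow> norm (conj_by g (traceless B)) \<le> R0 \<Longrightarrow> norm g \<le> R"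
        using elliptic_bounded[OF _ 1, of R0] by auto
      show ?thesis unfolding covers_def
        by (intro exI[of _ R] exI[of _ "{}"] conjI ballI impI bexI[of _ "mat 1"] one_mem disjI1) (simp_all add: R)
    next
      case 2
      obtain R where "\<And>g. g \<in> SL2R \<Longrightarrow> norm (conj_by g (traceless B)) \<le> R0 \<Longrightarrow> \<exists>\<gamma>\<in>\<Gamma>. norm (\<gamma> ** g) \<le> R"
        using hyperbolic_cocompact[OF B\<Gamma>(1) 2, of R0] by auto
      then show ?thesis unfolding covers_def by (intro exI[of _ R] exI[of _ "{}"]) blast
    next
      case 3
      obtain \<sigma> R where R: "cusp_at \<Gamma> \<sigma>" "\<And>g. g \<in> SL2R \<Longrightarrow> norm (conj_by g (traceless B)) \<le> R0 \<Longrightarrow> low \<sigma> g R"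
        using parabolic_horoball[OF B\<Gamma> 3, of R0] unfolding low_def by blast
      show ?thesis unfolding covers_def
        by (intro exI[of _ R] exI[of _ "{\<sigma>}"] conjI ballI impI bexI[of _ "mat 1"] one_mem disjI2 bexI[of _ \<sigma>])
          (simp_all add: R)
    qed
  qed
  then obtain r c where "\<And>B. B \<in> S \<Longrightarrow> covers B (r B) (c B)" by metis
  then have rc: "\<And>B. B \<in> S \<Longrightarrow> finite (c B)" "\<And>B \<sigma>. B \<in> S \<Longrightarrow> \<sigma> \<in> c B \<Longrightarrow> cusp_at \<Gamma> \<sigma>"
    "\<And>B g. B \<in> S \<Longrightarrow> g \<in> SL2R \<Longrightarrow> norm (conj_by g (traceless B)) \<le> R0 \<Longrightarrow>
     \<exists>\<gamma>\<in>\<Gamma>. norm (\<gamma> ** g) \<le> r B \<or> (\<exists>\<sigma>\<in>c B. low \<sigma> (\<gamma> ** g) (r B))"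
    unfolding covers_def by blast+
  define R where "R = Max (insert R0 (r ` S))"
  define C where "C = (\<Union>B\<in>S. c B)"
  have RR: "R0 \<le> R" "\<And>B. B \<in> S \<Longrightarrow> r B \<le> R" using S by (auto simp: R_def)
  have "\<exists>\<gamma>\<in>\<Gamma>. norm (\<gamma> ** g) \<le> R \<or> (\<exists>\<sigma>\<in>C. low \<sigma> (\<gamma> ** g) R)" if g: "g \<in> SL2R" for g
  proof -
    obtain \<gamma> where \<gamma>: "\<gamma> \<in> \<Gamma>" and alt: "norm (\<gamma> ** g) \<le> R0 \<or> (\<exists>B\<in>S. norm (conj_by (\<gamma> ** g) (traceless B)) \<le> R0)"
      using red[OF g] by blast
    show ?thesis
    proof (cases "norm (\<gamma> ** g) \<le> R0")
      case True
      then have "norm (\<gamma> ** g) \<le> R" using RR(1) by linarith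
      then show ?thesis using \<gamma> by blast
    next
      case False
      then obtain B where B: "B \<in> S" "norm (conj_by (\<gamma> ** g) (traceless B)) \<le> R0" using alt by blast
      have "\<gamma> ** g \<in> SL2R" using g \<gamma> SL2R_mem by simp
      from rc(3)[OF B(1) this B(2)] obtain \<gamma>' where \<gamma>': "\<gamma>' \<in> \<Gamma>"
        "norm (\<gamma>' ** (\<gamma> ** g)) \<le> r B \<or> (\<exists>\<sigma>\<in>c B. low \<sigma> (\<gamma>' ** (\<gamma> ** g)) (r B))" by blast
      have "norm (\<gamma>' ** \<gamma> ** g) \<le> R \<or> (\<exists>\<sigma>\<in>C. low \<sigma> (\<gamma>' ** \<gamma> ** g) R)"
        using \<gamma>'(2)
      proof
        assume "norm (\<gamma>' ** (\<gamma> ** g)) \<le> r B"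
        then show ?thesis using RR(2)[OF B(1)] by (simp add: matrix_mul_assoc)
      next
        assume "\<exists>\<sigma>\<in>c B. low \<sigma> (\<gamma>' ** (\<gamma> ** g)) (r B)"
        then obtain \<sigma> where "\<sigma> \<in> c B" "low \<sigma> (\<gamma>' ** (\<gamma> ** g)) (r B)" by blast
        moreover from this have "low \<sigma> (\<gamma>' ** \<gamma> ** g) R"
          using RR(2)[OF B(1)] unfolding low_def matrix_mul_assoc by linarith
        ultimately show ?thesis using B(1) by (auto simp: C_def)
      qed
      then show ?thesis using mult_closed[OF \<gamma>'(1) \<gamma>] by blast
    qed
  qed
  moreover have "finite C" "\<forall>\<sigma>\<in>C. cusp_at \<Gamma> \<sigma>" using S(1) rc(1,2) by (auto simp: C_def)
  ultimately show ?thesis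
    unfolding low_def by (intro exI[of _ R] exI[of _ C]) blast
qed

end

lemma translation_entries [simp]:
  "translation t $ 1 $ 1 = 1" "translation t $ 1 $ 2 = t" "translation t $ 2 $ 1 = 0" "translation t $ 2 $ 2 = 1"
  by (simp_all add: translation_def)

context discrete_subgroup
begin

text \<open>A diagonal entry \<open>t\<close> with \<open>|t| < 1\<close> would conjugate a translation by
\<open>b\<close> into translations by \<open>t\<^sup>2\<^sup>nb\<close>, which accumulate at the identity. So the
stabiliser consists, up to sign, of translations, by a discrete nonzero subgroup of \<open>\<real>\<close>; its least
positive element is the width.\<close>

lemma cusp_width_exists:
  assumes "cusp_at \<Gamma> \<sigma>"
  obtains h where "cusp_width \<Gamma> \<sigma> h"
proof -
  have \<sigma>: "\<sigma> \<in> SL2R" using assms by (simp add: cusp_at_def)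
  define G where "G = conj_by \<sigma> ` \<Gamma>"
  have G_mult: "A ** B \<in> G" if AB: "A \<in> G" "B \<in> G" for A B
  proof -
    obtain A' B' where "A' \<in> \<Gamma>" "A = conj_by \<sigma> A'" "B' \<in> \<Gamma>" "B = conj_by \<sigma> B'" using AB by (auto simp: G_def)
    then show ?thesis unfolding G_def using \<sigma> mult_closed by (intro image_eqI[of _ _ "A' ** B'"]) (simp_all add: conj_by_mult)
  qed
  have G_adj: "adj2 A \<in> G" if A: "A \<in> G" for A
  proof -
    obtain A' where "A' \<in> \<Gamma>" "A = conj_by \<sigma> A'" using A by (auto simp: G_def)
    then show ?thesis unfolding G_def using \<sigma> adj2_closed by (intro image_eqI[of _ _ "adj2 A'"]) (simp_all add: adj2_conj_by)
  qed
  have G_uminus: "- A \<in> G" if A: "A \<in> G" for A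
  proof -
    obtain A' where "A' \<in> \<Gamma>" "A = conj_by \<sigma> A'" using A by (auto simp: G_def)
    moreover have "conj_by \<sigma> (- A') = - conj_by \<sigma> A'" using \<sigma> by (simp add: conj_by_SL2R mat2_eq_iff algebra_simps)
    ultimately show ?thesis unfolding G_def using uminus_mem by (intro image_eqI[of _ _ "- A'"]) simp_all
  qed
  have G_one: "mat 1 \<in> G" unfolding G_def using \<sigma> one_mem by (intro image_eqI[of _ _ "mat 1"]) simp_all
  have G_S: "A \<in> SL2R" if "A \<in> G" for A using that \<sigma> SL2R_mem by (auto simp: G_def)
  have G_fin: "finite {A \<in> G. norm A \<le> c}" for c
  proof (rule finite_subset)
    show "{A \<in> G. norm A \<le> c} \<subseteq> conj_by \<sigma> ` {A \<in> \<Gamma>. norm (conj_by \<sigma> A - mat 1) \<le> c + 2}"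
    proof safe
      fix A assume "A \<in> G" "norm A \<le> c"
      then obtain A' where A': "A' \<in> \<Gamma>" "A = conj_by \<sigma> A'" by (auto simp: G_def)
      have "norm (A - mat 1) \<le> c + 2"
        using norm_triangle_ineq4[of A "mat 1"] norm_one_mat2_le \<open>norm A \<le> c\<close> by linarith
      then show "A \<in> conj_by \<sigma> ` {A \<in> \<Gamma>. norm (conj_by \<sigma> A - mat 1) \<le> c + 2}" using A' by auto
    qed
    show "finite (conj_by \<sigma> ` {A \<in> \<Gamma>. norm (conj_by \<sigma> A - mat 1) \<le> c + 2})"
      by (intro finite_imageI finite_small_at \<sigma>)
  qed
  define L where "L = {x. translation x \<in> G}"
  have L_add: "x + y \<in> L" if "x \<in> L" "y \<in> L" for x y
  proof -
    have "translation (x + y) = translation x ** translation y" by (simp add: mat2_eq_iff)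
    then show ?thesis using that G_mult by (simp add: L_def)
  qed
  have L_minus: "- x \<in> L" if "x \<in> L" for x
  proof -
    have "translation (- x) = adj2 (translation x)" by (simp add: mat2_eq_iff)
    then show ?thesis using that G_adj by (simp add: L_def)
  qed
  have L_zero: "0 \<in> L"
  proof -
    have "translation 0 = mat 1" by (simp add: mat2_eq_iff)
    then show ?thesis using G_one by (simp add: L_def)
  qed
  have L_fin: "finite {x \<in> L. \<bar>x\<bar> \<le> c}" for c
  proof (rule finite_imageD)
    show "inj_on translation {x \<in> L. \<bar>x\<bar> \<le> c}" by (rule inj_onI) (simp add: mat2_eq_iff)
    show "finite (translation ` {x \<in> L. \<bar>x\<bar> \<le> c})"
      by (rule finite_subset[OF _ G_fin[of "2 * max 1 c"]]) (auto simp: L_def intro!: norm_mat2_le)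
  qed
  have L_nat: "of_nat n * x \<in> L" if "x \<in> L" for n x
    by (induction n) (use that L_zero L_add in \<open>auto simp: algebra_simps\<close>)
  have L_int: "of_int n * x \<in> L" if "x \<in> L" for n x
  proof (cases "n \<ge> 0")
    case True
    then show ?thesis using L_nat[OF that, of "nat n"] by simp
  next
    case False
    then show ?thesis using L_minus[OF L_nat[OF that, of "nat (- n)"]] by simp
  qed
  obtain b where b: "b \<in> L" "b \<noteq> 0"
  proof -
    obtain \<gamma> where \<gamma>: "\<gamma> \<in> \<Gamma>" "parabolic \<gamma>" "conj_by \<sigma> \<gamma> $ 2 $ 1 = 0" using assms by (auto simp: cusp_at_def)
    define A where "A = conj_by \<sigma> \<gamma>"
    have A: "A \<in> G" "A$2$1 = 0" using \<gamma> by (auto simp: A_def G_def)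
    have \<gamma>S: "\<gamma> \<in> SL2R" "traceless \<gamma> \<noteq> 0" using \<gamma>(2) by (auto simp: parabolic_def traceless_eq_0_SL2R)
    have "det (traceless \<gamma>) = \<gamma>$1$1 * \<gamma>$2$2 - \<gamma>$1$2 * \<gamma>$2$1 - (\<gamma>$1$1 + \<gamma>$2$2)\<^sup>2 / 4"
      by (simp add: det_2 power2_eq_square field_simps)
    moreover have "\<bar>\<gamma>$1$1 + \<gamma>$2$2\<bar>\<^sup>2 = 2\<^sup>2" using \<gamma>(2) by (simp add: parabolic_def trace_def sum_2)
    ultimately have "det (traceless \<gamma>) = 0" using \<gamma>S by (simp add: SL2R_iff)
    then have "det (traceless A) = 0" using \<sigma> by (simp add: A_def det_traceless_conj_by)
    then have dd: "A$1$1 = A$2$2" using A(2) by (simp add: det_2)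
    have "traceless A \<noteq> 0"
      using \<gamma>S \<sigma> conj_by_cancel[OF \<sigma>, of "traceless \<gamma>" 0] by (simp add: A_def traceless_conj_by) (simp add: conj_by_SL2R)
    then have b: "A$1$2 \<noteq> 0" using A dd by (auto simp: mat2_eq_iff)
    have "A$2$2 * A$2$2 = 1" using G_S[OF A(1)] A(2) dd by (simp add: SL2R_iff)
    then consider "A$2$2 = 1" | "A$2$2 = -1" using square_eq_1_iff by blast
    then show ?thesis
    proof cases
      case 1
      then have "A = translation (A$1$2)" using A dd by (simp add: mat2_eq_iff)
      then show ?thesis using that[of "A$1$2"] b A(1) by (simp add: L_def)
    next
      case 2
      then have "- A = translation (- A$1$2)" using A dd by (simp add: mat2_eq_iff)
      then show ?thesis using that[of "- A$1$2"] b G_uminus[OF A(1)] by (simp add: L_def)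
    qed
  qed
  \<comment> \<open>Both \<open>A\<close> and its inverse are excluded from contracting, and their diagonal entries are reciprocal.\<close>
  have unip: "\<bar>A$1$1\<bar> = 1" if A: "A \<in> G" "A$2$1 = 0" for A
  proof -
    have no_contraction: "\<not> \<bar>M$1$1\<bar> < 1" if M: "M \<in> G" "M$2$1 = 0" for M
    proof
      assume lt: "\<bar>M$1$1\<bar> < 1"
      define t where "t = M$1$1"
      have tu: "t * M$2$2 = 1" using G_S[OF M(1)] M(2) by (simp add: SL2R_iff t_def)
      then have t0: "t \<noteq> 0" by auto
      have step: "t\<^sup>2 * x \<in> L" if x: "x \<in> L" for x
      proof -
        have "M ** translation x ** adj2 M = translation (t\<^sup>2 * x)"
          using M(2) tu by (simp add: mat2_eq_iff t_def[symmetric] power2_eq_square algebra_simps)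
        then show ?thesis using x M G_mult G_adj unfolding L_def by (metis mem_Collect_eq)
      qed
      have pow: "(t\<^sup>2) ^ n * b \<in> L" for n
        by (induction n) (use b step in \<open>auto simp: mult.assoc\<close>)
      have t2: "0 < t\<^sup>2" "t\<^sup>2 < 1" using t0 lt by (auto simp: t_def abs_square_less_1)
      have "inj (\<lambda>n. (t\<^sup>2) ^ n * b)"
      proof (rule injI)
        fix m n assume "(t\<^sup>2) ^ m * b = (t\<^sup>2) ^ n * b"
        then have "(t\<^sup>2) ^ m = (t\<^sup>2) ^ n" using b by simp
        then show "m = n" using t2 by (metis power_strict_decreasing_iff linorder_neq_iff)
      qed
      then have "infinite (range (\<lambda>n. (t\<^sup>2) ^ n * b))" by (rule range_inj_infinite)
      moreover have "range (\<lambda>n. (t\<^sup>2) ^ n * b) \<subseteq> {x \<in> L. \<bar>x\<bar> \<le> \<bar>b\<bar>}"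
      proof safe
        fix n
        show "(t\<^sup>2) ^ n * b \<in> L" by (rule pow)
        have "(t\<^sup>2) ^ n \<le> 1" by (rule power_le_one) (use t2 in auto)
        then show "\<bar>(t\<^sup>2) ^ n * b\<bar> \<le> \<bar>b\<bar>" using t2 by (simp add: abs_mult mult_left_le_one_le)
      qed
      ultimately show False using L_fin finite_subset by blast
    qed
    have "A$1$1 * A$2$2 = 1" using G_S[OF A(1)] A(2) by (simp add: SL2R_iff)
    then have "\<bar>A$1$1\<bar> * \<bar>A$2$2\<bar> = 1" by (metis abs_1 abs_mult)
    moreover have "\<not> \<bar>A$1$1\<bar> < 1" "\<not> \<bar>A$2$2\<bar> < 1"
      using no_contraction[OF A] no_contraction[OF G_adj[OF A(1)]] A(2) by auto
    ultimately show ?thesis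
      by (metis abs_ge_zero linorder_not_less mult.right_neutral mult_left_mono order_antisym)
  qed
  define P where "P = {x \<in> L. 0 < x \<and> x \<le> \<bar>b\<bar>}"
  have finP: "finite P" by (rule finite_subset[OF _ L_fin[of "\<bar>b\<bar>"]]) (auto simp: P_def)
  have "\<bar>b\<bar> \<in> P" using b L_minus by (auto simp: P_def abs_if)
  define h where "h = Min P"
  have hP: "h \<in> P" unfolding h_def by (rule Min_in) (use finP \<open>\<bar>b\<bar> \<in> P\<close> in auto)
  then have h: "h \<in> L" "h > 0" "h \<le> \<bar>b\<bar>" by (auto simp: P_def)
  have L_eq: "\<exists>n::int. x = of_int n * h" if "x \<in> L" for x
  proof -
    define y where "y = x - of_int \<lfloor>x / h\<rfloor> * h"
    have "y \<in> L" using L_add[OF that L_minus[OF L_int[OF h(1), of "\<lfloor>x / h\<rfloor>"]]] by (simp add: y_def)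
    have fl: "of_int \<lfloor>x / h\<rfloor> \<le> x / h" "x / h < of_int \<lfloor>x / h\<rfloor> + 1" by linarith+
    have xh: "x / h * h = x" using h(2) by simp
    have "0 \<le> y" using mult_right_mono[OF fl(1), of h] h(2) unfolding xh by (simp add: y_def)
    have "y < h" using mult_strict_right_mono[OF fl(2) h(2)] unfolding xh by (simp add: y_def algebra_simps)
    have "\<not> y > 0"
    proof
      assume "y > 0"
      then have "y \<in> P" using \<open>y \<in> L\<close> \<open>y < h\<close> h(3) by (simp add: P_def)
      then have "h \<le> y" unfolding h_def by (rule Min_le[OF finP])
      then show False using \<open>y < h\<close> by simp
    qed
    then have "y = 0" using \<open>0 \<le> y\<close> by simp
    then show ?thesis by (intro exI[of _ "\<lfloor>x / h\<rfloor>"]) (simp add: y_def)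
  qed
  have "cusp_width \<Gamma> \<sigma> h"
    unfolding cusp_width_def G_def[symmetric]
  proof (intro conjI h(2) Set.set_eqI iffI)
    fix A assume "A \<in> {\<delta> \<in> G. \<delta>$2$1 = 0}"
    then have A: "A \<in> G" "A$2$1 = 0" by auto
    have "A$1$1 * A$2$2 = 1" using G_S[OF A(1)] A(2) by (simp add: SL2R_iff)
    moreover have "A$1$1 = 1 \<or> A$1$1 = -1" using unip[OF A] by linarith
    ultimately consider "A$1$1 = 1" "A$2$2 = 1" | "A$1$1 = -1" "A$2$2 = -1" by auto
    then show "A \<in> {\<delta>. \<exists>n::int. \<delta> = translation (of_int n * h) \<or> \<delta> = - translation (of_int n * h)}"
    proof cases
      case 1
      then have e: "A = translation (A$1$2)" using A by (simp add: mat2_eq_iff)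
      then have "A$1$2 \<in> L" using A(1) by (simp add: L_def)
      then show ?thesis using L_eq e by (metis (mono_tags, lifting) mem_Collect_eq)
    next
      case 2
      then have e: "A = - translation (- A$1$2)" using A by (simp add: mat2_eq_iff)
      then have "- A = translation (- A$1$2)" by (simp add: mat2_eq_iff 2 A(2))
      then have "- A$1$2 \<in> L" using G_uminus[OF A(1)] by (simp add: L_def)
      then show ?thesis using L_eq e by (metis (mono_tags, lifting) mem_Collect_eq)
    qed
  next
    fix A assume "A \<in> {\<delta>. \<exists>n::int. \<delta> = translation (of_int n * h) \<or> \<delta> = - translation (of_int n * h)}"
    then obtain n :: int where "A = translation (of_int n * h) \<or> A = - translation (of_int n * h)" by blast
    moreover have "translation (of_int n * h) \<in> G" using L_int[OF h(1)] by (simp add: L_def)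
    ultimately show "A \<in> {\<delta> \<in> G. \<delta>$2$1 = 0}" using G_uminus by auto
  qed
  then show ?thesis by (rule that)
qed

end

lemma modular_forms_cusp:
  assumes "f \<in> modular_forms \<Gamma> k" "cusp_at \<Gamma> \<sigma>" "cusp_width \<Gamma> \<sigma> h"
  shows "q_expandable h (slash k \<sigma> f)"
  using assms by (subst q_expandable_iff_power_series) (auto simp: modular_forms_def cusp_width_def)

context finite_covolume
begin

text \<open>The invariant function is used in the form \<open>\<phi>(g) = |(f|\<^sub>kg)(i)|\<close> on
\<open>SL\<^sub>2(\<real>)\<close>, for which left invariance is the cocycle property of the slash action. In weight
\<open>-n < 0\<close> it carries the factor \<open>|j|\<^sup>n\<close>, which is bounded on horoballs.\<close>

theorem modular_forms_negative_weight:
  assumes cusp: "cusp_at \<Gamma> \<sigma>0" and f: "f \<in> modular_forms \<Gamma> k" and k: "k < 0"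
  shows "f = (\<lambda>_. 0)"
proof -
  obtain n where n: "k = - int n" "n > 0" using k by (metis neg_int_cases)
  have fhol: "f holomorphic_on uhp" and fout: "\<And>\<tau>. \<tau> \<notin> uhp \<Longrightarrow> f \<tau> = 0"
    and finv: "\<And>\<gamma> \<tau>. \<gamma> \<in> \<Gamma> \<Longrightarrow> \<tau> \<in> uhp \<Longrightarrow> slash k \<gamma> f \<tau> = f \<tau>"
    using f by (auto simp: modular_forms_def)
  have i: "\<i> \<in> uhp" by (simp add: uhp_iff)
  define \<phi> where "\<phi> g = norm (slash k g f \<i>)" for g
  have \<phi>: "\<phi> g = norm (jfac g \<i>) ^ n * norm (f (moeb g \<i>))" for g
    by (simp add: \<phi>_def slash_def n norm_mult norm_power)
  have \<phi>_inv: "\<phi> (\<gamma> ** g) = \<phi> g" if "\<gamma> \<in> \<Gamma>" "g \<in> SL2R" for \<gamma> g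
  proof -
    have "slash k (\<gamma> ** g) f \<i> = slash k g (slash k \<gamma> f) \<i>"
      by (rule slash_mult) (use that i SL2R_mem in auto)
    also have "\<dots> = slash k g f \<i>" unfolding slash_def[of k g] using finv[OF that(1), of "moeb g \<i>"] that i by simp
    finally show ?thesis by (simp add: \<phi>_def)
  qed
  have norm_j: "(norm (jfac g \<i>))\<^sup>2 = (g$2$1)\<^sup>2 + (g$2$2)\<^sup>2" for g
    by (simp add: jfac_def cmod_power2)
  have compact_bound: "\<exists>B. \<forall>g\<in>SL2R. norm g \<le> R \<longrightarrow> \<phi> g \<le> B" for R
  proof -
    let ?K = "{g \<in> SL2R. norm g \<le> R}"
    have entry: "continuous_on S (\<lambda>g. g $ i $ j)" for S :: "(real^2^2) set" and i j
      by (intro continuous_intros)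
    have "closed ?K"
    proof -
      have "?K = {g. det g = 1} \<inter> cball 0 R" by (auto simp: SL2R_def)
      moreover have "closed {g :: real^2^2. det g = 1}"
        unfolding det_2 by (intro closed_Collect_eq continuous_intros entry)
      ultimately show ?thesis by (simp add: closed_Int)
    qed
    moreover have "bounded ?K" by (auto simp: bounded_iff)
    ultimately have K: "compact ?K" by (simp add: compact_eq_bounded_closed)
    have cj: "continuous_on ?K (\<lambda>g. jfac g \<i>)" unfolding jfac_def by (intro continuous_intros entry)
    have "continuous_on ?K (\<lambda>g. moeb g \<i>)"
      unfolding moeb_eq by (intro continuous_intros entry cj) (use i in auto)
    moreover have "(\<lambda>g. moeb g \<i>) ` ?K \<subseteq> uhp" using i by auto
    ultimately have "continuous_on ?K (\<lambda>g. f (moeb g \<i>))"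
      using continuous_on_compose2[OF holomorphic_on_imp_continuous_on[OF fhol]] by blast
    then have "continuous_on ?K \<phi>" unfolding \<phi> by (intro continuous_intros cj)
    then have "compact (\<phi> ` ?K)" using K by (rule compact_continuous_image)
    then obtain B where "\<And>x. x \<in> \<phi> ` ?K \<Longrightarrow> norm x \<le> B" by (meson bounded_iff compact_imp_bounded)
    then show ?thesis by (intro exI[of _ B]) force
  qed
  have horoball_bound: "\<exists>B. \<forall>g\<in>SL2R. ((adj2 \<sigma> ** g)$2$1)\<^sup>2 + ((adj2 \<sigma> ** g)$2$2)\<^sup>2 \<le> R \<longrightarrow> \<phi> g \<le> B"
    if \<sigma>: "cusp_at \<Gamma> \<sigma>" for \<sigma> R
  proof (cases "R > 0")
    case True
    have \<sigma>S: "\<sigma> \<in> SL2R" using \<sigma> by (simp add: cusp_at_def)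
    obtain h where h: "cusp_width \<Gamma> \<sigma> h" using cusp_width_exists[OF \<sigma>] .
    then have "h > 0" by (simp add: cusp_width_def)
    from q_expandable_bounded[OF this modular_forms_cusp[OF f \<sigma> h], of "1 / R"] True
    obtain C where C: "\<And>\<tau>. Im \<tau> \<ge> 1 / R \<Longrightarrow> norm (slash k \<sigma> f \<tau>) \<le> C" by auto
    have "\<phi> g \<le> sqrt R ^ n * C" if g: "g \<in> SL2R" and le: "((adj2 \<sigma> ** g)$2$1)\<^sup>2 + ((adj2 \<sigma> ** g)$2$2)\<^sup>2 \<le> R" for g
    proof -
      define m where "m = adj2 \<sigma> ** g"
      have m: "m \<in> SL2R" "g = \<sigma> ** m" using \<sigma>S g by (simp_all add: m_def)
      have jm: "(norm (jfac m \<i>))\<^sup>2 \<le> R" unfolding norm_j m_def by (rule le)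
      have "jfac m \<i> \<noteq> 0" using m i by simp
      then have "1 / R \<le> 1 / (norm (jfac m \<i>))\<^sup>2" using jm True by (intro divide_left_mono mult_pos_pos) auto
      then have im: "Im (moeb m \<i>) \<ge> 1 / R" using Im_moeb[OF m(1) i] by simp
      have "\<phi> g = norm (slash k m (slash k \<sigma> f) \<i>)"
        unfolding \<phi>_def m(2) using slash_mult[OF \<sigma>S m(1) i] by simp
      also have "\<dots> = norm (jfac m \<i>) ^ n * norm (slash k \<sigma> f (moeb m \<i>))"
        unfolding slash_def[of k m "slash k \<sigma> f"] by (simp add: n(1) norm_mult norm_power)
      also have "\<dots> \<le> sqrt R ^ n * C"
        using C[OF im] real_le_rsqrt[OF jm] True by (intro mult_mono power_mono) auto
      finally show ?thesis .
    qed
    then show ?thesis by blast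
  next
    case False
    have "((adj2 \<sigma> ** g)$2$1)\<^sup>2 + ((adj2 \<sigma> ** g)$2$2)\<^sup>2 > 0" if "g \<in> SL2R" for g
    proof -
      have "adj2 \<sigma> ** g \<in> SL2R" using \<sigma> that by (simp add: cusp_at_def)
      then have "jfac (adj2 \<sigma> ** g) \<i> \<noteq> 0" using i by simp
      then show ?thesis unfolding norm_j[symmetric] by simp
    qed
    then show ?thesis using False by (meson leD le_less_trans not_le)
  qed
  from reduction_theory obtain R C where "finite C \<and> (\<forall>\<sigma>\<in>C. cusp_at \<Gamma> \<sigma>) \<and>
    (\<forall>g\<in>SL2R. \<exists>\<gamma>\<in>\<Gamma>. norm (\<gamma> ** g) \<le> R \<or>
      (\<exists>\<sigma>\<in>C. ((adj2 \<sigma> ** (\<gamma> ** g))$2$1)\<^sup>2 + ((adj2 \<sigma> ** (\<gamma> ** g))$2$2)\<^sup>2 \<le> R))"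
    by (elim exE)
  then have C: "finite C" "\<And>\<sigma>. \<sigma> \<in> C \<Longrightarrow> cusp_at \<Gamma> \<sigma>" and
    red: "\<And>g. g \<in> SL2R \<Longrightarrow> \<exists>\<gamma>\<in>\<Gamma>. norm (\<gamma> ** g) \<le> R \<or>
      (\<exists>\<sigma>\<in>C. ((adj2 \<sigma> ** (\<gamma> ** g))$2$1)\<^sup>2 + ((adj2 \<sigma> ** (\<gamma> ** g))$2$2)\<^sup>2 \<le> R)"
    by simp_all
  obtain B0 where B0: "\<And>g. g \<in> SL2R \<Longrightarrow> norm g \<le> R \<Longrightarrow> \<phi> g \<le> B0" using compact_bound by blast
  have "\<forall>\<sigma>\<in>C. \<exists>B. \<forall>g\<in>SL2R. ((adj2 \<sigma> ** g)$2$1)\<^sup>2 + ((adj2 \<sigma> ** g)$2$2)\<^sup>2 \<le> R \<longrightarrow> \<phi> g \<le> B"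
    using horoball_bound C by blast
  then obtain B1 where B1: "\<And>\<sigma> g. \<sigma> \<in> C \<Longrightarrow> g \<in> SL2R \<Longrightarrow> ((adj2 \<sigma> ** g)$2$1)\<^sup>2 + ((adj2 \<sigma> ** g)$2$2)\<^sup>2 \<le> R \<Longrightarrow> \<phi> g \<le> B1 \<sigma>"
    by metis
  define B where "B = Max (insert 0 (insert B0 (B1 ` C)))"
  have BB: "0 \<le> B" "B0 \<le> B" "\<And>\<sigma>. \<sigma> \<in> C \<Longrightarrow> B1 \<sigma> \<le> B"
    unfolding B_def by (rule Max_ge; use C(1) in simp)+
  have bound: "\<phi> g \<le> B" if g: "g \<in> SL2R" for g
  proof -
    obtain \<gamma> where \<gamma>: "\<gamma> \<in> \<Gamma>" and alt: "norm (\<gamma> ** g) \<le> R \<or>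
      (\<exists>\<sigma>\<in>C. ((adj2 \<sigma> ** (\<gamma> ** g))$2$1)\<^sup>2 + ((adj2 \<sigma> ** (\<gamma> ** g))$2$2)\<^sup>2 \<le> R)"
      using red[OF g] by blast
    have S: "\<gamma> ** g \<in> SL2R" using g \<gamma> SL2R_mem by simp
    have "\<phi> (\<gamma> ** g) \<le> B" using alt
    proof
      assume "norm (\<gamma> ** g) \<le> R" then show ?thesis using B0[OF S] BB by linarith
    next
      assume "\<exists>\<sigma>\<in>C. ((adj2 \<sigma> ** (\<gamma> ** g))$2$1)\<^sup>2 + ((adj2 \<sigma> ** (\<gamma> ** g))$2$2)\<^sup>2 \<le> R"
      then obtain \<sigma> where "\<sigma> \<in> C" "\<phi> (\<gamma> ** g) \<le> B1 \<sigma>" using B1[OF _ S] by blast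
      then show ?thesis using BB(3) by force
    qed
    then show ?thesis using \<phi>_inv[OF \<gamma> g] by simp
  qed
  have \<sigma>0: "\<sigma>0 \<in> SL2R" using cusp by (simp add: cusp_at_def)
  obtain h where h: "cusp_width \<Gamma> \<sigma>0 h" using cusp_width_exists[OF cusp] .
  then have hpos: "h > 0" by (simp add: cusp_width_def)
  define F where "F = slash k \<sigma>0 f"
  \<comment> \<open>In terms of \<open>z = mi\<close> the bound on \<open>\<phi>\<close> is a bound for \<open>F\<close> by a power of \<open>Im z\<close>, since \<open>|j(m,i)|\<^sup>2 = 1 / Im z\<close>.\<close>
  have growth: "norm (F z) \<le> B * sqrt (Im z) ^ n" if z: "z \<in> uhp" for z
  proof -
    obtain m where m: "m \<in> SL2R" "moeb m \<i> = z" using SL2R_transitive[OF z] .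
    have j0: "norm (jfac m \<i>) > 0" using m(1) i by simp
    have "Im z = 1 / (norm (jfac m \<i>))\<^sup>2" using Im_moeb[OF m(1) i] m(2) by simp
    then have s: "sqrt (Im z) = 1 / norm (jfac m \<i>)" by (simp add: real_sqrt_divide)
    have "\<phi> (\<sigma>0 ** m) = norm (slash k m F \<i>)"
      unfolding \<phi>_def F_def using slash_mult[OF \<sigma>0 m(1) i] by simp
    also have "\<dots> = norm (jfac m \<i>) ^ n * norm (F z)"
      by (simp add: slash_def n norm_mult norm_power m(2))
    finally have "norm (jfac m \<i>) ^ n * norm (F z) \<le> B" using bound[of "\<sigma>0 ** m"] \<sigma>0 m(1) by simp
    then show ?thesis unfolding s using j0 by (simp add: power_divide field_simps)
  qed
  have F0: "F z = 0" if "z \<in> uhp" for z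
  proof (rule q_expandable_small_near_boundary_imp_zero[OF hpos _ _ that])
    show "q_expandable h F" unfolding F_def by (rule modular_forms_cusp[OF f cusp h])
    fix e :: real assume e: "e > 0"
    define d where "d = (min 1 (e / (B + 1)))\<^sup>2"
    have mpos: "0 < min 1 (e / (B + 1))" using e BB(1) by simp
    have "norm (F z) \<le> e" if z: "z \<in> uhp" "Im z < d" for z
    proof -
      have s: "sqrt (Im z) < min 1 (e / (B + 1))"
        using z(2) mpos unfolding d_def by (intro real_less_lsqrt) auto
      have s0: "0 \<le> sqrt (Im z)" using z(1) by (simp add: uhp_iff)
      have "sqrt (Im z) ^ n \<le> sqrt (Im z) ^ 1"
        using s s0 n(2) by (intro power_decreasing) auto
      then have "B * sqrt (Im z) ^ n \<le> B * (e / (B + 1))"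
        using s BB(1) by (intro mult_left_mono) auto
      also have "\<dots> \<le> e" using BB(1) e by (simp add: field_simps)
      finally show ?thesis using growth[OF z(1)] by linarith
    qed
    then show "\<exists>d>0. \<forall>\<tau>\<in>uhp. Im \<tau> < d \<longrightarrow> norm (F \<tau>) \<le> e"
      using mpos by (intro exI[of _ d]) (auto simp: d_def)
  qed
  have "f \<tau> = 0" if \<tau>: "\<tau> \<in> uhp" for \<tau>
  proof -
    let ?z = "moeb (adj2 \<sigma>0) \<tau>"
    have z: "?z \<in> uhp" using \<sigma>0 \<tau> by simp
    have "moeb \<sigma>0 ?z = \<tau>" using moeb_mult[of \<sigma>0 "adj2 \<sigma>0" \<tau>] \<sigma>0 \<tau> by simp
    then have "jfac \<sigma>0 ?z powi (- k) * f \<tau> = 0" using F0[OF z] by (simp add: F_def slash_def)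
    moreover have "jfac \<sigma>0 ?z \<noteq> 0" using \<sigma>0 z by simp
    ultimately show ?thesis by (simp add: power_int_eq_0_iff)
  qed
  then show ?thesis using fout by blast
qed

end

lemma fuchsian_finite_covolume:
  assumes "fuchsian_first_kind \<Gamma>"
  obtains D where "finite_covolume \<Gamma> D"
proof -
  interpret discrete_subgroup \<Gamma> by (rule fuchsian_discrete_subgroup[OF assms])
  obtain D where D: "fundamental_domain \<Gamma> D" "(\<integral>\<^sup>+\<tau>\<in>D. ennreal (1 / (Im \<tau>)\<^sup>2) \<partial>lborel) < \<infinity>"
    using assms by (auto simp: fuchsian_first_kind_def)
  have "emeasure hyp_area D < \<infinity>"
    using D by (subst emeasure_hyp_area) (auto simp: fundamental_domain_def)
  then have "finite_covolume \<Gamma> D" using D(1) by unfold_locales auto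
  then show ?thesis by (rule that)
qed

section \<open>The action of L(0) and L(1)\<close>

lemma Sum_any_eq_sum:
  assumes "finite A" "\<And>x. x \<notin> A \<Longrightarrow> f x = 0"
  shows "Sum_any f = sum f A"
  by (rule Sum_any.expand_superset) (use assms in auto)

locale cft_voa = vertex_operator_algebra V for V :: "'v::ab_group_add voa" +
  assumes cft: "cft_type V"
begin

abbreviation L :: "'v \<Rightarrow> 'v" where "L \<equiv> vir V 1"

lemma hcomp_props:
  "hcomp V v n \<in> hsp V n" "finite {n. hcomp V v n \<noteq> 0}" "Sum_any (hcomp V v) = v"
  using theI'[OF hsp_decomposition[of v]] unfolding hcomp_def by blast+

lemma hcomp_unique:
  assumes "\<And>n. c n \<in> hsp V n" "finite {n. c n \<noteq> 0}" "Sum_any c = v"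
  shows "hcomp V v = c"
  using hsp_decomposition[of v] hcomp_props[of v] assms by blast

lemma hcomp_unique_sum:
  assumes "\<And>n. c n \<in> hsp V n" "finite A" "\<And>n. n \<notin> A \<Longrightarrow> c n = 0" "sum c A = v"
  shows "hcomp V v = c"
proof (rule hcomp_unique[OF assms(1)])
  show "finite {n. c n \<noteq> 0}" by (rule finite_subset[OF _ assms(2)]) (use assms(3) in auto)
  show "Sum_any c = v" using Sum_any_eq_sum[of A c] assms by simp
qed

lemma hcomp_support:
  obtains A where "finite A" "\<And>n. n \<notin> A \<Longrightarrow> hcomp V v n = 0" "sum (hcomp V v) A = v"
proof
  show "finite {n. hcomp V v n \<noteq> 0}" by (rule hcomp_props)
  show "sum (hcomp V v) {n. hcomp V v n \<noteq> 0} = v"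
    using Sum_any_eq_sum[OF hcomp_props(2)[of v], of "hcomp V v"] hcomp_props(3)[of v] by auto
qed auto

lemma hsp_zero [simp]: "0 \<in> hsp V n"
  by (rule subspace_0[OF hsp_subspace])
lemma hsp_add: "v \<in> hsp V n \<Longrightarrow> w \<in> hsp V n \<Longrightarrow> v + w \<in> hsp V n"
  by (rule subspace_add[OF hsp_subspace])
lemma hsp_scale: "v \<in> hsp V n \<Longrightarrow> smul V c v \<in> hsp V n"
  by (rule subspace_scale[OF hsp_subspace])

lemma hcomp_add: "hcomp V (v + w) n = hcomp V v n + hcomp V w n"
proof -
  obtain A where A: "finite A" "\<And>n. n \<notin> A \<Longrightarrow> hcomp V v n = 0" "sum (hcomp V v) A = v" using hcomp_support[of v] by blast
  obtain B where B: "finite B" "\<And>n. n \<notin> B \<Longrightarrow> hcomp V w n = 0" "sum (hcomp V w) B = w" using hcomp_support[of w] by blast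
  have "sum (hcomp V v) (A \<union> B) = v"
    using A B by (subst sum.mono_neutral_right[of "A \<union> B" A]) auto
  moreover have "sum (hcomp V w) (A \<union> B) = w"
    using A B by (subst sum.mono_neutral_right[of "A \<union> B" B]) auto
  ultimately have "hcomp V (v + w) = (\<lambda>n. hcomp V v n + hcomp V w n)"
    by (intro hcomp_unique_sum[where A = "A \<union> B"]) (use A B hcomp_props hsp_add in \<open>auto simp: sum.distrib\<close>)
  then show ?thesis by simp
qed

lemma hcomp_scale: "hcomp V (smul V c v) n = smul V c (hcomp V v n)"
proof -
  obtain A where A: "finite A" "\<And>n. n \<notin> A \<Longrightarrow> hcomp V v n = 0" "sum (hcomp V v) A = v" using hcomp_support[of v] by blast
  have "hcomp V (smul V c v) = (\<lambda>n. smul V c (hcomp V v n))"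
    by (rule hcomp_unique_sum[OF _ A(1)]) (use A hcomp_props hsp_scale in \<open>auto simp: scale_sum_right[symmetric]\<close>)
  then show ?thesis by simp
qed

lemma hcomp_zero [simp]: "hcomp V 0 n = 0"
  using hcomp_scale[of 0 0 n] by simp

lemma hcomp_sum: "hcomp V (sum f A) n = (\<Sum>a\<in>A. hcomp V (f a) n)"
  by (induction A rule: infinite_finite_induct) (simp_all add: hcomp_add)

lemma hcomp_homogeneous: "v \<in> hsp V n \<Longrightarrow> hcomp V v m = (if m = n then v else 0)"
proof -
  assume v: "v \<in> hsp V n"
  have "hcomp V v = (\<lambda>m. if m = n then v else 0)"
    by (rule hcomp_unique_sum[where A = "{n}"]) (use v in auto)
  then show ?thesis by simp
qed

lemma hcomp_eqI: "(\<And>n. hcomp V v n = hcomp V w n) \<Longrightarrow> v = w"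
  using hcomp_props(3)[of v] hcomp_props(3)[of w] by (metis ext)

lemma hcomp_neg: "n < 0 \<Longrightarrow> hcomp V v n = 0"
  using hcomp_props(1)[of v n] cft unfolding cft_type_def by auto

lemma vir_linear: "Vector_Spaces.linear (smul V) (smul V) (vir V n)"
  unfolding vir_def [abs_def] by (rule mode_linear)

lemma vir_add: "vir V n (v + w) = vir V n v + vir V n w"
  and vir_scale: "vir V n (smul V c v) = smul V c (vir V n v)"
proof -
  interpret l: Vector_Spaces.linear "smul V" "smul V" "vir V n" by (rule vir_linear)
  show "vir V n (v + w) = vir V n v + vir V n w" "vir V n (smul V c v) = smul V c (vir V n v)"
    by (rule l.add l.scale)+
qed

lemma vir_zero [simp]: "vir V n 0 = 0"
  using vir_scale[of n 0 0] by simp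

lemma vir_sum: "vir V n (sum f A) = (\<Sum>a\<in>A. vir V n (f a))"
  by (induction A rule: infinite_finite_induct) (simp_all add: vir_add)

lemma hcomp_L0: "hcomp V (vir V 0 v) n = smul V (of_int n) (hcomp V v n)"
proof -
  obtain A where A: "finite A" "\<And>n. n \<notin> A \<Longrightarrow> hcomp V v n = 0" "sum (hcomp V v) A = v" using hcomp_support[of v] by blast
  have "vir V 0 v = (\<Sum>n\<in>A. vir V 0 (hcomp V v n))" by (simp add: vir_sum[symmetric] A(3))
  also have "\<dots> = (\<Sum>n\<in>A. smul V (of_int n) (hcomp V v n))"
    by (intro sum.cong refl L0_grading hcomp_props)
  finally have "hcomp V (vir V 0 v) = (\<lambda>n. smul V (of_int n) (hcomp V v n))"
    by (intro hcomp_unique_sum[OF _ A(1)]) (use A hcomp_props hsp_scale in auto)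
  then show ?thesis by simp
qed

text \<open>From \<open>[L(0), L(1)] = -L(1)\<close> the vector \<open>L(1)v\<close> is an eigenvector of
\<open>L(0)\<close> with eigenvalue \<open>n - 1\<close>; comparing homogeneous components leaves only the one of weight
\<open>n - 1\<close>.\<close>

lemma L_lowers_weight: "v \<in> hsp V n \<Longrightarrow> L v \<in> hsp V (n - 1)"
proof -
  assume v: "v \<in> hsp V n"
  have "vir V 0 (L v) - L (vir V 0 v) = smul V (-1) (L v)"
    using virasoro[of 0 1 v] by simp
  then have "vir V 0 (L v) = smul V (of_int n) (L v) + smul V (-1) (L v)"
    using L0_grading[OF v] by (simp add: vir_scale algebra_simps)
  also have "\<dots> = smul V (of_int (n - 1)) (L v)" by (simp only: scale_left_distrib[symmetric]) simp
  finally have e: "vir V 0 (L v) = smul V (of_int (n - 1)) (L v)" .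
  have z: "hcomp V (L v) m = 0" if "m \<noteq> n - 1" for m
  proof -
    have "smul V (of_int m) (hcomp V (L v) m) = smul V (of_int (n - 1)) (hcomp V (L v) m)"
      unfolding hcomp_L0[symmetric] e hcomp_scale ..
    then have "smul V (of_int m - of_int (n - 1)) (hcomp V (L v) m) = 0"
      by (simp only: scale_left_diff_distrib) simp
    moreover have "(of_int m - of_int (n - 1) :: complex) \<noteq> 0" using that by (metis eq_iff_diff_eq_0 of_int_eq_iff)
    ultimately show ?thesis by (simp only: scale_eq_0_iff) simp
  qed
  have "hcomp V (L v) m = hcomp V (hcomp V (L v) (n - 1)) m" for m
    using z by (simp add: hcomp_homogeneous[OF hcomp_props(1)])
  then have "L v = hcomp V (L v) (n - 1)" by (rule hcomp_eqI)
  then show ?thesis using hcomp_props(1)[of "L v" "n - 1"] by simp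
qed

lemma hcomp_L: "hcomp V (L v) n = L (hcomp V v (n + 1))"
proof -
  obtain A where A: "finite A" "\<And>n. n \<notin> A \<Longrightarrow> hcomp V v n = 0" "sum (hcomp V v) A = v" using hcomp_support[of v] by blast
  have "hcomp V (L v) n = (\<Sum>m\<in>A. hcomp V (L (hcomp V v m)) n)"
    by (simp add: hcomp_sum[symmetric] vir_sum[symmetric] A(3))
  also have "\<dots> = (\<Sum>m\<in>A. if m = n + 1 then L (hcomp V v m) else 0)"
    by (intro sum.cong refl) (use hcomp_homogeneous[OF L_lowers_weight[OF hcomp_props(1)]] in auto)
  also have "\<dots> = L (hcomp V v (n + 1))" using A(1,2) by (auto simp: sum.delta)
  finally show ?thesis .
qed

lemma hcomp_L_pow: "hcomp V ((L ^^ r) v) n = (L ^^ r) (hcomp V v (n + int r))"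
proof (induction r arbitrary: n)
  case (Suc r)
  have "hcomp V ((L ^^ Suc r) v) n = L (hcomp V ((L ^^ r) v) (n + 1))" by (simp add: hcomp_L)
  also have "\<dots> = L ((L ^^ r) (hcomp V v (n + 1 + int r)))" by (simp only: Suc)
  finally show ?case by (simp add: algebra_simps)
qed simp

lemma L_pow_add: "(L ^^ r) (v + w) = (L ^^ r) v + (L ^^ r) w"
  by (induction r) (simp_all add: vir_add)
lemma L_pow_scale: "(L ^^ r) (smul V c v) = smul V c ((L ^^ r) v)"
  by (induction r) (simp_all add: vir_scale)
lemma L_pow_zero [simp]: "(L ^^ r) 0 = 0"
  by (induction r) simp_all
lemma L_pow_sum: "(L ^^ r) (sum f A) = (\<Sum>a\<in>A. (L ^^ r) (f a))"
  by (induction A rule: infinite_finite_induct) (simp_all add: L_pow_add)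

lemma filtration_iff: "v \<in> filtration V N \<longleftrightarrow> (\<forall>n>N. hcomp V v n = 0)"
proof
  assume "v \<in> filtration V N"
  then show "\<forall>n>N. hcomp V v n = 0"
    unfolding filtration_def
    by (induction rule: span_induct_alt) (auto simp: hcomp_add hcomp_scale hcomp_homogeneous)
next
  assume z: "\<forall>n>N. hcomp V v n = 0"
  obtain A where A: "finite A" "\<And>n. n \<notin> A \<Longrightarrow> hcomp V v n = 0" "sum (hcomp V v) A = v" using hcomp_support[of v] by blast
  have "sum (hcomp V v) A \<in> filtration V N"
    unfolding filtration_def
  proof (rule span_sum)
    fix n
    show "hcomp V v n \<in> span (\<Union>n\<in>{..N}. hsp V n)"
    proof (cases "n \<le> N")
      case True
      then show ?thesis using hcomp_props(1)[of v n] by (intro span_base) auto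
    next
      case False
      then show ?thesis using z by (simp add: span_zero)
    qed
  qed
  then show "v \<in> filtration V N" using A(3) by simp
qed

lemma in_some_filtration: obtains N where "v \<in> filtration V (int N)"
proof -
  have "finite (insert 0 {n. hcomp V v n \<noteq> 0})" using hcomp_props(2) by simp
  then obtain M where M: "\<And>n. n \<in> insert 0 {n. hcomp V v n \<noteq> 0} \<Longrightarrow> n \<le> M"
    by (meson Max_ge)
  then have "M \<ge> 0" by blast
  have "v \<in> filtration V (int (nat M))"
    unfolding filtration_iff using M \<open>M \<ge> 0\<close> by force
  then show ?thesis by (rule that)
qed

lemma filtration_mono: "v \<in> filtration V N \<Longrightarrow> N \<le> M \<Longrightarrow> v \<in> filtration V M"
  by (auto simp: filtration_iff)

text \<open>The weights of a vector in \<open>F\<^sub>NV\<close> lie between 0 and \<open>N\<close>.\<close>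

lemma L_pow_vanish: "v \<in> filtration V N \<Longrightarrow> int r > N \<Longrightarrow> (L ^^ r) v = 0"
proof (rule hcomp_eqI)
  fix n assume v: "v \<in> filtration V N" and r: "int r > N"
  show "hcomp V ((L ^^ r) v) n = hcomp V 0 n"
  proof (cases "n < 0")
    case True then show ?thesis by (simp add: hcomp_neg)
  next
    case False
    then have "hcomp V v (n + int r) = 0" using v r by (simp add: filtration_iff)
    then show ?thesis by (simp add: hcomp_L_pow)
  qed
qed

lemma exp_L1_eq_sum:
  assumes "v \<in> filtration V (int N)"
  shows "exp_L1 V z v = (\<Sum>r\<le>N. smul V (z ^ r / fact r) ((L ^^ r) v))"
  unfolding exp_L1_def by (rule Sum_any_eq_sum) (use L_pow_vanish[OF assms] in auto)

lemma common_filtration: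
  obtains N where "v \<in> filtration V (int N)" "w \<in> filtration V (int N)"
proof -
  obtain N where N: "v \<in> filtration V (int N)" by (rule in_some_filtration)
  obtain M where M: "w \<in> filtration V (int M)" by (rule in_some_filtration)
  show ?thesis
    by (rule that[of "max N M"]) (use filtration_mono[OF N] filtration_mono[OF M] in auto)
qed

lemma filtration_subspace: "subspace (filtration V N)"
  unfolding filtration_def by (rule subspace_span)

lemma exp_L1_add: "exp_L1 V z (v + w) = exp_L1 V z v + exp_L1 V z w"
proof -
  obtain N where N: "v \<in> filtration V (int N)" "w \<in> filtration V (int N)" by (rule common_filtration)
  have vw: "v + w \<in> filtration V (int N)" using N subspace_add[OF filtration_subspace] by blast
  show ?thesis unfolding exp_L1_eq_sum[OF N(1)] exp_L1_eq_sum[OF N(2)] exp_L1_eq_sum[OF vw]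
    by (simp add: L_pow_add scale_right_distrib sum.distrib)
qed

lemma exp_L1_scale: "exp_L1 V z (smul V c v) = smul V c (exp_L1 V z v)"
proof -
  obtain N where N: "v \<in> filtration V (int N)" by (rule in_some_filtration)
  have cv: "smul V c v \<in> filtration V (int N)" using N subspace_scale[OF filtration_subspace] by blast
  show ?thesis unfolding exp_L1_eq_sum[OF N(1)] exp_L1_eq_sum[OF cv]
    by (simp add: L_pow_scale scale_sum_right mult.commute)
qed

lemma exp_L1_zero_vec [simp]: "exp_L1 V z 0 = 0"
  using exp_L1_scale[of z 0 0] by simp

lemma exp_L1_sum: "exp_L1 V z (sum f A) = (\<Sum>a\<in>A. exp_L1 V z (f a))"
  by (induction A rule: infinite_finite_induct) (simp_all add: exp_L1_add)

lemma exp_L1_zero [simp]: "exp_L1 V 0 v = v"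
proof -
  obtain N where N: "v \<in> filtration V (int N)" by (rule in_some_filtration)
  have "exp_L1 V 0 v = (\<Sum>r\<in>{..N}. if r = 0 then v else 0)"
    unfolding exp_L1_eq_sum[OF N] by (intro sum.cong) auto
  then show ?thesis by (simp add: sum.delta)
qed

lemma filtration_exp_L1:
  assumes "v \<in> filtration V N"
  shows "exp_L1 V z v \<in> filtration V N"
  unfolding filtration_iff
proof (intro allI impI)
  fix n assume n: "n > N"
  obtain M where M: "v \<in> filtration V (int M)" by (rule in_some_filtration)
  show "hcomp V (exp_L1 V z v) n = 0"
    unfolding exp_L1_eq_sum[OF M] hcomp_sum hcomp_scale hcomp_L_pow
    using assms n by (intro sum.neutral) (auto simp: filtration_iff)
qed

lemma exp_L1_exp_L1: "exp_L1 V a (exp_L1 V b v) = exp_L1 V (a + b) v"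
proof -
  obtain N where N: "v \<in> filtration V (int N)" by (rule in_some_filtration)
  define t where "t r s = smul V (a ^ r * b ^ s / (fact r * fact s)) ((L ^^ (r + s)) v)" for r s
  have t0: "t r s = 0" if "r + s > N" for r s
    using L_pow_vanish[OF N, of "r + s"] that by (simp add: t_def)
  have "exp_L1 V a (exp_L1 V b v) = (\<Sum>r\<le>N. \<Sum>s\<le>N. t r s)"
    unfolding exp_L1_eq_sum[OF filtration_exp_L1[OF N]] unfolding exp_L1_eq_sum[OF N] t_def
    by (simp add: L_pow_sum L_pow_scale scale_sum_right funpow_add)
  also have "\<dots> = (\<Sum>(r, s)\<in>{..N} \<times> {..N}. t r s)" by (simp add: sum.cartesian_product)
  also have "\<dots> = (\<Sum>(r, s)\<in>{(r, s). r + s \<le> N}. t r s)"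
  proof (rule sum.mono_neutral_right)
    show "\<forall>p\<in>{..N} \<times> {..N} - {(r, s). r + s \<le> N}. (case p of (r, s) \<Rightarrow> t r s) = 0"
      using t0 by (auto simp: not_le[symmetric])
  qed auto
  also have "\<dots> = (\<Sum>n\<le>N. \<Sum>r\<le>n. t r (n - r))"
    by (rule sum.triangle_reindex_eq)
  also have "\<dots> = (\<Sum>n\<le>N. smul V ((a + b) ^ n / fact n) ((L ^^ n) v))"
  proof (rule sum.cong[OF refl])
    fix n
    have "(\<Sum>r\<le>n. t r (n - r)) = (\<Sum>r\<le>n. smul V (of_nat (n choose r) * a ^ r * b ^ (n - r) / fact n) ((L ^^ n) v))"
    proof (rule sum.cong[OF refl])
      fix r assume "r \<in> {..n}"
      then have r: "r \<le> n" by simp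
      have "a ^ r * b ^ (n - r) / (fact r * fact (n - r)) = of_nat (n choose r) * a ^ r * b ^ (n - r) / fact n"
        using r by (simp add: binomial_fact)
      then show "t r (n - r) = smul V (of_nat (n choose r) * a ^ r * b ^ (n - r) / fact n) ((L ^^ n) v)"
        using r by (simp add: t_def)
    qed
    also have "\<dots> = smul V (\<Sum>r\<le>n. of_nat (n choose r) * a ^ r * b ^ (n - r) / fact n) ((L ^^ n) v)"
      by (simp add: scale_sum_left)
    also have "(\<Sum>r\<le>n. of_nat (n choose r) * a ^ r * b ^ (n - r) / fact n) = (a + b) ^ n / fact n"
      by (simp add: binomial_ring sum_divide_distrib)
    finally show "(\<Sum>r\<le>n. t r (n - r)) = smul V ((a + b) ^ n / fact n) ((L ^^ n) v)" .
  qed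
  finally show ?thesis unfolding exp_L1_eq_sum[OF N] .
qed

lemma hcomp_pow_L0: "hcomp V (pow_L0 V z m v) n = smul V (z powi (m * n)) (hcomp V v n)"
proof -
  obtain A where A: "finite A" "\<And>n. n \<notin> A \<Longrightarrow> hcomp V v n = 0" "sum (hcomp V v) A = v" using hcomp_support[of v] by blast
  have "pow_L0 V z m v = (\<Sum>n\<in>A. smul V (z powi (m * n)) (hcomp V v n))"
    unfolding pow_L0_def by (rule Sum_any_eq_sum) (use A in auto)
  then have "hcomp V (pow_L0 V z m v) = (\<lambda>n. smul V (z powi (m * n)) (hcomp V v n))"
    by (intro hcomp_unique_sum[OF _ A(1)]) (use A hcomp_props hsp_scale in auto)
  then show ?thesis by simp
qed

lemma pow_L0_inverse: "z \<noteq> 0 \<Longrightarrow> pow_L0 V z m (pow_L0 V z (- m) v) = v"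
  by (rule hcomp_eqI) (simp add: hcomp_pow_L0 power_int_add[symmetric])

lemma hcomp_exp_L1:
  assumes "v \<in> filtration V (int N)"
  shows "hcomp V (exp_L1 V z v) n = (\<Sum>r\<le>N. smul V (z ^ r / fact r) ((L ^^ r) (hcomp V v (n + int r))))"
  unfolding exp_L1_eq_sum[OF assms] hcomp_sum hcomp_scale hcomp_L_pow ..

lemma filtration_pow_L0: "v \<in> filtration V N \<Longrightarrow> pow_L0 V z m v \<in> filtration V N"
  by (simp add: filtration_iff hcomp_pow_L0)

text \<open>Conjugation by \<open>z\<^bsup>mL(0)\<^esup>\<close> multiplies \<open>L(1)\<close> by
\<open>z\<^bsup>-m\<^esup>\<close>.\<close>

lemma pow_L0_exp_L1:
  assumes z: "z \<noteq> 0"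
  shows "pow_L0 V z m (exp_L1 V a v) = exp_L1 V (z powi (- m) * a) (pow_L0 V z m v)"
proof (rule hcomp_eqI)
  fix n
  obtain N where N: "v \<in> filtration V (int N)" by (rule in_some_filtration)
  have coeff: "z powi (m * n) * (a ^ r / fact r) = (z powi (- m) * a) ^ r / fact r * z powi (m * (n + int r))" for r
  proof -
    have "(z powi (- m)) ^ r = z powi (- m * int r)" by (simp only: power_int_mult power_int_of_nat)
    then have "(z powi (- m) * a) ^ r * z powi (m * (n + int r)) = a ^ r * (z powi (- m * int r) * z powi (m * (n + int r)))"
      by (simp add: power_mult_distrib)
    also have "z powi (- m * int r) * z powi (m * (n + int r)) = z powi (m * n)"
      using z by (simp add: power_int_add[symmetric] algebra_simps)
    finally show ?thesis by simp
  qed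
  show "hcomp V (pow_L0 V z m (exp_L1 V a v)) n = hcomp V (exp_L1 V (z powi (- m) * a) (pow_L0 V z m v)) n"
    unfolding hcomp_pow_L0 hcomp_exp_L1[OF N] hcomp_exp_L1[OF filtration_pow_L0[OF N]]
    by (simp only: scale_sum_right scale_scale L_pow_scale coeff)
qed

lemma inv_Kfac:
  assumes "jfac \<gamma> \<tau> \<noteq> 0"
  shows "inv_into UNIV (Kfac V \<gamma> \<tau>) = (\<lambda>v. pow_L0 V (jfac \<gamma> \<tau>) 2 (exp_L1 V (of_real (\<gamma>$2$1) * jfac \<gamma> \<tau>) v))"
    and "bij (Kfac V \<gamma> \<tau>)"
proof -
  define K' where "K' v = pow_L0 V (jfac \<gamma> \<tau>) 2 (exp_L1 V (of_real (\<gamma>$2$1) * jfac \<gamma> \<tau>) v)" for v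
  have 1: "K' (Kfac V \<gamma> \<tau> v) = v" for v
    using pow_L0_inverse[OF assms, of 2 v] by (simp add: K'_def Kfac_def exp_L1_exp_L1)
  have 2: "Kfac V \<gamma> \<tau> (K' v) = v" for v
    using pow_L0_inverse[OF assms, of "-2"] by (simp add: K'_def Kfac_def exp_L1_exp_L1)
  show "inv_into UNIV (Kfac V \<gamma> \<tau>) = (\<lambda>v. pow_L0 V (jfac \<gamma> \<tau>) 2 (exp_L1 V (of_real (\<gamma>$2$1) * jfac \<gamma> \<tau>) v))"
    unfolding K'_def[symmetric] by (rule inv_equality) (use 1 2 in auto)
  show "bij (Kfac V \<gamma> \<tau>)" by (rule bijI') (metis 1, metis 2)
qed

text \<open>The slash action with \<open>K\<close> replaced by its diagonal part \<open>j\<^bsup>-2L(0)\<^esup>\<close>: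
on the component of weight \<open>n\<close> it is the scalar slash action of weight \<open>k - 2n\<close>.\<close>

definition gslash :: "int \<Rightarrow> real^2^2 \<Rightarrow> (complex \<Rightarrow> 'v) \<Rightarrow> complex \<Rightarrow> 'v" where
  "gslash k \<sigma> g \<tau> = smul V (jfac \<sigma> \<tau> powi (- k)) (pow_L0 V (jfac \<sigma> \<tau>) 2 (g (moeb \<sigma> \<tau>)))"

lemma hcomp_gslash:
  assumes "jfac \<sigma> \<tau> \<noteq> 0"
  shows "hcomp V (gslash k \<sigma> g \<tau>) n = smul V (jfac \<sigma> \<tau> powi (- (k - 2 * n))) (hcomp V (g (moeb \<sigma> \<tau>)) n)"
  using assms by (simp add: gslash_def hcomp_scale hcomp_pow_L0 power_int_add[symmetric])

text \<open>The exponential absorbs the unipotent part of \<open>K\<close>: moving \<open>j\<^bsup>2L(0)\<^esup>\<close>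
past \<open>exp((c\<^sub>\<sigma> j + c E(\<sigma>\<tau>)) L(1))\<close> divides the exponent by
\<open>j\<^sup>2\<close>.\<close>

lemma vslash_exp_L1:
  assumes j: "jfac \<sigma> \<tau> \<noteq> 0"
    and f: "f (moeb \<sigma> \<tau>) = exp_L1 V (c * E (moeb \<sigma> \<tau>)) (g (moeb \<sigma> \<tau>))"
  shows "vslash V k \<sigma> f \<tau> = exp_L1 V (Xfac \<sigma> \<tau> + c * slash 2 \<sigma> E \<tau>) (gslash k \<sigma> g \<tau>)"
proof -
  have "jfac \<sigma> \<tau> powi (- 2) * (of_real (\<sigma>$2$1) * jfac \<sigma> \<tau> + c * E (moeb \<sigma> \<tau>)) = Xfac \<sigma> \<tau> + c * slash 2 \<sigma> E \<tau>"
    using j by (simp add: Xfac_def slash_def power_int_minus field_simps power2_eq_square)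
  then show ?thesis
    unfolding vslash_def inv_Kfac(1)[OF j] f exp_L1_exp_L1 pow_L0_exp_L1[OF j] gslash_def exp_L1_scale by (simp only: distrib_left)
qed

end

section \<open>Scalar modular forms and linear functionals\<close>

lemma modular_forms_iff:
  "f \<in> modular_forms \<Gamma> k \<longleftrightarrow>
     (\<forall>\<tau>. \<tau> \<notin> uhp \<longrightarrow> f \<tau> = 0) \<and> f holomorphic_on uhp \<and>
     (\<forall>\<gamma>\<in>\<Gamma>. \<forall>\<tau>\<in>uhp. slash k \<gamma> f \<tau> = f \<tau>) \<and>
     (\<forall>\<sigma> h. cusp_at \<Gamma> \<sigma> \<and> cusp_width \<Gamma> \<sigma> h \<longrightarrow> q_expandable h (slash k \<sigma> f))"
proof -
  have "(\<exists>a::nat \<Rightarrow> complex. \<forall>\<tau>\<in>uhp. (\<lambda>n. a n * qpar h \<tau> ^ n) sums slash k \<sigma> f \<tau>) \<longleftrightarrow> q_expandable h (slash k \<sigma> f)"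
    if "cusp_at \<Gamma> \<sigma> \<and> cusp_width \<Gamma> \<sigma> h" for \<sigma> h
    using that by (simp add: q_expandable_iff_power_series cusp_width_def)
  then show ?thesis unfolding modular_forms_def by blast
qed

lemma modular_forms_zero [simp]: "(\<lambda>_. 0) \<in> modular_forms \<Gamma> k"
  by (simp add: modular_forms_iff slash_def [abs_def] q_expandable_const)

lemma modular_forms_add:
  assumes "f \<in> modular_forms \<Gamma> k" "g \<in> modular_forms \<Gamma> k"
  shows "(\<lambda>\<tau>. f \<tau> + g \<tau>) \<in> modular_forms \<Gamma> k"
proof -
  have e: "slash k \<sigma> (\<lambda>\<tau>. f \<tau> + g \<tau>) = (\<lambda>\<tau>. slash k \<sigma> f \<tau> + slash k \<sigma> g \<tau>)" for \<sigma>
    by (simp add: slash_def [abs_def] distrib_left)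
  show ?thesis using assms unfolding modular_forms_iff e
    by (auto intro!: holomorphic_intros q_expandable_add)
qed

lemma modular_forms_mult:
  assumes \<Gamma>: "\<Gamma> \<subseteq> SL2R" and fg: "f \<in> modular_forms \<Gamma> k" "g \<in> modular_forms \<Gamma> l"
  shows "(\<lambda>\<tau>. f \<tau> * g \<tau>) \<in> modular_forms \<Gamma> (k + l)"
proof -
  have e: "slash (k + l) \<sigma> (\<lambda>\<tau>. f \<tau> * g \<tau>) \<tau> = slash k \<sigma> f \<tau> * slash l \<sigma> g \<tau>" if "\<sigma> \<in> SL2R" "\<tau> \<in> uhp" for \<sigma> \<tau>
    using jfac_nonzero[OF that] by (simp add: slash_def power_int_add power_int_diff power_int_minus divide_inverse)
  have q: "q_expandable h (slash (k + l) \<sigma> (\<lambda>\<tau>. f \<tau> * g \<tau>))" if "cusp_at \<Gamma> \<sigma>" "cusp_width \<Gamma> \<sigma> h" for \<sigma> h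
  proof -
    have "\<sigma> \<in> SL2R" using that by (simp add: cusp_at_def)
    then have "q_expandable h (slash (k + l) \<sigma> (\<lambda>\<tau>. f \<tau> * g \<tau>)) = q_expandable h (\<lambda>\<tau>. slash k \<sigma> f \<tau> * slash l \<sigma> g \<tau>)"
      by (intro q_expandable_cong e)
    then show ?thesis using fg that unfolding modular_forms_iff by (simp add: q_expandable_mult)
  qed
  show ?thesis unfolding modular_forms_iff
    using fg \<Gamma> q e unfolding modular_forms_iff by (auto intro!: holomorphic_intros)
qed

lemma modular_forms_const_mult:
  assumes "f \<in> modular_forms \<Gamma> k"
  shows "(\<lambda>\<tau>. c * f \<tau>) \<in> modular_forms \<Gamma> k"
proof -
  have e: "slash k \<sigma> (\<lambda>\<tau>. c * f \<tau>) = (\<lambda>\<tau>. c * slash k \<sigma> f \<tau>)" for \<sigma>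
    by (simp add: slash_def [abs_def] mult.left_commute)
  show ?thesis using assms unfolding modular_forms_iff e
    by (auto intro!: holomorphic_intros q_expandable_mult q_expandable_const)
qed

text \<open>If \<open>\<gamma>\<sigma> = \<sigma>T\<close> with \<open>T\<close> the translation by \<open>h\<close>,
then passing from \<open>\<tau>\<close> to \<open>\<tau> + h\<close> changes \<open>E|\<^sub>2\<sigma>\<close> by the
multiple \<open>12/(2\<pi>i)\<close> of \<open>j(\<sigma>,\<tau>)\<^bsup>-2\<^esup> X(\<gamma>,\<sigma>\<tau>)\<close>,
and \<open>X(\<sigma>,\<tau>)\<close> by the same quantity itself. The two changes cancel.\<close>

lemma (in discrete_subgroup) quasimodular_shift_q_expandable:
  assumes E: "quasimodular_E2 \<Gamma> E" and cusp: "cusp_at \<Gamma> \<sigma>" "cusp_width \<Gamma> \<sigma> h"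
  shows "q_expandable h (\<lambda>\<tau>. Xfac \<sigma> \<tau> + - (2 * of_real pi * \<i> / 12) * slash 2 \<sigma> E \<tau>)"
proof -
  define c :: complex where "c = - (2 * of_real pi * \<i> / 12)"
  have cinv: "c * (12 / (2 * of_real pi * \<i>)) = - 1" by (simp add: c_def)
  have \<sigma>: "\<sigma> \<in> SL2R" using cusp by (simp add: cusp_at_def)
  have h: "h > 0" using cusp by (simp add: cusp_width_def)
  have Ehol: "E holomorphic_on uhp" using E by (simp add: quasimodular_E2_def)
  have Etr: "slash 2 \<gamma> E \<tau> = E \<tau> + 12 / (2 * of_real pi * \<i>) * Xfac \<gamma> \<tau>" if "\<gamma> \<in> \<Gamma>" "\<tau> \<in> uhp" for \<gamma> \<tau>
    using E that unfolding quasimodular_E2_def by blast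
  define u where "u = (\<lambda>\<tau>. Xfac \<sigma> \<tau> + c * slash 2 \<sigma> E \<tau>)"
  obtain y0 B where yB: "y0 > 0" "\<And>\<tau>. Re \<tau> \<in> {-h..h} \<Longrightarrow> Im \<tau> \<ge> y0 \<Longrightarrow> norm (slash 2 \<sigma> E \<tau>) \<le> B"
  proof -
    have "compact {-h..h}" by simp
    then have "\<exists>y0>0. \<exists>B. \<forall>\<tau>. Re \<tau> \<in> {-h..h} \<and> Im \<tau> \<ge> y0 \<longrightarrow> norm (slash 2 \<sigma> E \<tau>) \<le> B"
      using E cusp(1) unfolding quasimodular_E2_def by blast
    then show ?thesis using that by blast
  qed
  have "q_expandable h u"
  proof (rule periodic_bounded_imp_q_expandable[OF h _ _ yB(1)])
    have X: "Xfac \<sigma> holomorphic_on uhp"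
      unfolding Xfac_def [abs_def] by (intro holomorphic_intros holomorphic_jfac) (use \<sigma> in auto)
    then show "u holomorphic_on uhp"
      unfolding u_def by (intro holomorphic_intros X holomorphic_slash \<sigma> Ehol)
  next
    fix \<tau> assume \<tau>: "\<tau> \<in> uhp"
    have "translation h \<in> {\<delta> \<in> conj_by \<sigma> ` \<Gamma>. \<delta>$2$1 = 0}"
      using cusp(2) unfolding cusp_width_def by (metis (mono_tags, lifting) mem_Collect_eq mult_1 of_int_1)
    then obtain \<gamma> where \<gamma>: "\<gamma> \<in> \<Gamma>" "conj_by \<sigma> \<gamma> = translation h" by auto
    have \<gamma>S: "\<gamma> \<in> SL2R" using \<gamma> SL2R_mem by blast
    have T: "translation h \<in> SL2R" by (simp add: SL2R_iff)
    have eq: "\<gamma> ** \<sigma> = \<sigma> ** translation h"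
      using \<sigma> unfolding \<gamma>(2)[symmetric] by (simp add: conj_by_SL2R matrix_mul_assoc[symmetric])
    have jT: "jfac (translation h) \<tau> = 1" "moeb (translation h) \<tau> = \<tau> + of_real h"
      by (simp_all add: jfac_def moeb_def)
    have \<tau>': "\<tau> + of_real h \<in> uhp" using \<tau> by (simp add: uhp_iff)
    have js: "jfac \<sigma> \<tau> \<noteq> 0" "jfac \<gamma> (moeb \<sigma> \<tau>) \<noteq> 0" "jfac \<sigma> (\<tau> + of_real h) \<noteq> 0" using \<sigma> \<gamma>S \<tau> \<tau>' by auto
    have s1: "slash 2 \<sigma> E (\<tau> + of_real h) = slash 2 \<sigma> (slash 2 \<gamma> E) \<tau>"
    proof -
      have "slash 2 \<sigma> E (\<tau> + of_real h) = slash 2 (translation h) (slash 2 \<sigma> E) \<tau>" by (simp add: slash_def[of 2 "translation h"] jT)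
      also have "\<dots> = slash 2 (\<gamma> ** \<sigma>) E \<tau>" unfolding eq by (rule slash_mult[OF \<sigma> T \<tau>, symmetric])
      also have "\<dots> = slash 2 \<sigma> (slash 2 \<gamma> E) \<tau>" by (rule slash_mult[OF \<gamma>S \<sigma> \<tau>])
      finally show ?thesis .
    qed
    have s2: "slash 2 \<sigma> (slash 2 \<gamma> E) \<tau> = slash 2 \<sigma> E \<tau> + 12 / (2 * of_real pi * \<i>) * (jfac \<sigma> \<tau> powi (-2) * Xfac \<gamma> (moeb \<sigma> \<tau>))"
      unfolding slash_def[of 2 \<sigma>] using Etr[OF \<gamma>(1), of "moeb \<sigma> \<tau>"] \<sigma> \<tau> by (simp add: distrib_left)
    have x: "Xfac \<sigma> (\<tau> + of_real h) = Xfac \<sigma> \<tau> + jfac \<sigma> \<tau> powi (-2) * Xfac \<gamma> (moeb \<sigma> \<tau>)"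
    proof -
      have j1: "jfac \<sigma> (\<tau> + of_real h) = jfac \<gamma> (moeb \<sigma> \<tau>) * jfac \<sigma> \<tau>"
        using jfac_mult[OF \<sigma> T \<tau>] jfac_mult[OF \<gamma>S \<sigma> \<tau>] unfolding eq jT by simp
      have c21: "\<sigma>$2$1 = \<gamma>$2$1 * \<sigma>$1$1 + \<gamma>$2$2 * \<sigma>$2$1"
        using arg_cong[OF eq, of "\<lambda>M. M$2$1"] by simp
      have det: "of_real (\<sigma>$1$1) * jfac \<sigma> \<tau> - of_real (\<sigma>$2$1) * (moeb \<sigma> \<tau> * jfac \<sigma> \<tau>) = 1"
      proof -
        have "complex_of_real (\<sigma>$1$1) * of_real (\<sigma>$2$2) - of_real (\<sigma>$1$2) * of_real (\<sigma>$2$1) = 1"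
          using \<sigma> by (simp add: SL2R_iff flip: of_real_mult of_real_diff)
        moreover have "moeb \<sigma> \<tau> * jfac \<sigma> \<tau> = of_real (\<sigma>$1$1) * \<tau> + of_real (\<sigma>$1$2)"
          using js by (simp add: moeb_eq)
        ultimately show ?thesis by (simp add: jfac_def algebra_simps)
      qed
      have "of_real (\<sigma>$2$1) * jfac \<sigma> \<tau> = of_real (\<sigma>$2$1) * (jfac \<gamma> (moeb \<sigma> \<tau>) * jfac \<sigma> \<tau>) + of_real (\<gamma>$2$1)"
      proof -
        have "complex_of_real (\<sigma>$2$1) = of_real (\<gamma>$2$1) * of_real (\<sigma>$1$1) + of_real (\<gamma>$2$2) * of_real (\<sigma>$2$1)"
          by (subst c21) simp
        from arg_cong[OF this, of "\<lambda>x. x * jfac \<sigma> \<tau>"] have "of_real (\<sigma>$2$1) * jfac \<sigma> \<tau> - of_real (\<sigma>$2$1) * (jfac \<gamma> (moeb \<sigma> \<tau>) * jfac \<sigma> \<tau>)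
          = of_real (\<gamma>$2$1) * (of_real (\<sigma>$1$1) * jfac \<sigma> \<tau> - of_real (\<sigma>$2$1) * (moeb \<sigma> \<tau> * jfac \<sigma> \<tau>))"
          by (simp add: jfac_def[of \<gamma>] algebra_simps)
        then show ?thesis unfolding det by (simp add: algebra_simps)
      qed
      then show ?thesis
        unfolding Xfac_def j1 using js(1,2) by (simp add: power_int_minus field_simps power2_eq_square)
    qed
    have "u (\<tau> + of_real h) = u \<tau> + (1 + c * (12 / (2 * of_real pi * \<i>))) * (jfac \<sigma> \<tau> powi (-2) * Xfac \<gamma> (moeb \<sigma> \<tau>))"
      unfolding u_def s1 s2 x by (simp add: algebra_simps)
    then show "u (\<tau> + of_real h) = u \<tau>" unfolding cinv by simp
  next
    fix \<tau> assume re: "\<bar>Re \<tau>\<bar> \<le> h" and im: "Im \<tau> \<ge> y0"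
    have \<tau>: "\<tau> \<in> uhp" using im yB(1) by (simp add: uhp_iff)
    have "norm (Xfac \<sigma> \<tau>) \<le> 1 / y0"
    proof (cases "\<sigma>$2$1 = 0")
      case True then show ?thesis using yB(1) by (simp add: Xfac_def)
    next
      case False
      have "\<bar>\<sigma>$2$1\<bar> * y0 \<le> \<bar>\<sigma>$2$1\<bar> * \<bar>Im \<tau>\<bar>" using im yB(1) by (intro mult_left_mono) auto
      also have "\<dots> = \<bar>Im (jfac \<sigma> \<tau>)\<bar>" by (simp add: jfac_def abs_mult)
      also have "\<dots> \<le> norm (jfac \<sigma> \<tau>)" by (rule abs_Im_le_cmod)
      finally have "\<bar>\<sigma>$2$1\<bar> / norm (jfac \<sigma> \<tau>) \<le> 1 / y0"
        using yB(1) jfac_nonzero[OF \<sigma> \<tau>] by (simp add: field_simps)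
      then show ?thesis by (simp add: Xfac_def norm_divide)
    qed
    moreover have "norm (c * slash 2 \<sigma> E \<tau>) \<le> norm c * B"
      unfolding norm_mult using re im yB(2)[of \<tau>] by (intro mult_left_mono) (auto simp: abs_le_iff)
    ultimately show "norm (u \<tau>) \<le> 1 / y0 + norm c * B"
      unfolding u_def by (rule norm_triangle_le[OF add_mono])
  qed
  then show ?thesis unfolding u_def c_def .
qed

context cft_voa
begin

definition functional :: "('v \<Rightarrow> complex) \<Rightarrow> bool" where
  "functional \<phi> \<longleftrightarrow> (\<forall>v w. \<phi> (v + w) = \<phi> v + \<phi> w) \<and> (\<forall>c v. \<phi> (smul V c v) = c * \<phi> v)"

lemma linear_functional_iff: "Vector_Spaces.linear (smul V) (*) \<phi> \<longleftrightarrow> functional \<phi>"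
proof -
  have "vector_space ((*) :: complex \<Rightarrow> complex \<Rightarrow> complex)"
    by unfold_locales (simp_all add: algebra_simps)
  then show ?thesis using vector_space_axioms by (simp add: Vector_Spaces.linear_iff functional_def)
qed

lemma functional_add: "functional \<phi> \<Longrightarrow> \<phi> (v + w) = \<phi> v + \<phi> w"
  and functional_scale: "functional \<phi> \<Longrightarrow> \<phi> (smul V c v) = c * \<phi> v"
  by (simp_all add: functional_def)

lemma functional_zero: "functional \<phi> \<Longrightarrow> \<phi> 0 = 0"
  using functional_scale[of \<phi> 0 0] by simp

lemma functional_sum: "functional \<phi> \<Longrightarrow> \<phi> (sum f A) = (\<Sum>a\<in>A. \<phi> (f a))"
  by (induction A rule: infinite_finite_induct) (simp_all add: functional_add functional_zero)

lemma functional_hcomp: "functional \<phi> \<Longrightarrow> functional (\<lambda>v. \<phi> (hcomp V v n))"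
  by (simp add: functional_def hcomp_add hcomp_scale)

lemma functional_L_pow: "functional \<phi> \<Longrightarrow> functional (\<lambda>v. \<phi> ((L ^^ r) v))"
  by (simp add: functional_def L_pow_add L_pow_scale)

text \<open>The coordinates with respect to a basis of the whole space that extends \<open>B\<close>.\<close>

lemma coordinate_functionals:
  assumes "independent B"
  obtains r where "\<And>b. functional (r b)" "\<And>b b'. b' \<in> B \<Longrightarrow> r b b' = (if b = b' then 1 else 0)"
    "\<And>v. finite B \<Longrightarrow> v \<in> span B \<Longrightarrow> (\<Sum>b\<in>B. smul V (r b v) b) = v"
proof
  let ?B = "extend_basis B"
  let ?r = "\<lambda>b v. representation ?B v b"
  have ind: "independent ?B" by (rule independent_extend_basis[OF assms])
  have mem: "v \<in> span ?B" for v using assms by (simp add: span_extend_basis)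
  show "functional (?r b)" for b
    by (simp add: functional_def representation_add[OF ind mem mem] representation_scale[OF ind mem])
  show "?r b b' = (if b = b' then 1 else 0)" if "b' \<in> B" for b b'
    using representation_basis[OF ind, of b'] extend_basis_superset[OF assms] that by auto
  show "(\<Sum>b\<in>B. smul V (?r b v) b) = v" if "finite B" "v \<in> span B" for v
    using representation_extend[OF ind that(2) extend_basis_superset[OF assms]]
      sum_representation_eq[OF assms that(2) that(1) subset_refl] by simp
qed

lemma functionals_separate:
  assumes "\<And>\<phi>. functional \<phi> \<Longrightarrow> \<phi> v = \<phi> w"
  shows "v = w"
proof (rule ccontr)
  assume ne: "v \<noteq> w"
  have ind: "independent {v - w}" using ne by (simp add: dependent_single)
  from coordinate_functionals[OF ind] obtain r where
    r: "\<And>b. functional (r b)" "\<And>b b'. b' \<in> {v - w} \<Longrightarrow> r b b' = (if b = b' then 1 else 0)" by metis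
  have "r (v - w) v = r (v - w) (v - w) + r (v - w) w"
    using functional_add[OF r(1), of "v - w" "v - w" w] by simp
  then show False using assms[OF r(1)] r(2)[of "v - w" "v - w"] by simp
qed

lemma finite_dim_basis:
  assumes "finite S"
  obtains B where "finite B" "B \<subseteq> span S" "independent B" "span B = span S"
proof -
  obtain B where B: "B \<subseteq> span S" "independent B" "span S \<subseteq> span B" using basis_exists[of "span S"] by metis
  have "finite B" using independent_span_bound[OF assms B(2,1)] by simp
  moreover have "span B = span S" using B(1,3) span_minimal[OF B(1) subspace_span] by blast
  ultimately show ?thesis using that B by blast
qed

lemma filtration_finite_span: "\<exists>S. finite S \<and> filtration V N = span S"
proof -
  obtain b where b: "\<And>n. finite (b n)" "\<And>n. span (b n) = hsp V n" using hsp_finite_dim by metis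
  let ?S = "\<Union>n\<in>{0..N}. b n"
  have bh: "b n \<subseteq> hsp V n" for n using span_superset[of "b n"] b(2) by simp
  have "filtration V N = span ?S"
  proof
    have "v \<in> span ?S" if v: "v \<in> (\<Union>n\<in>{..N}. hsp V n)" for v
    proof -
      obtain n where n: "n \<le> N" "v \<in> hsp V n" using v by auto
      show ?thesis
      proof (cases "n < 0")
        case True
        then have "v = 0" using n(2) cft by (auto simp: cft_type_def)
        then show ?thesis by (simp add: span_zero)
      next
        case False
        have "v \<in> span (b n)" using n b by simp
        moreover have "b n \<subseteq> ?S" using UN_upper[of n "{0..N}" b] n False by simp
        ultimately show ?thesis using span_mono by blast
      qed
    qed
    then show "filtration V N \<subseteq> span ?S"
      unfolding filtration_def by (intro span_minimal subspace_span) blast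
    show "span ?S \<subseteq> filtration V N"
      unfolding filtration_def by (rule span_mono) (use bh in fastforce)
  qed
  then show ?thesis using b(1) by blast
qed

text \<open>On \<open>F\<^sub>NV\<close> the exponential is a polynomial in its scalar argument, with coefficients that
are functionals of the vector. The statement serves holomorphy and expandability at a cusp alike.\<close>

lemma weak_exp_L1:
  assumes Pr_const: "\<And>c. Pr (\<lambda>_. c)" and Pr_add: "\<And>u v. Pr u \<Longrightarrow> Pr v \<Longrightarrow> Pr (\<lambda>\<tau>. u \<tau> + v \<tau>)"
    and Pr_mult: "\<And>u v. Pr u \<Longrightarrow> Pr v \<Longrightarrow> Pr (\<lambda>\<tau>. u \<tau> * v \<tau>)"
    and Pr_cong: "\<And>u v. (\<And>\<tau>. \<tau> \<in> uhp \<Longrightarrow> u \<tau> = v \<tau>) \<Longrightarrow> Pr u \<Longrightarrow> Pr v"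
    and e: "Pr e" and u: "\<And>\<phi>. functional \<phi> \<Longrightarrow> Pr (\<lambda>\<tau>. \<phi> (u \<tau>))"
    and N: "\<And>\<tau>. \<tau> \<in> uhp \<Longrightarrow> u \<tau> \<in> filtration V N" and \<phi>: "functional \<phi>"
  shows "Pr (\<lambda>\<tau>. \<phi> (exp_L1 V (e \<tau>) (u \<tau>)))"
proof -
  have pw: "Pr (\<lambda>\<tau>. e \<tau> ^ r)" for r
    by (induction r) (use Pr_const Pr_mult[OF e] in auto)
  have sm: "finite A \<Longrightarrow> (\<And>a. a \<in> A \<Longrightarrow> Pr (f a)) \<Longrightarrow> Pr (\<lambda>\<tau>. \<Sum>a\<in>A. f a \<tau>)" for A :: "nat set" and f
    by (induction A rule: finite_induct) (use Pr_const Pr_add in auto)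
  have "Pr (\<lambda>\<tau>. \<Sum>r\<le>nat N. (e \<tau> ^ r * (1 / fact r)) * \<phi> ((L ^^ r) (u \<tau>)))"
    by (intro sm Pr_mult pw Pr_const u[OF functional_L_pow[OF \<phi>]]) simp
  then show ?thesis
  proof (rule Pr_cong[rotated])
    fix \<tau> assume "\<tau> \<in> uhp"
    then have s: "u \<tau> \<in> filtration V (int (nat N))" by (rule filtration_mono[OF N]) simp
    show "(\<Sum>r\<le>nat N. (e \<tau> ^ r * (1 / fact r)) * \<phi> ((L ^^ r) (u \<tau>))) = \<phi> (exp_L1 V (e \<tau>) (u \<tau>))"
      unfolding exp_L1_eq_sum[OF s] by (simp add: functional_sum[OF \<phi>] functional_scale[OF \<phi>])
  qed
qed

text \<open>Coordinates with respect to a basis of the finite-dimensional space \<open>F\<^sub>NV\<close> assemble the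
scalar expansions into one with vector coefficients.\<close>

lemma weak_q_expandable_iff:
  assumes h: "h > 0" and N: "\<And>\<tau>. \<tau> \<in> uhp \<Longrightarrow> u \<tau> \<in> filtration V N"
  shows "(\<exists>a::nat \<Rightarrow> 'v. (\<forall>n. a n \<in> filtration V N) \<and> (\<forall>\<tau>\<in>uhp. vsums V (\<lambda>n. smul V (qpar h \<tau> ^ n) (a n)) (u \<tau>)))
    \<longleftrightarrow> (\<forall>\<phi>. functional \<phi> \<longrightarrow> q_expandable h (\<lambda>\<tau>. \<phi> (u \<tau>)))"
proof
  assume "\<exists>a::nat \<Rightarrow> 'v. (\<forall>n. a n \<in> filtration V N) \<and> (\<forall>\<tau>\<in>uhp. vsums V (\<lambda>n. smul V (qpar h \<tau> ^ n) (a n)) (u \<tau>))"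
  then obtain a where a: "\<And>\<tau> \<phi>. \<tau> \<in> uhp \<Longrightarrow> functional \<phi> \<Longrightarrow> (\<lambda>n. \<phi> (smul V (qpar h \<tau> ^ n) (a n))) sums \<phi> (u \<tau>)"
    by (auto simp: vsums_def linear_functional_iff)
  show "\<forall>\<phi>. functional \<phi> \<longrightarrow> q_expandable h (\<lambda>\<tau>. \<phi> (u \<tau>))"
  proof (intro allI impI)
    fix \<phi> assume \<phi>: "functional \<phi>"
    have "(\<lambda>n. \<phi> (a n) * qpar h \<tau> ^ n) sums \<phi> (u \<tau>)" if "\<tau> \<in> uhp" for \<tau>
      using a[OF that \<phi>] by (simp add: functional_scale[OF \<phi>] mult.commute)
    then show "q_expandable h (\<lambda>\<tau>. \<phi> (u \<tau>))"
      unfolding q_expandable_iff_power_series[OF h] by (intro exI[of _ "\<lambda>n. \<phi> (a n)"]) auto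
  qed
next
  assume q: "\<forall>\<phi>. functional \<phi> \<longrightarrow> q_expandable h (\<lambda>\<tau>. \<phi> (u \<tau>))"
  obtain S where S: "finite S" "filtration V N = span S" using filtration_finite_span by blast
  obtain B where B: "finite B" "B \<subseteq> span S" "independent B" "span B = span S"
    using finite_dim_basis[OF S(1)] by metis
  from coordinate_functionals[OF B(3)] obtain r where r: "\<And>b. functional (r b)"
    "\<And>v. v \<in> span B \<Longrightarrow> (\<Sum>b\<in>B. smul V (r b v) b) = v" using B(1) by metis
  have "\<forall>b. \<exists>c. \<forall>\<tau>\<in>uhp. (\<lambda>n. c n * qpar h \<tau> ^ n) sums r b (u \<tau>)"
    using q r(1) unfolding q_expandable_iff_power_series[OF h] by blast
  then obtain c where c: "\<And>b \<tau>. \<tau> \<in> uhp \<Longrightarrow> (\<lambda>n. c b n * qpar h \<tau> ^ n) sums r b (u \<tau>)" by metis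
  define a where "a n = (\<Sum>b\<in>B. smul V (c b n) b)" for n
  have "a n \<in> filtration V N" for n
    unfolding S(2) B(4)[symmetric] a_def by (intro span_sum span_scale span_base)
  moreover have "vsums V (\<lambda>n. smul V (qpar h \<tau> ^ n) (a n)) (u \<tau>)" if \<tau>: "\<tau> \<in> uhp" for \<tau>
    unfolding vsums_def linear_functional_iff
  proof (intro allI impI)
    fix \<phi> assume \<phi>: "functional \<phi>"
    have "(\<lambda>n. \<Sum>b\<in>B. c b n * qpar h \<tau> ^ n * \<phi> b) sums (\<Sum>b\<in>B. r b (u \<tau>) * \<phi> b)"
      by (intro sums_sum sums_mult2 c \<tau>)
    also have "(\<lambda>n. \<Sum>b\<in>B. c b n * qpar h \<tau> ^ n * \<phi> b) = (\<lambda>n. \<phi> (smul V (qpar h \<tau> ^ n) (a n)))"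
      by (simp add: a_def functional_scale[OF \<phi>] functional_sum[OF \<phi>] sum_distrib_left mult_ac)
    also have "(\<Sum>b\<in>B. r b (u \<tau>) * \<phi> b) = \<phi> (\<Sum>b\<in>B. smul V (r b (u \<tau>)) b)"
      by (simp add: functional_scale[OF \<phi>] functional_sum[OF \<phi>])
    also have "(\<Sum>b\<in>B. smul V (r b (u \<tau>)) b) = u \<tau>"
      using N[OF \<tau>] S(2) B(4) by (intro r(2)) simp
    finally show "(\<lambda>n. \<phi> (smul V (qpar h \<tau> ^ n) (a n))) sums \<phi> (u \<tau>)" .
  qed
  ultimately show "\<exists>a::nat \<Rightarrow> 'v. (\<forall>n. a n \<in> filtration V N) \<and> (\<forall>\<tau>\<in>uhp. vsums V (\<lambda>n. smul V (qpar h \<tau> ^ n) (a n)) (u \<tau>))"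
    by blast
qed

lemma sum_hcomp_filtration:
  assumes "v \<in> filtration V N"
  shows "(\<Sum>n\<in>{0..N}. hcomp V v n) = v"
proof (rule hcomp_eqI)
  fix m
  have "hcomp V (\<Sum>n\<in>{0..N}. hcomp V v n) m = (\<Sum>n\<in>{0..N}. if m = n then hcomp V v n else 0)"
    unfolding hcomp_sum by (intro sum.cong refl hcomp_homogeneous hcomp_props)
  also have "\<dots> = hcomp V v m"
    using assms hcomp_neg[of m v] by (auto simp: sum.delta' filtration_iff not_le)
  finally show "hcomp V (\<Sum>n\<in>{0..N}. hcomp V v n) m = hcomp V v m" .
qed

end

section \<open>The exponential of E L(1) on functions\<close>

lemma vector_space_pointwise:
  assumes "vector_space s"
  shows "vector_space (pointwise s)"
proof -
  interpret vector_space s by fact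
  show ?thesis
    by unfold_locales (auto simp: pointwise_def fun_eq_iff scale_right_distrib scale_left_distrib)
qed

lemma sum_fun_apply: "(sum f A) x = (\<Sum>a\<in>A. f a x)"
  for f :: "'a \<Rightarrow> 'b \<Rightarrow> 'c::comm_monoid_add"
  by (induction A rule: infinite_finite_induct) auto

context cft_voa
begin

lemma weak_exp_L1_holomorphic:
  assumes "e holomorphic_on uhp" "\<And>\<phi>. functional \<phi> \<Longrightarrow> (\<lambda>\<tau>. \<phi> (u \<tau>)) holomorphic_on uhp"
    and "\<And>\<tau>. \<tau> \<in> uhp \<Longrightarrow> u \<tau> \<in> filtration V N" "functional \<phi>"
  shows "(\<lambda>\<tau>. \<phi> (exp_L1 V (e \<tau>) (u \<tau>))) holomorphic_on uhp"
proof (rule weak_exp_L1[where Pr = "\<lambda>u. u holomorphic_on uhp" and N = N and e = e and u = u and \<phi> = \<phi>, OF _ _ _ _ assms])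
  show "v holomorphic_on uhp" if "\<And>\<tau>. \<tau> \<in> uhp \<Longrightarrow> u \<tau> = v \<tau>" "u holomorphic_on uhp" for u v
    by (rule holomorphic_transform[OF that(2)]) (rule that(1))
qed (auto intro: holomorphic_intros)

lemma weak_exp_L1_q_expandable:
  assumes "q_expandable h e" "\<And>\<phi>. functional \<phi> \<Longrightarrow> q_expandable h (\<lambda>\<tau>. \<phi> (u \<tau>))"
    and "\<And>\<tau>. \<tau> \<in> uhp \<Longrightarrow> u \<tau> \<in> filtration V N" "functional \<phi>"
  shows "q_expandable h (\<lambda>\<tau>. \<phi> (exp_L1 V (e \<tau>) (u \<tau>)))"
proof (rule weak_exp_L1[where Pr = "q_expandable h" and N = N and e = e and u = u and \<phi> = \<phi>, OF _ _ _ _ assms])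
  show "q_expandable h v" if "\<And>\<tau>. \<tau> \<in> uhp \<Longrightarrow> u \<tau> = v \<tau>" "q_expandable h u" for u v
    using q_expandable_cong[of u v h] that by simp
qed (auto intro: q_expandable_const q_expandable_add q_expandable_mult)

end

locale cft_voa_forms = cft_voa V + discrete_subgroup \<Gamma>
  for V :: "'v::ab_group_add voa" and \<Gamma> :: "(real^2^2) set" +
  fixes E :: "complex \<Rightarrow> complex"
  assumes E2: "quasimodular_E2 \<Gamma> E"
begin

text \<open>The weight-\<open>k\<close> part of \<open>M(\<Gamma>) \<otimes> V\<^sup>(\<^sup>2\<^sup>)\<close> as a
space of functions: the component in \<open>V\<^sub>n\<close> is modular of weight \<open>k - 2n\<close>, tested on
functionals.\<close>

definition tensor_forms :: "int \<Rightarrow> (complex \<Rightarrow> 'v) set" where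
  "tensor_forms k = {u. (\<forall>\<tau>. \<tau> \<notin> uhp \<longrightarrow> u \<tau> = 0) \<and> (\<exists>N. \<forall>\<tau>\<in>uhp. u \<tau> \<in> filtration V N) \<and>
     (\<forall>n \<phi>. functional \<phi> \<longrightarrow> (\<lambda>\<tau>. \<phi> (hcomp V (u \<tau>) n)) \<in> modular_forms \<Gamma> (k - 2 * n))}"

definition expE :: "(complex \<Rightarrow> 'v) \<Rightarrow> complex \<Rightarrow> 'v" where
  "expE u = (\<lambda>\<tau>. exp_L1 V (- (2 * of_real pi * \<i> / 12) * E \<tau>) (u \<tau>))"

definition expE_inv :: "(complex \<Rightarrow> 'v) \<Rightarrow> complex \<Rightarrow> 'v" where
  "expE_inv u = (\<lambda>\<tau>. exp_L1 V (- (- (2 * of_real pi * \<i> / 12) * E \<tau>)) (u \<tau>))"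

lemma expE_inverse [simp]: "expE_inv (expE u) = u" "expE (expE_inv u) = u"
  by (simp_all add: expE_def expE_inv_def exp_L1_exp_L1)

text \<open>This is where the constant \<open>-2\<pi>i/12\<close> in the definition of \<open>P\<close> matches the
constant in the transformation law of \<open>E\<close>.\<close>

lemma E_transform:
  assumes "\<gamma> \<in> \<Gamma>" "\<tau> \<in> uhp"
  shows "Xfac \<gamma> \<tau> + - (2 * of_real pi * \<i> / 12) * slash 2 \<gamma> E \<tau> = - (2 * of_real pi * \<i> / 12) * E \<tau>"
proof -
  have "slash 2 \<gamma> E \<tau> = E \<tau> + 12 / (2 * of_real pi * \<i>) * Xfac \<gamma> \<tau>"
    using E2 assms unfolding quasimodular_E2_def by blast
  then show ?thesis by (simp add: distrib_left field_simps)
qed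

lemma vslash_expE:
  assumes "\<sigma> \<in> SL2R" "\<tau> \<in> uhp"
  shows "vslash V k \<sigma> (expE u) \<tau> = exp_L1 V (Xfac \<sigma> \<tau> + - (2 * of_real pi * \<i> / 12) * slash 2 \<sigma> E \<tau>) (gslash k \<sigma> u \<tau>)"
  by (rule vslash_exp_L1) (use assms in \<open>simp_all add: expE_def\<close>)

lemma hcomp_gslash_slash:
  assumes "\<sigma> \<in> SL2R" "\<tau> \<in> uhp" "functional \<phi>"
  shows "\<phi> (hcomp V (gslash k \<sigma> u \<tau>) n) = slash (k - 2 * n) \<sigma> (\<lambda>\<tau>. \<phi> (hcomp V (u \<tau>) n)) \<tau>"
  using hcomp_gslash[OF jfac_nonzero[OF assms(1,2)]] functional_scale[OF assms(3)] by (simp add: slash_def)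

lemma gslash_filtration:
  "u (moeb \<sigma> \<tau>) \<in> filtration V N \<Longrightarrow> gslash k \<sigma> u \<tau> \<in> filtration V N"
  unfolding gslash_def by (intro subspace_scale[OF filtration_subspace] filtration_pow_L0)

lemma functional_via_components:
  assumes "functional \<phi>" "v \<in> filtration V N"
  shows "\<phi> v = (\<Sum>n\<in>{0..N}. \<phi> (hcomp V v n))"
  using sum_hcomp_filtration[OF assms(2)] functional_sum[OF assms(1)] by metis

text \<open>For \<open>\<gamma>\<close> in \<open>\<Gamma>\<close> the exponents on both sides agree, so the exponential
can be cancelled; what remains is diagonal.\<close>

lemma expE_invariant_iff:
  assumes "\<gamma> \<in> \<Gamma>" "\<tau> \<in> uhp"
  shows "vslash V k \<gamma> (expE u) \<tau> = expE u \<tau> \<longleftrightarrow>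
    (\<forall>n \<phi>. functional \<phi> \<longrightarrow> slash (k - 2 * n) \<gamma> (\<lambda>\<tau>. \<phi> (hcomp V (u \<tau>) n)) \<tau> = \<phi> (hcomp V (u \<tau>) n))"
proof -
  have \<gamma>: "\<gamma> \<in> SL2R" using assms SL2R_mem by blast
  have inj: "exp_L1 V z v = exp_L1 V z w \<longleftrightarrow> v = w" for z v w
    by (metis add.left_inverse exp_L1_exp_L1 exp_L1_zero)
  have "vslash V k \<gamma> (expE u) \<tau> = expE u \<tau> \<longleftrightarrow> gslash k \<gamma> u \<tau> = u \<tau>"
    unfolding vslash_expE[OF \<gamma> assms(2)] E_transform[OF assms] unfolding expE_def inj ..
  also have "\<dots> \<longleftrightarrow> (\<forall>n. hcomp V (gslash k \<gamma> u \<tau>) n = hcomp V (u \<tau>) n)"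
    using hcomp_eqI by metis
  also have "\<dots> \<longleftrightarrow> (\<forall>n \<phi>. functional \<phi> \<longrightarrow> \<phi> (hcomp V (gslash k \<gamma> u \<tau>) n) = \<phi> (hcomp V (u \<tau>) n))"
    using functionals_separate by metis
  finally show ?thesis using hcomp_gslash_slash[OF \<gamma> assms(2)] by auto
qed

text \<open>Each condition defining vector-valued modular forms is translated separately into the scalar condition on
all components; the elliptic condition is implied by invariance.\<close>

theorem expE_modular_iff: "expE u \<in> vmodular_forms V \<Gamma> k \<longleftrightarrow> u \<in> tensor_forms k"
proof -
  let ?e = "\<lambda>\<tau>. - (2 * of_real pi * \<i> / 12) * E \<tau>"
  have Ehol: "E holomorphic_on uhp" using E2 by (simp add: quasimodular_E2_def)
  have zero: "expE u \<tau> = 0 \<longleftrightarrow> u \<tau> = 0" for \<tau>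
    by (metis expE_def exp_L1_zero_vec expE_inverse(1) expE_inv_def)
  have filt: "expE u \<tau> \<in> filtration V N \<longleftrightarrow> u \<tau> \<in> filtration V N" for \<tau> N
    by (metis expE_def expE_inverse(1) expE_inv_def filtration_exp_L1)
  have main: "vholomorphic V (expE u) \<and>
       (\<forall>\<gamma>\<in>\<Gamma>. \<forall>\<tau>\<in>uhp. vslash V k \<gamma> (expE u) \<tau> = expE u \<tau>) \<and>
       (\<forall>\<sigma> h. cusp_at \<Gamma> \<sigma> \<and> cusp_width \<Gamma> \<sigma> h \<longrightarrow>
          (\<exists>a::nat \<Rightarrow> 'v. (\<forall>n. a n \<in> filtration V N) \<and>
             (\<forall>\<tau>\<in>uhp. vsums V (\<lambda>n. smul V (qpar h \<tau> ^ n) (a n)) (vslash V k \<sigma> (expE u) \<tau>)))) \<and>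
       (\<forall>\<tau> \<gamma>. elliptic_with_generator \<Gamma> \<tau> \<gamma> \<longrightarrow>
          smul V (jfac \<gamma> \<tau> powi k) (Kfac V \<gamma> \<tau> (expE u \<tau>)) = expE u \<tau>) \<longleftrightarrow>
     (\<forall>n \<phi>. functional \<phi> \<longrightarrow> (\<lambda>\<tau>. \<phi> (hcomp V (u \<tau>) n)) \<in> modular_forms \<Gamma> (k - 2 * n))"
    (is "?hol \<and> ?inv \<and> ?cusp \<and> ?ell \<longleftrightarrow> ?R")
    if out: "\<And>\<tau>. \<tau> \<notin> uhp \<Longrightarrow> u \<tau> = 0" and N: "\<And>\<tau>. \<tau> \<in> uhp \<Longrightarrow> u \<tau> \<in> filtration V N" for N
  proof -
    have hol: "?hol \<longleftrightarrow> (\<forall>n \<phi>. functional \<phi> \<longrightarrow> (\<lambda>\<tau>. \<phi> (hcomp V (u \<tau>) n)) holomorphic_on uhp)"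
    proof
      assume ?hol
      then have h: "(\<lambda>\<tau>. \<phi> (expE u \<tau>)) holomorphic_on uhp" if "functional \<phi>" for \<phi>
        using that by (simp add: vholomorphic_def linear_functional_iff)
      have "(\<lambda>\<tau>. \<phi> (exp_L1 V (- ?e \<tau>) (expE u \<tau>))) holomorphic_on uhp" if "functional \<phi>" for \<phi>
        by (rule weak_exp_L1_holomorphic[OF _ h _ that, where N = N])
          (auto intro!: holomorphic_intros Ehol simp: filt N)
      then have "(\<lambda>\<tau>. \<phi> (u \<tau>)) holomorphic_on uhp" if "functional \<phi>" for \<phi>
        using that expE_inverse(1)[of u] unfolding expE_inv_def by metis
      then show "\<forall>n \<phi>. functional \<phi> \<longrightarrow> (\<lambda>\<tau>. \<phi> (hcomp V (u \<tau>) n)) holomorphic_on uhp"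
        using functional_hcomp by blast
    next
      assume c: "\<forall>n \<phi>. functional \<phi> \<longrightarrow> (\<lambda>\<tau>. \<phi> (hcomp V (u \<tau>) n)) holomorphic_on uhp"
      have h: "(\<lambda>\<tau>. \<phi> (u \<tau>)) holomorphic_on uhp" if "functional \<phi>" for \<phi>
      proof -
        have "(\<lambda>\<tau>. \<Sum>n\<in>{0..N}. \<phi> (hcomp V (u \<tau>) n)) holomorphic_on uhp"
          using c that by (intro holomorphic_intros) auto
        then show ?thesis
          by (rule holomorphic_transform) (simp add: functional_via_components[OF that N])
      qed
      have "(\<lambda>\<tau>. \<phi> (exp_L1 V (?e \<tau>) (u \<tau>))) holomorphic_on uhp" if "functional \<phi>" for \<phi>
        by (rule weak_exp_L1_holomorphic[OF _ h _ that, where N = N])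
          (auto intro!: holomorphic_intros Ehol simp: N)
      then show ?hol by (simp add: vholomorphic_def linear_functional_iff expE_def)
    qed
    have inv: "?inv \<longleftrightarrow> (\<forall>n \<phi>. functional \<phi> \<longrightarrow> (\<forall>\<gamma>\<in>\<Gamma>. \<forall>\<tau>\<in>uhp. slash (k - 2 * n) \<gamma> (\<lambda>\<tau>. \<phi> (hcomp V (u \<tau>) n)) \<tau> = \<phi> (hcomp V (u \<tau>) n)))"
      using expE_invariant_iff by blast
    have cusp1: "(\<exists>a::nat \<Rightarrow> 'v. (\<forall>n. a n \<in> filtration V N) \<and>
             (\<forall>\<tau>\<in>uhp. vsums V (\<lambda>n. smul V (qpar h \<tau> ^ n) (a n)) (vslash V k \<sigma> (expE u) \<tau>))) \<longleftrightarrow>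
          (\<forall>n \<phi>. functional \<phi> \<longrightarrow> q_expandable h (slash (k - 2 * n) \<sigma> (\<lambda>\<tau>. \<phi> (hcomp V (u \<tau>) n))))"
      if \<sigma>h: "cusp_at \<Gamma> \<sigma>" "cusp_width \<Gamma> \<sigma> h" for \<sigma> h
    proof -
      have \<sigma>: "\<sigma> \<in> SL2R" using \<sigma>h by (simp add: cusp_at_def)
      have h: "h > 0" using \<sigma>h by (simp add: cusp_width_def)
      let ?x = "\<lambda>\<tau>. Xfac \<sigma> \<tau> + - (2 * of_real pi * \<i> / 12) * slash 2 \<sigma> E \<tau>"
      let ?g = "gslash k \<sigma> u"
      have x: "q_expandable h ?x" by (rule quasimodular_shift_q_expandable[OF E2 \<sigma>h])
      have x': "q_expandable h (\<lambda>\<tau>. - ?x \<tau>)"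
        using q_expandable_mult[OF q_expandable_const x, of "-1"] by simp
      have gN: "?g \<tau> \<in> filtration V N" if "\<tau> \<in> uhp" for \<tau>
        by (rule gslash_filtration) (use N \<sigma> that in simp)
      have vN: "vslash V k \<sigma> (expE u) \<tau> \<in> filtration V N" if "\<tau> \<in> uhp" for \<tau>
        unfolding vslash_expE[OF \<sigma> that] by (intro filtration_exp_L1 gN that)
      have cong: "(\<And>\<tau>. \<tau> \<in> uhp \<Longrightarrow> u \<tau> = v \<tau>) \<Longrightarrow> q_expandable h u \<Longrightarrow> q_expandable h v" for u v
        using q_expandable_cong[of u v h] by simp
      have "(\<exists>a::nat \<Rightarrow> 'v. (\<forall>n. a n \<in> filtration V N) \<and>
             (\<forall>\<tau>\<in>uhp. vsums V (\<lambda>n. smul V (qpar h \<tau> ^ n) (a n)) (vslash V k \<sigma> (expE u) \<tau>))) \<longleftrightarrow>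
          (\<forall>\<phi>. functional \<phi> \<longrightarrow> q_expandable h (\<lambda>\<tau>. \<phi> (vslash V k \<sigma> (expE u) \<tau>)))"
        by (rule weak_q_expandable_iff[OF h vN])
      also have "\<dots> \<longleftrightarrow> (\<forall>\<phi>. functional \<phi> \<longrightarrow> q_expandable h (\<lambda>\<tau>. \<phi> (?g \<tau>)))"
      proof
        assume a: "\<forall>\<phi>. functional \<phi> \<longrightarrow> q_expandable h (\<lambda>\<tau>. \<phi> (vslash V k \<sigma> (expE u) \<tau>))"
        have q0: "q_expandable h (\<lambda>\<tau>. \<phi> (exp_L1 V (- ?x \<tau>) (vslash V k \<sigma> (expE u) \<tau>)))" if "functional \<phi>" for \<phi>
          by (rule weak_exp_L1_q_expandable[OF x' _ vN that]) (use a in auto)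
        have "q_expandable h (\<lambda>\<tau>. \<phi> (?g \<tau>))" if "functional \<phi>" for \<phi>
          by (rule cong[OF _ q0[OF that]]) (simp add: vslash_expE[OF \<sigma>] exp_L1_exp_L1)
        then show "\<forall>\<phi>. functional \<phi> \<longrightarrow> q_expandable h (\<lambda>\<tau>. \<phi> (?g \<tau>))" by blast
      next
        assume a: "\<forall>\<phi>. functional \<phi> \<longrightarrow> q_expandable h (\<lambda>\<tau>. \<phi> (?g \<tau>))"
        have q0: "q_expandable h (\<lambda>\<tau>. \<phi> (exp_L1 V (?x \<tau>) (?g \<tau>)))" if "functional \<phi>" for \<phi>
          by (rule weak_exp_L1_q_expandable[OF x _ gN that]) (use a in auto)
        have "q_expandable h (\<lambda>\<tau>. \<phi> (vslash V k \<sigma> (expE u) \<tau>))" if "functional \<phi>" for \<phi>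
          by (rule cong[OF _ q0[OF that]]) (simp add: vslash_expE[OF \<sigma>])
        then show "\<forall>\<phi>. functional \<phi> \<longrightarrow> q_expandable h (\<lambda>\<tau>. \<phi> (vslash V k \<sigma> (expE u) \<tau>))" by blast
      qed
      also have "\<dots> \<longleftrightarrow> (\<forall>n \<phi>. functional \<phi> \<longrightarrow> q_expandable h (\<lambda>\<tau>. \<phi> (hcomp V (?g \<tau>) n)))"
      proof
        assume "\<forall>\<phi>. functional \<phi> \<longrightarrow> q_expandable h (\<lambda>\<tau>. \<phi> (?g \<tau>))"
        then show "\<forall>n \<phi>. functional \<phi> \<longrightarrow> q_expandable h (\<lambda>\<tau>. \<phi> (hcomp V (?g \<tau>) n))"
          using functional_hcomp by blast
      next
        assume a: "\<forall>n \<phi>. functional \<phi> \<longrightarrow> q_expandable h (\<lambda>\<tau>. \<phi> (hcomp V (?g \<tau>) n))"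
        have "q_expandable h (\<lambda>\<tau>. \<phi> (?g \<tau>))" if \<phi>: "functional \<phi>" for \<phi>
        proof -
          have sm: "finite A \<Longrightarrow> (\<And>a. a \<in> A \<Longrightarrow> q_expandable h (f a)) \<Longrightarrow> q_expandable h (\<lambda>\<tau>. \<Sum>a\<in>A. f a \<tau>)" for A :: "int set" and f
            by (induction A rule: finite_induct) (auto intro: q_expandable_add q_expandable_const)
          have "q_expandable h (\<lambda>\<tau>. \<Sum>n\<in>{0..N}. \<phi> (hcomp V (?g \<tau>) n))"
            by (rule sm) (use a \<phi> in auto)
          then show ?thesis
            by (rule cong[rotated]) (simp add: functional_via_components[OF \<phi> gN])
        qed
        then show "\<forall>\<phi>. functional \<phi> \<longrightarrow> q_expandable h (\<lambda>\<tau>. \<phi> (?g \<tau>))" by blast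
      qed
      also have "\<dots> \<longleftrightarrow> (\<forall>n \<phi>. functional \<phi> \<longrightarrow> q_expandable h (slash (k - 2 * n) \<sigma> (\<lambda>\<tau>. \<phi> (hcomp V (u \<tau>) n))))"
      proof -
        have "q_expandable h (\<lambda>\<tau>. \<phi> (hcomp V (?g \<tau>) n)) = q_expandable h (slash (k - 2 * n) \<sigma> (\<lambda>\<tau>. \<phi> (hcomp V (u \<tau>) n)))"
          if "functional \<phi>" for \<phi> n
          by (rule q_expandable_cong) (rule hcomp_gslash_slash[OF \<sigma> _ that])
        then show ?thesis by blast
      qed
      finally show ?thesis .
    qed
    have cusp: "?cusp \<longleftrightarrow> (\<forall>n \<phi>. functional \<phi> \<longrightarrow> (\<forall>\<sigma> h. cusp_at \<Gamma> \<sigma> \<and> cusp_width \<Gamma> \<sigma> h \<longrightarrow>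
        q_expandable h (slash (k - 2 * n) \<sigma> (\<lambda>\<tau>. \<phi> (hcomp V (u \<tau>) n)))))"
      using cusp1 by blast
    \<comment> \<open>At a fixed point of \<open>\<gamma>\<close> invariance says \<open>j\<^bsup>-k\<^esup> K\<inverse> f(\<tau>) = f(\<tau>)\<close>.\<close>
    have ell: ?ell if inv: ?inv
    proof (intro allI impI)
      fix \<tau> \<gamma> assume e: "elliptic_with_generator \<Gamma> \<tau> \<gamma>"
      have "\<gamma> \<in> generate SL2R_group {\<gamma>, - mat 1}" by (rule generate.incl) simp
      then have \<gamma>: "\<gamma> \<in> \<Gamma>" "moeb \<gamma> \<tau> = \<tau>" and \<tau>: "\<tau> \<in> uhp"
        using e unfolding elliptic_with_generator_def by auto
      have j: "jfac \<gamma> \<tau> \<noteq> 0" using \<gamma> \<tau> SL2R_mem by auto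
      have "vslash V k \<gamma> (expE u) \<tau> = expE u \<tau>" using inv \<gamma> \<tau> by blast
      then have "smul V (jfac \<gamma> \<tau> powi k) (smul V (jfac \<gamma> \<tau> powi (- k)) (inv_into UNIV (Kfac V \<gamma> \<tau>) (expE u \<tau>))) = smul V (jfac \<gamma> \<tau> powi k) (expE u \<tau>)"
        unfolding vslash_def \<gamma>(2) by simp
      then have "inv_into UNIV (Kfac V \<gamma> \<tau>) (expE u \<tau>) = smul V (jfac \<gamma> \<tau> powi k) (expE u \<tau>)"
        using j by (simp add: power_int_add[symmetric])
      then have "Kfac V \<gamma> \<tau> (inv_into UNIV (Kfac V \<gamma> \<tau>) (expE u \<tau>)) = Kfac V \<gamma> \<tau> (smul V (jfac \<gamma> \<tau> powi k) (expE u \<tau>))" by simp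
      moreover have "Kfac V \<gamma> \<tau> (inv_into UNIV (Kfac V \<gamma> \<tau>) (expE u \<tau>)) = expE u \<tau>"
        using inv_Kfac(2)[OF j] by (simp add: bij_is_surj surj_f_inv_f)
      moreover have "Kfac V \<gamma> \<tau> (smul V c v) = smul V c (Kfac V \<gamma> \<tau> v)" for c v
      proof -
        have "pow_L0 V (jfac \<gamma> \<tau>) (- 2) (smul V c v) = smul V c (pow_L0 V (jfac \<gamma> \<tau>) (- 2) v)"
          by (rule hcomp_eqI) (simp add: hcomp_pow_L0 hcomp_scale mult.commute)
        then show ?thesis by (simp add: Kfac_def exp_L1_scale)
      qed
      ultimately show "smul V (jfac \<gamma> \<tau> powi k) (Kfac V \<gamma> \<tau> (expE u \<tau>)) = expE u \<tau>" by simp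
    qed
    have zero_out: "\<forall>n \<phi>. functional \<phi> \<longrightarrow> (\<forall>\<tau>. \<tau> \<notin> uhp \<longrightarrow> \<phi> (hcomp V (u \<tau>) n) = 0)"
      using out by (simp add: functional_zero)
    have "?R \<longleftrightarrow> ?hol \<and> ?inv \<and> ?cusp"
      unfolding modular_forms_iff hol inv cusp using zero_out by blast
    then show ?thesis using ell by blast
  qed
  show ?thesis
  proof
    assume "expE u \<in> vmodular_forms V \<Gamma> k"
    then obtain N where out: "\<And>\<tau>. \<tau> \<notin> uhp \<Longrightarrow> u \<tau> = 0" and N: "\<And>\<tau>. \<tau> \<in> uhp \<Longrightarrow> u \<tau> \<in> filtration V N"
      and rest: "vholomorphic V (expE u) \<and>
       (\<forall>\<gamma>\<in>\<Gamma>. \<forall>\<tau>\<in>uhp. vslash V k \<gamma> (expE u) \<tau> = expE u \<tau>) \<and>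
       (\<forall>\<sigma> h. cusp_at \<Gamma> \<sigma> \<and> cusp_width \<Gamma> \<sigma> h \<longrightarrow>
          (\<exists>a::nat \<Rightarrow> 'v. (\<forall>n. a n \<in> filtration V N) \<and>
             (\<forall>\<tau>\<in>uhp. vsums V (\<lambda>n. smul V (qpar h \<tau> ^ n) (a n)) (vslash V k \<sigma> (expE u) \<tau>)))) \<and>
       (\<forall>\<tau> \<gamma>. elliptic_with_generator \<Gamma> \<tau> \<gamma> \<longrightarrow>
          smul V (jfac \<gamma> \<tau> powi k) (Kfac V \<gamma> \<tau> (expE u \<tau>)) = expE u \<tau>)"
      unfolding vmodular_forms_def mem_Collect_eq filt zero by auto
    have "\<forall>n \<phi>. functional \<phi> \<longrightarrow> (\<lambda>\<tau>. \<phi> (hcomp V (u \<tau>) n)) \<in> modular_forms \<Gamma> (k - 2 * n)"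
      by (rule iffD1[OF main rest]) (fact out, fact N)
    then show "u \<in> tensor_forms k"
      using out N unfolding tensor_forms_def by blast
  next
    assume "u \<in> tensor_forms k"
    then obtain N where out: "\<And>\<tau>. \<tau> \<notin> uhp \<Longrightarrow> u \<tau> = 0" and N: "\<And>\<tau>. \<tau> \<in> uhp \<Longrightarrow> u \<tau> \<in> filtration V N"
      and R: "\<forall>n \<phi>. functional \<phi> \<longrightarrow> (\<lambda>\<tau>. \<phi> (hcomp V (u \<tau>) n)) \<in> modular_forms \<Gamma> (k - 2 * n)"
      unfolding tensor_forms_def by blast
    note main' = iffD2[OF main[of N] R]
    show "expE u \<in> vmodular_forms V \<Gamma> k"
      unfolding vmodular_forms_def mem_Collect_eq filt zero
    proof (intro conjI exI[of _ N])
      show "\<forall>\<tau>. \<tau> \<notin> uhp \<longrightarrow> u \<tau> = 0" using out by blast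
      show "\<forall>\<tau>\<in>uhp. u \<tau> \<in> filtration V N" using N by blast
    qed (use main'[OF out N] in blast)+
  qed
qed

end

section \<open>The tensor product and the map P\<close>

context cft_voa_forms
begin

lemma hcomp_tens: "hcomp V (tens V f v k \<tau>) n = smul V (f (k - 2 * n) \<tau>) (hcomp V v n)"
proof -
  obtain A where A: "finite A" "\<And>n. n \<notin> A \<Longrightarrow> hcomp V v n = 0" "sum (hcomp V v) A = v" using hcomp_support[of v] by blast
  have "tens V f v k \<tau> = (\<Sum>n\<in>A. smul V (f (k - 2 * n) \<tau>) (hcomp V v n))"
    unfolding tens_def by (rule Sum_any_eq_sum) (use A in auto)
  then have "hcomp V (tens V f v k \<tau>) = (\<lambda>n. smul V (f (k - 2 * n) \<tau>) (hcomp V v n))"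
    by (intro hcomp_unique_sum[OF _ A(1)]) (use A hcomp_props hsp_scale in auto)
  then show ?thesis by simp
qed

lemma tens_homogeneous:
  assumes "v \<in> hsp V n"
  shows "tens V f v k \<tau> = smul V (f (k - 2 * n) \<tau>) v"
  by (rule hcomp_eqI) (simp add: hcomp_tens hcomp_scale hcomp_homogeneous[OF assms])

lemma tensor_formsI:
  assumes "\<And>\<tau>. \<tau> \<notin> uhp \<Longrightarrow> u \<tau> = 0" "\<And>\<tau>. \<tau> \<in> uhp \<Longrightarrow> u \<tau> \<in> filtration V N"
    "\<And>n \<phi>. functional \<phi> \<Longrightarrow> (\<lambda>\<tau>. \<phi> (hcomp V (u \<tau>) n)) \<in> modular_forms \<Gamma> (k - 2 * n)"
  shows "u \<in> tensor_forms k"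
  using assms unfolding tensor_forms_def by blast

lemma tensor_formsD:
  assumes "u \<in> tensor_forms k"
  shows "\<tau> \<notin> uhp \<Longrightarrow> u \<tau> = 0" "\<exists>N. \<forall>\<tau>\<in>uhp. u \<tau> \<in> filtration V N"
    "functional \<phi> \<Longrightarrow> (\<lambda>\<tau>. \<phi> (hcomp V (u \<tau>) n)) \<in> modular_forms \<Gamma> (k - 2 * n)"
  using assms unfolding tensor_forms_def by blast+

lemma tensor_forms_add:
  assumes "u \<in> tensor_forms k" "w \<in> tensor_forms k"
  shows "(\<lambda>\<tau>. u \<tau> + w \<tau>) \<in> tensor_forms k"
proof -
  obtain N M where N: "\<forall>\<tau>\<in>uhp. u \<tau> \<in> filtration V N" and M: "\<forall>\<tau>\<in>uhp. w \<tau> \<in> filtration V M"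
    using assms unfolding tensor_forms_def by blast
  have "\<forall>\<tau>\<in>uhp. u \<tau> + w \<tau> \<in> filtration V (max N M)"
    using N M filtration_mono[of _ N "max N M"] filtration_mono[of _ M "max N M"]
    by (auto intro!: subspace_add[OF filtration_subspace])
  moreover have "(\<lambda>\<tau>. \<phi> (hcomp V (u \<tau> + w \<tau>) n)) \<in> modular_forms \<Gamma> (k - 2 * n)" if "functional \<phi>" for \<phi> n
    using assms that unfolding tensor_forms_def hcomp_add functional_add[OF that]
    by (intro modular_forms_add) auto
  ultimately show ?thesis using assms unfolding tensor_forms_def by auto
qed

lemma tensor_forms_mult:
  assumes f: "f \<in> modular_forms \<Gamma> l" and u: "u \<in> tensor_forms k"
  shows "(\<lambda>\<tau>. smul V (f \<tau>) (u \<tau>)) \<in> tensor_forms (l + k)"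
proof -
  have "(\<lambda>\<tau>. \<phi> (hcomp V (smul V (f \<tau>) (u \<tau>)) n)) \<in> modular_forms \<Gamma> (l + k - 2 * n)" if \<phi>: "functional \<phi>" for \<phi> n
  proof -
    have "(\<lambda>\<tau>. f \<tau> * \<phi> (hcomp V (u \<tau>) n)) \<in> modular_forms \<Gamma> (l + (k - 2 * n))"
      using u \<phi> by (intro modular_forms_mult[OF sub_SL2R f]) (simp add: tensor_forms_def)
    then show ?thesis by (simp add: hcomp_scale functional_scale[OF \<phi>] algebra_simps)
  qed
  moreover obtain N where "\<forall>\<tau>\<in>uhp. u \<tau> \<in> filtration V N" using tensor_formsD(2)[OF u] by blast
  then have "smul V (f \<tau>) (u \<tau>) \<in> filtration V N" if "\<tau> \<in> uhp" for \<tau>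
    using that subspace_scale[OF filtration_subspace] by blast
  ultimately show ?thesis using tensor_formsD(1)[OF u] by (intro tensor_formsI) auto
qed

lemma tensor_forms_scale:
  assumes "u \<in> tensor_forms k"
  shows "(\<lambda>\<tau>. smul V c (u \<tau>)) \<in> tensor_forms k"
proof -
  have "(\<lambda>\<tau>. \<phi> (hcomp V (smul V c (u \<tau>)) n)) \<in> modular_forms \<Gamma> (k - 2 * n)" if \<phi>: "functional \<phi>" for \<phi> n
    using assms \<phi> unfolding hcomp_scale functional_scale[OF \<phi>]
    by (intro modular_forms_const_mult) (simp add: tensor_forms_def)
  moreover obtain N where "\<forall>\<tau>\<in>uhp. u \<tau> \<in> filtration V N" using tensor_formsD(2)[OF assms] by blast
  then have "smul V c (u \<tau>) \<in> filtration V N" if "\<tau> \<in> uhp" for \<tau>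
    using that subspace_scale[OF filtration_subspace] by blast
  ultimately show ?thesis using tensor_formsD(1)[OF assms] by (intro tensor_formsI) auto
qed

lemma tensor_forms_zero: "(\<lambda>_. 0) \<in> tensor_forms k"
  unfolding tensor_forms_def by (auto simp: functional_zero filtration_iff)

lemma tensor_forms_sum:
  "finite A \<Longrightarrow> (\<And>a. a \<in> A \<Longrightarrow> u a \<in> tensor_forms k) \<Longrightarrow> (\<lambda>\<tau>. \<Sum>a\<in>A. u a \<tau>) \<in> tensor_forms k"
  by (induction A rule: finite_induct) (auto intro: tensor_forms_add tensor_forms_zero)

abbreviation fam_span :: "(int \<Rightarrow> complex \<Rightarrow> 'v) set \<Rightarrow> (int \<Rightarrow> complex \<Rightarrow> 'v) set" where
  "fam_span \<equiv> module.span (famscale V)"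

lemma vector_space_famscale: "vector_space (famscale V)"
  by (intro vector_space_pointwise vector_space_axioms)

lemma direct_sum_subspace: "module.subspace (famscale V) (direct_sum tensor_forms)"
proof -
  interpret fam: vector_space "famscale V" by (rule vector_space_famscale)
  show ?thesis
  proof (rule fam.subspaceI)
    show "0 \<in> direct_sum tensor_forms"
      using tensor_forms_zero by (simp add: direct_sum_def zero_fun_def)
  next
    fix F G assume F: "F \<in> direct_sum tensor_forms" and G: "G \<in> direct_sum tensor_forms"
    have "{k. (F + G) k \<noteq> 0} \<subseteq> {k. F k \<noteq> 0} \<union> {k. G k \<noteq> 0}" by auto
    then have "finite {k. (F + G) k \<noteq> 0}"
      by (rule finite_subset) (use F G in \<open>simp add: direct_sum_def\<close>)
    moreover have "(F + G) k \<in> tensor_forms k" for k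
      using tensor_forms_add[of "F k" k "G k"] F G by (simp add: direct_sum_def plus_fun_def)
    ultimately show "F + G \<in> direct_sum tensor_forms" by (simp add: direct_sum_def)
  next
    fix c F assume F: "F \<in> direct_sum tensor_forms"
    have "{k. famscale V c F k \<noteq> 0} \<subseteq> {k. F k \<noteq> 0}" by (auto simp: pointwise_def zero_fun_def)
    then have "finite {k. famscale V c F k \<noteq> 0}"
      by (rule finite_subset) (use F in \<open>simp add: direct_sum_def\<close>)
    moreover have "famscale V c F k \<in> tensor_forms k" for k
      using tensor_forms_scale[of "F k" k c] F by (simp add: direct_sum_def pointwise_def)
    ultimately show "famscale V c F \<in> direct_sum tensor_forms" by (simp add: direct_sum_def)
  qed
qed

lemma tens_in_direct_sum:
  assumes f: "f \<in> modular_ring \<Gamma>"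
  shows "tens V f v \<in> direct_sum tensor_forms"
proof -
  have fk: "f k \<in> modular_forms \<Gamma> k" for k using f by (simp add: modular_ring_def direct_sum_def)
  have fin: "finite {k. f k \<noteq> 0}" using f by (simp add: modular_ring_def direct_sum_def)
  have "{k. tens V f v k \<noteq> 0} \<subseteq> (\<lambda>(m, n). m + 2 * n) ` ({k. f k \<noteq> 0} \<times> {n. hcomp V v n \<noteq> 0})"
  proof
    fix k assume "k \<in> {k. tens V f v k \<noteq> 0}"
    then obtain \<tau> where "tens V f v k \<tau> \<noteq> 0" by (auto simp: fun_eq_iff)
    then obtain n where n: "hcomp V (tens V f v k \<tau>) n \<noteq> hcomp V 0 n" using hcomp_eqI by blast
    then have "f (k - 2 * n) \<noteq> 0" "hcomp V v n \<noteq> 0" by (auto simp: hcomp_tens zero_fun_def)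
    then show "k \<in> (\<lambda>(m, n). m + 2 * n) ` ({k. f k \<noteq> 0} \<times> {n. hcomp V v n \<noteq> 0})"
      by (intro image_eqI[of _ _ "(k - 2 * n, n)"]) auto
  qed
  then have "finite {k. tens V f v k \<noteq> 0}"
    by (rule finite_subset) (use fin hcomp_props(2) in auto)
  moreover have "tens V f v k \<in> tensor_forms k" for k
    unfolding tensor_forms_def mem_Collect_eq
  proof (intro conjI allI impI)
    fix \<tau> :: complex assume "\<tau> \<notin> uhp"
    then have z: "f l \<tau> = 0" for l using fk[of l] by (simp add: modular_forms_iff)
    show "tens V f v k \<tau> = 0" by (rule hcomp_eqI) (simp add: hcomp_tens z)
  next
    obtain N where N: "v \<in> filtration V (int N)" by (rule in_some_filtration)
    then have "\<forall>\<tau>\<in>uhp. tens V f v k \<tau> \<in> filtration V (int N)"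
      by (auto simp: filtration_iff hcomp_tens)
    then show "\<exists>N. \<forall>\<tau>\<in>uhp. tens V f v k \<tau> \<in> filtration V N" by blast
  next
    fix n \<phi> assume \<phi>: "functional \<phi>"
    show "(\<lambda>\<tau>. \<phi> (hcomp V (tens V f v k \<tau>) n)) \<in> modular_forms \<Gamma> (k - 2 * n)"
      using modular_forms_const_mult[OF fk[of "k - 2 * n"], of "\<phi> (hcomp V v n)"]
      by (simp add: hcomp_tens functional_scale[OF \<phi>] mult.commute)
  qed
  ultimately show ?thesis by (simp add: direct_sum_def)
qed

definition hbasis :: "int \<Rightarrow> 'v set" where
  "hbasis n = (SOME B. finite B \<and> independent B \<and> span B = hsp V n)"

lemma hbasis: "finite (hbasis n)" "independent (hbasis n)" "span (hbasis n) = hsp V n" "b \<in> hbasis n \<Longrightarrow> b \<in> hsp V n"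
proof -
  obtain S where S: "finite S" "span S = hsp V n" using hsp_finite_dim by blast
  obtain B where "finite B" "independent B" "span B = span S" by (rule finite_dim_basis[OF S(1)]) (rule that)
  then have "\<exists>B. finite B \<and> independent B \<and> span B = hsp V n" using S(2) by (intro exI[of _ B]) simp
  from someI_ex[OF this] show *: "finite (hbasis n)" "independent (hbasis n)" "span (hbasis n) = hsp V n"
    unfolding hbasis_def[symmetric] by auto
  show "b \<in> hbasis n \<Longrightarrow> b \<in> hsp V n" using span_base[of b "hbasis n"] *(3) by simp
qed

definition hcoord :: "int \<Rightarrow> 'v \<Rightarrow> 'v \<Rightarrow> complex" where
  "hcoord n = (SOME r. (\<forall>b. functional (r b)) \<and> (\<forall>b. \<forall>b'\<in>hbasis n. r b b' = (if b = b' then 1 else 0)) \<and>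
     (\<forall>v\<in>hsp V n. (\<Sum>b\<in>hbasis n. smul V (r b v) b) = v))"

lemma hcoord: "functional (hcoord n b)" "b' \<in> hbasis n \<Longrightarrow> hcoord n b b' = (if b = b' then 1 else 0)"
  "v \<in> hsp V n \<Longrightarrow> (\<Sum>b\<in>hbasis n. smul V (hcoord n b v) b) = v"
proof -
  obtain r where r: "\<And>b. functional (r b)" "\<And>b b'. b' \<in> hbasis n \<Longrightarrow> r b b' = (if b = b' then 1 else 0)"
    "\<And>v. finite (hbasis n) \<Longrightarrow> v \<in> span (hbasis n) \<Longrightarrow> (\<Sum>b\<in>hbasis n. smul V (r b v) b) = v"
    by (rule coordinate_functionals[OF hbasis(2)[of n]]) (rule that)
  have "(\<Sum>b\<in>hbasis n. smul V (r b v) b) = v" if "v \<in> hsp V n" for v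
    using r(3)[OF hbasis(1), of v] that by (simp only: hbasis(3))
  with r(1,2) have "\<exists>r. (\<forall>b. functional (r b)) \<and> (\<forall>b. \<forall>b'\<in>hbasis n. r b b' = (if b = b' then 1 else 0)) \<and>
     (\<forall>v\<in>hsp V n. (\<Sum>b\<in>hbasis n. smul V (r b v) b) = v)" by (intro exI[of _ r]) auto
  from someI_ex[OF this, folded hcoord_def] show "functional (hcoord n b)"
    "b' \<in> hbasis n \<Longrightarrow> hcoord n b b' = (if b = b' then 1 else 0)"
    "v \<in> hsp V n \<Longrightarrow> (\<Sum>b\<in>hbasis n. smul V (hcoord n b v) b) = v" by auto
qed

lemma tensor_forms_decomposition:
  assumes u: "u \<in> tensor_forms k"
  obtains N where "\<And>\<tau>. u \<tau> \<in> filtration V N"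
    "\<And>\<tau>. u \<tau> = (\<Sum>n\<in>{0..N}. \<Sum>b\<in>hbasis n. smul V (hcoord n b (hcomp V (u \<tau>) n)) b)"
    "\<And>n b. (\<lambda>\<tau>. hcoord n b (hcomp V (u \<tau>) n)) \<in> modular_forms \<Gamma> (k - 2 * n)"
proof -
  obtain N where N0: "\<And>\<tau>. \<tau> \<in> uhp \<Longrightarrow> u \<tau> \<in> filtration V N" using u unfolding tensor_forms_def by blast
  have N: "u \<tau> \<in> filtration V N" for \<tau>
  proof (cases "\<tau> \<in> uhp")
    case False
    then have "u \<tau> = 0" using u by (simp add: tensor_forms_def)
    then show ?thesis by (simp add: filtration_iff)
  qed (rule N0)
  show ?thesis
  proof (rule that[OF N])
    fix \<tau>
    show "u \<tau> = (\<Sum>n\<in>{0..N}. \<Sum>b\<in>hbasis n. smul V (hcoord n b (hcomp V (u \<tau>) n)) b)"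
      using sum_hcomp_filtration[OF N[of \<tau>]] hcoord(3)[OF hcomp_props(1)] by simp
  next
    fix n b
    show "(\<lambda>\<tau>. hcoord n b (hcomp V (u \<tau>) n)) \<in> modular_forms \<Gamma> (k - 2 * n)"
      using u hcoord(1) unfolding tensor_forms_def by blast
  qed
qed

text \<open>A family is a finite sum of families concentrated in one weight; such a family is expanded in bases of the
\<open>V\<^sub>n\<close>, with coordinates that are scalar modular forms placed in weight \<open>k - 2n\<close>.\<close>

theorem tensor_module_eq: "tensor_module V \<Gamma> = direct_sum tensor_forms"
proof
  interpret fam: vector_space "famscale V" by (rule vector_space_famscale)
  show "tensor_module V \<Gamma> \<subseteq> direct_sum tensor_forms"
    unfolding tensor_module_def
    by (rule fam.span_minimal[OF _ direct_sum_subspace]) (use tens_in_direct_sum in auto)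
  show "direct_sum tensor_forms \<subseteq> tensor_module V \<Gamma>"
  proof
    fix F assume F: "F \<in> direct_sum tensor_forms"
    let ?single = "\<lambda>k (x :: complex \<Rightarrow> 'v) l. if l = k then x else 0"
    let ?csingle = "\<lambda>k (x :: complex \<Rightarrow> complex) l. if l = k then x else 0"
    define K where "K = {k. F k \<noteq> 0}"
    have K: "finite K" using F by (simp add: K_def direct_sum_def)
    have Fk: "F k \<in> tensor_forms k" for k using F by (simp add: direct_sum_def)
    have "F = (\<Sum>k\<in>K. ?single k (F k))"
    proof
      fix l
      have "(\<Sum>k\<in>K. ?single k (F k)) l = (\<Sum>k\<in>K. if l = k then F k else 0)" by (rule sum_fun_apply)
      also have "\<dots> = F l" using K by (auto simp: K_def)
      finally show "F l = (\<Sum>k\<in>K. ?single k (F k)) l" by simp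
    qed
    moreover have single: "?single k u \<in> tensor_module V \<Gamma>" if u: "u \<in> tensor_forms k" for k u
    proof -
      obtain N where "\<And>\<tau>. u \<tau> \<in> filtration V N" and N: "\<And>\<tau>. u \<tau> = (\<Sum>n\<in>{0..N}. \<Sum>b\<in>hbasis n. smul V (hcoord n b (hcomp V (u \<tau>) n)) b)"
        and m: "\<And>n b. (\<lambda>\<tau>. hcoord n b (hcomp V (u \<tau>) n)) \<in> modular_forms \<Gamma> (k - 2 * n)"
        by (rule tensor_forms_decomposition[OF u]) (rule that)
      let ?t = "\<lambda>n b. tens V (?csingle (k - 2 * n) (\<lambda>\<tau>. hcoord n b (hcomp V (u \<tau>) n))) b"
      have eq: "?single k u = (\<Sum>n\<in>{0..N}. \<Sum>b\<in>hbasis n. ?t n b)"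
      proof (intro ext)
        fix l \<tau>
        have "(\<Sum>n\<in>{0..N}. \<Sum>b\<in>hbasis n. ?t n b) l \<tau> = (\<Sum>n\<in>{0..N}. \<Sum>b\<in>hbasis n. ?t n b l \<tau>)"
          by (simp only: sum_fun_apply)
        also have "\<dots> = (\<Sum>n\<in>{0..N}. \<Sum>b\<in>hbasis n. if l = k then smul V (hcoord n b (hcomp V (u \<tau>) n)) b else 0)"
          by (intro sum.cong refl) (auto simp: tens_homogeneous[OF hbasis(4)])
        also have "\<dots> = (if l = k then u \<tau> else 0)" using N[of \<tau>] by simp
        finally show "?single k u l \<tau> = (\<Sum>n\<in>{0..N}. \<Sum>b\<in>hbasis n. ?t n b) l \<tau>" by simp
      qed
      have mem: "?csingle (k - 2 * n) (\<lambda>\<tau>. hcoord n b (hcomp V (u \<tau>) n)) \<in> modular_ring \<Gamma>" for n b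
      proof -
        have "{l. ?csingle (k - 2 * n) (\<lambda>\<tau>. hcoord n b (hcomp V (u \<tau>) n)) l \<noteq> 0} \<subseteq> {k - 2 * n}" by auto
        then have "finite {l. ?csingle (k - 2 * n) (\<lambda>\<tau>. hcoord n b (hcomp V (u \<tau>) n)) l \<noteq> 0}"
          by (rule finite_subset) simp
        then show ?thesis using m unfolding modular_ring_def direct_sum_def
          by (auto simp: zero_fun_def)
      qed
      have "?t n b \<in> fam_span {tens V f v | f v. f \<in> modular_ring \<Gamma>}" for n b
        by (rule fam.span_base) (use mem in blast)
      then show ?thesis unfolding tensor_module_def eq by (intro fam.span_sum)
    qed
    have "(\<Sum>k\<in>K. ?single k (F k)) \<in> tensor_module V \<Gamma>"
      unfolding tensor_module_def by (rule fam.span_sum) (rule single[OF Fk, unfolded tensor_module_def])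
    ultimately show "F \<in> tensor_module V \<Gamma>" by simp
  qed
qed

lemma Pmap_eq: "Pmap V E F k = expE (F k)"
  by (simp add: Pmap_def expE_def)

lemma Pmap_linear: "Vector_Spaces.linear (famscale V) (famscale V) (Pmap V E)"
  unfolding Vector_Spaces.linear_iff
  by (auto simp: vector_space_famscale Pmap_def fun_eq_iff pointwise_def exp_L1_add exp_L1_scale)

lemma expE_zero_iff: "expE u = 0 \<longleftrightarrow> u = 0"
proof -
  have "expE 0 = 0" "expE_inv 0 = 0" by (simp_all add: expE_def expE_inv_def fun_eq_iff)
  then show ?thesis by (metis expE_inverse(1))
qed

lemma Pmap_in_iff: "Pmap V E F \<in> vmodular_module V \<Gamma> \<longleftrightarrow> F \<in> tensor_module V \<Gamma>"
  unfolding vmodular_module_def tensor_module_eq direct_sum_def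
  by (simp add: Pmap_eq expE_modular_iff expE_zero_iff)

lemma Pmap_homogeneous_iff:
  "Pmap V E F \<in> homogeneous_part k (vmodular_module V \<Gamma>) \<longleftrightarrow> F \<in> homogeneous_part k (tensor_module V \<Gamma>)"
  unfolding homogeneous_part_def by (simp add: Pmap_in_iff Pmap_eq expE_zero_iff)

lemma Pmap_inverse:
  obtains Q where "\<And>F. Q (Pmap V E F) = F" "\<And>F. Pmap V E (Q F) = F"
proof (rule that[of "\<lambda>F k. expE_inv (F k)"])
  show "(\<lambda>k. expE_inv (Pmap V E F k)) = F" for F by (simp add: Pmap_eq)
  show "Pmap V E (\<lambda>k. expE_inv (F k)) = F" for F by (rule ext) (simp add: Pmap_eq)
qed

lemma Pmap_bij: "bij_betw (Pmap V E) (tensor_module V \<Gamma>) (vmodular_module V \<Gamma>)"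
proof -
  obtain Q where Q: "\<And>F. Q (Pmap V E F) = F" "\<And>F. Pmap V E (Q F) = F" using Pmap_inverse by blast
  show ?thesis by (rule bij_betw_byWitness[where f' = Q]) (use Q Pmap_in_iff in \<open>auto, metis\<close>)
qed

lemma Pmap_homogeneous: "Pmap V E ` homogeneous_part k (tensor_module V \<Gamma>) = homogeneous_part k (vmodular_module V \<Gamma>)"
proof -
  obtain Q where Q: "\<And>F. Q (Pmap V E F) = F" "\<And>F. Pmap V E (Q F) = F" using Pmap_inverse by blast
  show ?thesis
  proof (rule equalityI)
    show "Pmap V E ` homogeneous_part k (tensor_module V \<Gamma>) \<subseteq> homogeneous_part k (vmodular_module V \<Gamma>)"
      using Pmap_homogeneous_iff by blast
    show "homogeneous_part k (vmodular_module V \<Gamma>) \<subseteq> Pmap V E ` homogeneous_part k (tensor_module V \<Gamma>)"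
    proof
      fix G assume "G \<in> homogeneous_part k (vmodular_module V \<Gamma>)"
      then have "Q G \<in> homogeneous_part k (tensor_module V \<Gamma>)" using Pmap_homogeneous_iff[of "Q G" k] Q(2) by simp
      then show "G \<in> Pmap V E ` homogeneous_part k (tensor_module V \<Gamma>)" using Q(2) by (metis imageI)
    qed
  qed
qed

lemma ring_act_tensor_module:
  assumes g: "g \<in> modular_ring \<Gamma>" and F: "F \<in> tensor_module V \<Gamma>"
  shows "ring_act V g F \<in> tensor_module V \<Gamma>"
  unfolding tensor_module_eq
proof -
  have gm: "g m \<in> modular_forms \<Gamma> m" and fg: "finite {m. g m \<noteq> 0}" for m
    using g by (auto simp: modular_ring_def direct_sum_def)
  have Fk: "F k \<in> tensor_forms k" and fF: "finite {k. F k \<noteq> 0}" for k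
    using F by (auto simp: tensor_module_eq direct_sum_def)
  have "{k. ring_act V g F k \<noteq> 0} \<subseteq> (\<lambda>(m, l). m + l) ` ({m. g m \<noteq> 0} \<times> {l. F l \<noteq> 0})"
  proof
    fix k assume "k \<in> {k. ring_act V g F k \<noteq> 0}"
    then obtain \<tau> where "ring_act V g F k \<tau> \<noteq> 0" by (auto simp: fun_eq_iff)
    then have "(\<Sum>m | g m \<noteq> 0. smul V (g m \<tau>) (F (k - m) \<tau>)) \<noteq> 0" by (simp add: ring_act_def)
    then obtain m where "m \<in> {m. g m \<noteq> 0}" "smul V (g m \<tau>) (F (k - m) \<tau>) \<noteq> 0"
      by (rule sum.not_neutral_contains_not_neutral)
    then have m: "g m \<noteq> 0" "smul V (g m \<tau>) (F (k - m) \<tau>) \<noteq> 0" by auto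
    then have "F (k - m) \<noteq> 0" by auto
    then show "k \<in> (\<lambda>(m, l). m + l) ` ({m. g m \<noteq> 0} \<times> {l. F l \<noteq> 0})"
      using m(1) by (intro image_eqI[of _ _ "(m, k - m)"]) auto
  qed
  then have "finite {k. ring_act V g F k \<noteq> 0}" by (rule finite_subset) (use fg fF in auto)
  moreover have "ring_act V g F k \<in> tensor_forms k" for k
  proof -
    have "(\<lambda>\<tau>. smul V (g m \<tau>) (F (k - m) \<tau>)) \<in> tensor_forms k" for m
      using tensor_forms_mult[OF gm Fk, of m "k - m"] by simp
    then show ?thesis unfolding ring_act_def by (intro tensor_forms_sum fg)
  qed
  ultimately show "ring_act V g F \<in> direct_sum tensor_forms" by (simp add: direct_sum_def)
qed

lemma Pmap_ring_act: "Pmap V E (ring_act V g F) = ring_act V g (Pmap V E F)"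
  by (simp add: Pmap_def ring_act_def exp_L1_sum exp_L1_scale)

lemma Pmap_tens_explicit:
  assumes v: "v \<in> hsp V n"
  shows "Pmap V E (tens V f v) k \<tau> =
    Sum_any (\<lambda>r. smul V (1 / fact r * (- (2 * of_real pi * \<i> / 12)) ^ r * E \<tau> ^ r * f (k - 2 * n) \<tau>) ((L ^^ r) v))"
  unfolding Pmap_def tens_homogeneous[OF v] exp_L1_def L_pow_scale scale_scale power_mult_distrib
proof (rule arg_cong[where f = Sum_any], rule ext)
  fix r
  let ?c = "- (2 * complex_of_real pi * \<i> / 12)"
  have "?c ^ r * E \<tau> ^ r / fact r * f (k - 2 * n) \<tau> = 1 / fact r * ?c ^ r * E \<tau> ^ r * f (k - 2 * n) \<tau>"
    by (simp only: times_divide_eq_left times_divide_eq_right mult_1_left mult.assoc)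
  then show "smul V (?c ^ r * E \<tau> ^ r / fact r * f (k - 2 * n) \<tau>) ((L ^^ r) v) =
    smul V (1 / fact r * ?c ^ r * E \<tau> ^ r * f (k - 2 * n) \<tau>) ((L ^^ r) v)" by (simp only:)
qed

end

section \<open>Dimensions\<close>

context vector_space
begin

lemma edim_basis:
  assumes "finite B" "independent B" "span B = S"
  shows "edim scale S = enat (card B)"
  using assms dim_span_eq_card_independent[OF assms(2)] unfolding edim_def by auto

lemma edim_finite_basis:
  assumes "edim scale S \<noteq> \<infinity>"
  obtains B where "finite B" "independent B" "span B = S"
proof -
  obtain C where C: "finite C" "span C = S" using assms unfolding edim_def by (auto split: if_splits)
  obtain B where B: "B \<subseteq> span C" "independent B" "span C \<subseteq> span B" using basis_exists[of "span C"] by metis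
  have "finite B" using independent_span_bound[OF C(1) B(2,1)] by simp
  moreover have "span B = S" using B(1,3) C(2) span_minimal[OF B(1) subspace_span] by blast
  ultimately show ?thesis using that B by blast
qed

lemma edim_subspace_infinite:
  assumes "subspace A" "A \<subseteq> S" "edim scale A = \<infinity>"
  shows "edim scale S = \<infinity>"
proof (rule ccontr)
  assume "edim scale S \<noteq> \<infinity>"
  then obtain C where C: "finite C" "span C = S" by (rule edim_finite_basis) (rule that)
  obtain B where B: "B \<subseteq> A" "independent B" "A \<subseteq> span B" using basis_exists[of A] by metis
  have "finite B" using independent_span_bound[OF C(1) B(2)] B(1) assms(2) C(2) by auto
  moreover have "span B = A" using B(1,3) span_minimal[OF B(1) assms(1)] by blast
  ultimately show False using edim_basis[of B A] B(2) assms(3) by simp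
qed

lemma edim_direct_sum:
  assumes A: "subspace A" and B: "subspace B" and AB: "A \<inter> B \<subseteq> {0}"
  shows "edim scale {a + b | a b. a \<in> A \<and> b \<in> B} = edim scale A + edim scale B"
proof -
  let ?S = "{a + b | a b. a \<in> A \<and> b \<in> B}"
  have sub: "A \<subseteq> ?S" "B \<subseteq> ?S"
    using subspace_0[OF A] subspace_0[OF B] by force+
  show ?thesis
  proof (cases "edim scale A = \<infinity> \<or> edim scale B = \<infinity>")
    case True
    then have "edim scale ?S = \<infinity>" using edim_subspace_infinite[OF A sub(1)] edim_subspace_infinite[OF B sub(2)] by blast
    then show ?thesis using True by auto
  next
    case False
    obtain X where X: "finite X" "independent X" "span X = A" using edim_finite_basis[of A] False by blast
    obtain Y where Y: "finite Y" "independent Y" "span Y = B" using edim_finite_basis[of B] False by blast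
    have disj: "X \<inter> Y = {}"
    proof -
      have "X \<inter> Y \<subseteq> {0}" using span_superset[of X] span_superset[of Y] X(3) Y(3) AB by blast
      moreover have "0 \<notin> X" using X(2) dependent_zero by blast
      ultimately show ?thesis by blast
    qed
    have ind: "independent (X \<union> Y)"
    proof (rule independent_if_scalars_zero)
      fix f x assume s: "(\<Sum>x\<in>X \<union> Y. scale (f x) x) = 0" and x: "x \<in> X \<union> Y"
      let ?a = "\<Sum>x\<in>X. scale (f x) x" and ?b = "\<Sum>x\<in>Y. scale (f x) x"
      have ab: "?a + ?b = 0" using s X(1) Y(1) disj by (simp add: sum.union_disjoint)
      have a: "?a \<in> A" unfolding X(3)[symmetric] by (intro span_sum span_scale span_base)
      have b: "?b \<in> B" unfolding Y(3)[symmetric] by (intro span_sum span_scale span_base)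
      have "?a = - ?b" using ab by (simp add: eq_neg_iff_add_eq_0)
      then have "?a \<in> B" using subspace_neg[OF B b] by simp
      then have a0: "?a = 0" using a AB by blast
      then have b0: "?b = 0" using ab by simp
      show "f x = 0"
      proof (cases "x \<in> X")
        case True
        show ?thesis by (rule independentD[OF X(2,1) subset_refl a0 True])
      next
        case False
        then have "x \<in> Y" using x by blast
        show ?thesis by (rule independentD[OF Y(2,1) subset_refl b0 \<open>x \<in> Y\<close>])
      qed
    qed (use X Y in simp)
    have "span (X \<union> Y) = ?S" unfolding span_Un X(3) Y(3) by blast
    then show ?thesis
      using edim_basis[OF X] edim_basis[OF Y] edim_basis[OF _ ind] X(1) Y(1) disj by (simp add: card_Un_disjoint)
  qed
qed

lemma edim_zero: "edim scale {0} = 0"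
  using edim_basis[of "{}" "{0}"] by (simp add: independent_empty zero_enat_def)

end

lemma edim_linear_image:
  assumes lin: "Vector_Spaces.linear s1 s2 f" and S: "module.subspace s1 S" and inj: "inj_on f S"
  shows "edim s2 (f ` S) = edim s1 S"
proof -
  interpret l: Vector_Spaces.linear s1 s2 f by (rule lin)
  show ?thesis
  proof (cases "edim s1 S = \<infinity>")
    case False
    obtain B where B: "finite B" "l.vs1.independent B" "l.vs1.span B = S"
      using l.vs1.edim_finite_basis[OF False] by blast
    have BS: "B \<subseteq> S" using l.vs1.span_superset[of B] B(3) by simp
    have "l.vs2.independent (f ` B)"
      using l.independent_inj_on_image[OF B(2)] inj B(3) by simp
    moreover have "l.vs2.span (f ` B) = f ` S" by (simp add: l.span_image B(3))
    moreover have "card (f ` B) = card B" using inj BS by (intro card_image) (rule inj_on_subset)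
    ultimately show ?thesis
      using l.vs1.edim_basis[OF B] l.vs2.edim_basis[of "f ` B" "f ` S"] B(1) by simp
  next
    case True
    have "edim s2 (f ` S) = \<infinity>"
    proof (rule ccontr)
      assume "edim s2 (f ` S) \<noteq> \<infinity>"
      then obtain C where C: "finite C" "l.vs2.independent C" "l.vs2.span C = f ` S"
        using l.vs2.edim_finite_basis by blast
      obtain B where B: "B \<subseteq> S" "l.vs1.independent B" "S \<subseteq> l.vs1.span B" using l.vs1.basis_exists[of S] by metis
      have sp: "l.vs1.span B = S" using B l.vs1.span_minimal[OF B(1) S] by blast
      have "l.vs2.independent (f ` B)"
        using l.independent_inj_on_image[OF B(2)] inj sp by simp
      moreover have "f ` B \<subseteq> l.vs2.span C" using B(1) C(3) by auto
      ultimately have "finite (f ` B)" using l.vs2.independent_span_bound[OF C(1)] by blast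
      then have "finite B" using inj_on_subset[OF inj B(1)] by (rule finite_imageD)
      then show False using l.vs1.edim_basis[OF _ B(2) sp] True by simp
    qed
    then show ?thesis using True by simp
  qed
qed

text \<open>The dimension of an internal direct sum of copies of the spaces \<open>S i\<close>, in a form that allows
infinite-dimensional summands.\<close>

lemma edim_sum_of_images:
  assumes lin: "\<And>i. i \<in> I \<Longrightarrow> Vector_Spaces.linear s1 s2 (\<iota> i)" and S: "\<And>i. i \<in> I \<Longrightarrow> module.subspace s1 (S i)"
    and v2: "vector_space s2" and I: "finite I"
    and inj: "\<And>x i. (\<And>j. j \<in> I \<Longrightarrow> x j \<in> S j) \<Longrightarrow> (\<Sum>j\<in>I. \<iota> j (x j)) = 0 \<Longrightarrow> i \<in> I \<Longrightarrow> x i = 0"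
  shows "edim s2 {\<Sum>i\<in>I. \<iota> i (x i) | x. \<forall>i\<in>I. x i \<in> S i} = (\<Sum>i\<in>I. edim s1 (S i))"
proof -
  interpret v2: vector_space s2 by (rule v2)
  have zero: "\<iota> i 0 = 0" "\<iota> i (x + y) = \<iota> i x + \<iota> i y" "\<iota> i (s1 c x) = s2 c (\<iota> i x)" if "i \<in> I" for i x y c
  proof -
    interpret l: Vector_Spaces.linear s1 s2 "\<iota> i" by (rule lin[OF that])
    show "\<iota> i 0 = 0" "\<iota> i (x + y) = \<iota> i x + \<iota> i y" "\<iota> i (s1 c x) = s2 c (\<iota> i x)" by (rule l.zero l.add l.scale)+
  qed
  have S0: "0 \<in> S i" "x \<in> S i \<Longrightarrow> y \<in> S i \<Longrightarrow> x + y \<in> S i" "x \<in> S i \<Longrightarrow> s1 c x \<in> S i" if "i \<in> I" for i x y c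
  proof -
    interpret l: Vector_Spaces.linear s1 s2 "\<iota> i" by (rule lin[OF that])
    show "0 \<in> S i" "x \<in> S i \<Longrightarrow> y \<in> S i \<Longrightarrow> x + y \<in> S i" "x \<in> S i \<Longrightarrow> s1 c x \<in> S i"
      using l.vs1.subspace_0 l.vs1.subspace_add l.vs1.subspace_scale S[OF that] by blast+
  qed
  define T where "T J = {\<Sum>i\<in>J. \<iota> i (x i) | x. \<forall>i\<in>J. x i \<in> S i}" for J
  have TI: "(\<Sum>i\<in>J. \<iota> i (x i)) \<in> T J" if "\<forall>i\<in>J. x i \<in> S i" for J x
    using that unfolding T_def by blast
  have T_sub: "v2.subspace (T J)" if J: "J \<subseteq> I" for J
  proof (rule v2.subspaceI)
    have "(\<Sum>i\<in>J. \<iota> i 0) = 0" by (rule sum.neutral) (use zero(1) J in blast)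
    then show "0 \<in> T J" unfolding T_def
      using S0(1) J by (intro CollectI exI[of _ "\<lambda>_. 0"]) auto
  next
    fix u w assume "u \<in> T J" "w \<in> T J"
    then obtain x y where x: "u = (\<Sum>i\<in>J. \<iota> i (x i))" "\<forall>i\<in>J. x i \<in> S i" and y: "w = (\<Sum>i\<in>J. \<iota> i (y i))" "\<forall>i\<in>J. y i \<in> S i"
      unfolding T_def by blast
    have "u + w = (\<Sum>i\<in>J. \<iota> i (x i + y i))"
      unfolding x(1) y(1) sum.distrib[symmetric] by (intro sum.cong refl) (use zero(2) J in auto)
    moreover have "(\<Sum>i\<in>J. \<iota> i (x i + y i)) \<in> T J" by (rule TI) (use x(2) y(2) S0(2) J in blast)
    ultimately show "u + w \<in> T J" by simp
  next
    fix c u assume "u \<in> T J"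
    then obtain x where x: "u = (\<Sum>i\<in>J. \<iota> i (x i))" "\<forall>i\<in>J. x i \<in> S i" unfolding T_def by blast
    have "s2 c u = (\<Sum>i\<in>J. \<iota> i (s1 c (x i)))"
      unfolding x(1) v2.scale_sum_right by (intro sum.cong refl) (use zero(3) J in auto)
    moreover have "(\<Sum>i\<in>J. \<iota> i (s1 c (x i))) \<in> T J" by (rule TI) (use x(2) S0(3) J in blast)
    ultimately show "s2 c u \<in> T J" by simp
  qed
  have "edim s2 (T J) = (\<Sum>i\<in>J. edim s1 (S i))" if "J \<subseteq> I" for J
    using finite_subset[OF that I] that
  proof (induction J rule: finite_induct)
    case empty
    have "T {} = {0}" by (auto simp: T_def)
    then show ?case using v2.edim_zero by simp
  next
    case (insert j J)
    have jI: "j \<in> I" "J \<subseteq> I" using insert by auto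
    interpret l: Vector_Spaces.linear s1 s2 "\<iota> j" by (rule lin[OF jI(1)])
    have jinj: "inj_on (\<iota> j) (S j)"
    proof (rule l.inj_on_iff_eq_0[OF S[OF jI(1)], THEN iffD2], intro ballI impI)
      fix x assume x: "x \<in> S j" "\<iota> j x = 0"
      have "(\<Sum>i\<in>I. \<iota> i (if i = j then x else 0)) = (\<Sum>i\<in>I. if i = j then \<iota> j x else 0)"
        by (intro sum.cong refl) (auto simp: zero(1))
      also have "\<dots> = 0" using x I by simp
      finally have "(if j = j then x else 0) = 0"
        by (intro inj[where x = "\<lambda>i. if i = j then x else 0"]) (use x jI S0(1) in auto)
      then show "x = 0" by simp
    qed
    have eq: "T (insert j J) = {a + b | a b. a \<in> \<iota> j ` S j \<and> b \<in> T J}"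
    proof (intro equalityI subsetI)
      fix u assume "u \<in> T (insert j J)"
      then obtain x where x: "u = (\<Sum>i\<in>insert j J. \<iota> i (x i))" "\<forall>i\<in>insert j J. x i \<in> S i" unfolding T_def by blast
      then have "u = \<iota> j (x j) + (\<Sum>i\<in>J. \<iota> i (x i))" using insert by simp
      moreover have "(\<Sum>i\<in>J. \<iota> i (x i)) \<in> T J" using x(2) unfolding T_def by blast
      ultimately show "u \<in> {a + b | a b. a \<in> \<iota> j ` S j \<and> b \<in> T J}" using x(2) by blast
    next
      fix u assume "u \<in> {a + b | a b. a \<in> \<iota> j ` S j \<and> b \<in> T J}"
      then obtain y x where u: "u = \<iota> j y + (\<Sum>i\<in>J. \<iota> i (x i))" "y \<in> S j" "\<forall>i\<in>J. x i \<in> S i" unfolding T_def by blast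
      let ?x = "x(j := y)"
      have "(\<Sum>i\<in>J. \<iota> i (x i)) = (\<Sum>i\<in>J. \<iota> i (?x i))" by (intro sum.cong refl) (use insert in auto)
      then have "u = (\<Sum>i\<in>insert j J. \<iota> i (?x i))" using u insert by simp
      moreover have "\<forall>i\<in>insert j J. ?x i \<in> S i" using u by auto
      ultimately show "u \<in> T (insert j J)" unfolding T_def by blast
    qed
    have disj: "\<iota> j ` S j \<inter> T J \<subseteq> {0}"
    proof
      fix u assume "u \<in> \<iota> j ` S j \<inter> T J"
      then obtain y x where u: "u = \<iota> j y" "y \<in> S j" "u = (\<Sum>i\<in>J. \<iota> i (x i))" "\<forall>i\<in>J. x i \<in> S i" unfolding T_def by blast
      \<comment> \<open>An element in both subspaces would give a relation among the summands.\<close>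
      let ?z = "\<lambda>i. if i = j then s1 (- 1) y else if i \<in> J then x i else 0"
      have zS: "?z i \<in> S i" if "i \<in> I" for i
        using u(2,4) S0(1)[OF that] S0(3)[OF jI(1) u(2), of "- 1"] by auto
      have "(\<Sum>i\<in>I. \<iota> i (?z i)) = (\<Sum>i\<in>insert j J. \<iota> i (?z i))"
        using insert.prems I zero(1) by (intro sum.mono_neutral_right) auto
      also have "\<dots> = \<iota> j (s1 (- 1) y) + (\<Sum>i\<in>J. \<iota> i (?z i))" using insert by simp
      also have "(\<Sum>i\<in>J. \<iota> i (?z i)) = (\<Sum>i\<in>J. \<iota> i (x i))" by (intro sum.cong refl) (use insert in auto)
      also have "\<iota> j (s1 (- 1) y) + (\<Sum>i\<in>J. \<iota> i (x i)) = 0" unfolding u(3)[symmetric] zero(3)[OF jI(1)] u(1)[symmetric] by simp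
      finally have "?z j = 0" by (intro inj[OF zS]) (use jI in auto)
      then have "y = 0" by simp
      then show "u \<in> {0}" using u(1) zero(1)[OF jI(1)] by simp
    qed
    have sub: "v2.subspace (\<iota> j ` S j)" by (rule l.subspace_image[OF S[OF jI(1)]])
    have "edim s2 (T (insert j J)) = edim s2 (\<iota> j ` S j) + edim s2 (T J)"
      unfolding eq by (rule v2.edim_direct_sum[OF sub T_sub[OF jI(2)] disj])
    then show ?case using insert edim_linear_image[OF lin[OF jI(1)] S[OF jI(1)] jinj] by simp
  qed
  from this[OF subset_refl] show ?thesis unfolding T_def .
qed

context cft_voa_forms
begin

lemma vmodular_forms_eq_image: "vmodular_forms V \<Gamma> k = expE ` tensor_forms k"
proof (intro equalityI subsetI)
  fix f assume "f \<in> vmodular_forms V \<Gamma> k"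
  then have "expE_inv f \<in> tensor_forms k" using expE_modular_iff[of "expE_inv f" k] by simp
  then show "f \<in> expE ` tensor_forms k" by (intro image_eqI[of _ _ "expE_inv f"]) simp_all
qed (use expE_modular_iff in auto)

lemma vector_space_pw: "vector_space (pointwise (smul V))"
  by (intro vector_space_pointwise vector_space_axioms)

lemma tensor_forms_subspace: "module.subspace (pointwise (smul V)) (tensor_forms k)"
proof -
  interpret pw: vector_space "pointwise (smul V)" by (rule vector_space_pw)
  show ?thesis
    by (rule pw.subspaceI)
      (use tensor_forms_zero tensor_forms_add tensor_forms_scale in
        \<open>auto simp: zero_fun_def plus_fun_def pointwise_def\<close>)
qed

lemma edim_vmodular_forms: "edim (pointwise (smul V)) (vmodular_forms V \<Gamma> k) = edim (pointwise (smul V)) (tensor_forms k)"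
  unfolding vmodular_forms_eq_image
proof (rule edim_linear_image[OF _ tensor_forms_subspace])
  show "Vector_Spaces.linear (pointwise (smul V)) (pointwise (smul V)) expE"
    unfolding Vector_Spaces.linear_iff
    by (auto simp: vector_space_pw expE_def fun_eq_iff pointwise_def exp_L1_add exp_L1_scale)
  show "inj_on expE (tensor_forms k)" by (rule inj_onI) (metis expE_inverse(1))
qed

text \<open>The coordinates of the components with respect to bases of the \<open>V\<^sub>n\<close> identify the space
with a product of spaces of scalar forms of weight \<open>2K - 2n\<close>, one for each basis vector. The vanishing in
negative weight confines \<open>n\<close> to the range up to \<open>K\<close>.\<close>

theorem edim_tensor_forms:
  assumes vanish: "\<And>l f. l < 0 \<Longrightarrow> f \<in> modular_forms \<Gamma> l \<Longrightarrow> f = (\<lambda>_. 0)"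
  shows "edim (pointwise (smul V)) (tensor_forms (2 * int K)) =
    (\<Sum>i=0..K. edim (pointwise (*)) (modular_forms \<Gamma> (2 * int i)) * edim (smul V) (hsp V (int (K - i))))"
proof -
  let ?k = "2 * int K"
  define I where "I = (SIGMA n:{0..K}. hbasis (int n))"
  define \<iota> where "\<iota> = (\<lambda>(n :: nat, b) m. (\<lambda>\<tau> :: complex. smul V (m \<tau>) b :: 'v))"
  define S where "S = (\<lambda>(n, b :: 'v). modular_forms \<Gamma> (?k - 2 * int n))"
  have vc: "vector_space (pointwise ((*) :: complex \<Rightarrow> complex \<Rightarrow> complex) :: complex \<Rightarrow> (complex \<Rightarrow> complex) \<Rightarrow> _)"
    by (intro vector_space_pointwise) (unfold_locales, simp_all add: algebra_simps)
  interpret fc: vector_space "pointwise ((*) :: complex \<Rightarrow> complex \<Rightarrow> complex) :: complex \<Rightarrow> (complex \<Rightarrow> complex) \<Rightarrow> _"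
    by (rule vc)
  have Ifin: "finite I" unfolding I_def by (intro finite_SigmaI) (auto simp: hbasis)
  have subM: "fc.subspace (modular_forms \<Gamma> l)" for l
    by (rule fc.subspaceI)
      (use modular_forms_zero modular_forms_add modular_forms_const_mult in
        \<open>auto simp: zero_fun_def plus_fun_def pointwise_def\<close>)
  have b_forms: "(\<lambda>\<tau>. smul V (m \<tau>) b) \<in> tensor_forms ?k"
    if m: "m \<in> modular_forms \<Gamma> (?k - 2 * int n)" and b: "b \<in> hsp V (int n)" for m n b
  proof (rule tensor_formsI)
    show "\<tau> \<notin> uhp \<Longrightarrow> smul V (m \<tau>) b = 0" for \<tau> using m by (simp add: modular_forms_iff)
    show "smul V (m \<tau>) b \<in> filtration V (int n)" for \<tau>
      using hcomp_homogeneous[OF b] by (simp add: filtration_iff hcomp_scale)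
    fix n' \<phi> assume \<phi>: "functional \<phi>"
    have "(\<lambda>\<tau>. \<phi> (hcomp V (smul V (m \<tau>) b) n')) = (if n' = int n then (\<lambda>\<tau>. \<phi> b * m \<tau>) else (\<lambda>_. 0))"
      by (auto simp: hcomp_scale hcomp_homogeneous[OF b] functional_scale[OF \<phi>] functional_zero[OF \<phi>] mult.commute)
    then show "(\<lambda>\<tau>. \<phi> (hcomp V (smul V (m \<tau>) b) n')) \<in> modular_forms \<Gamma> (?k - 2 * n')"
      using modular_forms_const_mult[OF m, of "\<phi> b"] by auto
  qed
  have sumI: "(\<Sum>p\<in>I. g p) = (\<Sum>n\<in>{0..K}. \<Sum>b\<in>hbasis (int n). g (n, b))" for g :: "nat \<times> 'v \<Rightarrow> 'c::comm_monoid_add"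
    unfolding I_def by (subst sum.Sigma) (auto simp: hbasis)
  have T_eq: "tensor_forms ?k = {\<Sum>p\<in>I. \<iota> p (x p) | x. \<forall>p\<in>I. x p \<in> S p}"
  proof (intro equalityI subsetI)
    fix u assume u: "u \<in> tensor_forms ?k"
    have m: "(\<lambda>\<tau>. hcoord n b (hcomp V (u \<tau>) n)) \<in> modular_forms \<Gamma> (?k - 2 * n)" for n b
      using tensor_formsD(3)[OF u hcoord(1)] .
    \<comment> \<open>Components of weight \<open>n > K\<close> have coordinates of negative weight \<open>2K - 2n\<close>.\<close>
    have uK: "u \<tau> \<in> filtration V (int K)" for \<tau>
      unfolding filtration_iff
    proof (intro allI impI)
      fix n assume n: "n > int K"
      have "hcoord n b (hcomp V (u \<tau>) n) = 0" for b
        using vanish[OF _ m[of n b]] n by (simp add: fun_eq_iff)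
      then have "(\<Sum>b\<in>hbasis n. smul V (hcoord n b (hcomp V (u \<tau>) n)) b) = 0" by simp
      then show "hcomp V (u \<tau>) n = 0" using hcoord(3)[OF hcomp_props(1)] by metis
    qed
    define x where "x = (\<lambda>(n :: nat, b) \<tau>. hcoord (int n) b (hcomp V (u \<tau>) (int n)))"
    have "u = (\<Sum>p\<in>I. \<iota> p (x p))"
    proof
      fix \<tau>
      have "(\<Sum>p\<in>I. \<iota> p (x p)) \<tau> = (\<Sum>p\<in>I. \<iota> p (x p) \<tau>)" by (rule sum_fun_apply)
      also have "\<dots> = (\<Sum>n\<in>{0..K}. \<Sum>b\<in>hbasis (int n). smul V (hcoord (int n) b (hcomp V (u \<tau>) (int n))) b)"
        unfolding sumI by (simp add: \<iota>_def x_def)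
      also have "\<dots> = (\<Sum>n\<in>{0..K}. hcomp V (u \<tau>) (int n))"
        by (intro sum.cong refl hcoord hcomp_props)
      also have "\<dots> = (\<Sum>n\<in>{0..int K}. hcomp V (u \<tau>) n)"
        by (rule sum.reindex_bij_witness[of _ nat int]) auto
      also have "\<dots> = u \<tau>" by (rule sum_hcomp_filtration[OF uK])
      finally show "u \<tau> = (\<Sum>p\<in>I. \<iota> p (x p)) \<tau>" by simp
    qed
    moreover have "\<forall>p\<in>I. x p \<in> S p" using m by (auto simp: x_def S_def)
    ultimately show "u \<in> {\<Sum>p\<in>I. \<iota> p (x p) | x. \<forall>p\<in>I. x p \<in> S p}" by blast
  next
    fix u assume "u \<in> {\<Sum>p\<in>I. \<iota> p (x p) | x. \<forall>p\<in>I. x p \<in> S p}"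
    then obtain x where x: "u = (\<Sum>p\<in>I. \<iota> p (x p))" "\<forall>p\<in>I. x p \<in> S p" by blast
    have "u = (\<lambda>\<tau>. \<Sum>p\<in>I. \<iota> p (x p) \<tau>)" unfolding x(1) by (rule ext) (rule sum_fun_apply)
    moreover have "\<iota> p (x p) \<in> tensor_forms ?k" if p: "p \<in> I" for p
    proof -
      obtain n b where nb: "p = (n, b)" "b \<in> hbasis (int n)" using p by (auto simp: I_def)
      have "x p \<in> modular_forms \<Gamma> (?k - 2 * int n)" using x(2) p nb by (auto simp: S_def)
      then have "(\<lambda>\<tau>. smul V (x p \<tau>) b) \<in> tensor_forms ?k" by (rule b_forms) (rule hbasis(4)[OF nb(2)])
      then show ?thesis by (simp add: \<iota>_def nb(1))
    qed
    ultimately show "u \<in> tensor_forms ?k" using tensor_forms_sum[OF Ifin] by simp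
  qed
  have "edim (pointwise (smul V)) (tensor_forms ?k) = (\<Sum>p\<in>I. edim (pointwise (*)) (S p))"
    unfolding T_eq
  proof (rule edim_sum_of_images)
    show "Vector_Spaces.linear (pointwise (*)) (pointwise (smul V)) (\<iota> p)" for p
      unfolding Vector_Spaces.linear_iff using vc vector_space_pw
      by (cases p) (auto simp: \<iota>_def fun_eq_iff pointwise_def scale_left_distrib)
    show "fc.subspace (S p)" for p by (cases p) (simp add: S_def subM)
    show "vector_space (pointwise (smul V))" by (rule vector_space_pw)
    show "finite I" by (rule Ifin)
  next
    fix x p assume z: "(\<Sum>j\<in>I. \<iota> j (x j)) = 0" and p: "p \<in> I"
    obtain n0 b0 where nb: "p = (n0, b0)" "b0 \<in> hbasis (int n0)" "n0 \<in> {0..K}" using p by (auto simp: I_def)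
    show "x p = 0"
    proof
      fix \<tau>
      have "(\<Sum>n\<in>{0..K}. \<Sum>b\<in>hbasis (int n). smul V (x (n, b) \<tau>) b) = (\<Sum>j\<in>I. \<iota> j (x j)) \<tau>"
        unfolding sum_fun_apply sumI by (simp add: \<iota>_def)
      also have "\<dots> = 0" by (simp add: z)
      finally have "hcoord (int n0) b0 (hcomp V (\<Sum>n\<in>{0..K}. \<Sum>b\<in>hbasis (int n). smul V (x (n, b) \<tau>) b) (int n0)) = 0"
        by (simp add: functional_zero[OF hcoord(1)])
      also have "hcomp V (\<Sum>n\<in>{0..K}. \<Sum>b\<in>hbasis (int n). smul V (x (n, b) \<tau>) b) (int n0)
        = (\<Sum>n\<in>{0..K}. if n = n0 then \<Sum>b\<in>hbasis (int n). smul V (x (n, b) \<tau>) b else 0)"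
        unfolding hcomp_sum hcomp_scale
      proof (rule sum.cong[OF refl])
        fix n
        have "hcomp V b (int n0) = (if n = n0 then b else 0)" if "b \<in> hbasis (int n)" for b
          using hcomp_homogeneous[OF hbasis(4)[OF that], of "int n0"] by auto
        then show "(\<Sum>b\<in>hbasis (int n). smul V (x (n, b) \<tau>) (hcomp V b (int n0))) =
          (if n = n0 then \<Sum>b\<in>hbasis (int n). smul V (x (n, b) \<tau>) b else 0)" by simp
      qed
      also have "\<dots> = (\<Sum>b\<in>hbasis (int n0). smul V (x (n0, b) \<tau>) b)" using nb(3) by simp
      also have "hcoord (int n0) b0 \<dots> = (\<Sum>b\<in>hbasis (int n0). x (n0, b) \<tau> * (if b0 = b then 1 else 0))"
        unfolding functional_sum[OF hcoord(1)] functional_scale[OF hcoord(1)]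
        by (intro sum.cong refl) (simp add: hcoord(2))
      also have "\<dots> = (\<Sum>b\<in>hbasis (int n0). if b0 = b then x (n0, b) \<tau> else 0)"
        by (intro sum.cong refl) simp
      also have "\<dots> = x p \<tau>" using nb(1,2) hbasis(1) by simp
      finally show "x p \<tau> = 0 \<tau>" by simp
    qed
  qed
  also have "\<dots> = (\<Sum>n\<in>{0..K}. edim (pointwise (*)) (modular_forms \<Gamma> (?k - 2 * int n)) * edim (smul V) (hsp V (int n)))"
    unfolding sumI
  proof (rule sum.cong[OF refl])
    fix n
    have "edim (smul V) (hsp V (int n)) = enat (card (hbasis (int n)))"
      by (rule edim_basis) (auto simp: hbasis)
    then show "(\<Sum>b\<in>hbasis (int n). edim (pointwise (*)) (S (n, b))) =
        edim (pointwise (*)) (modular_forms \<Gamma> (?k - 2 * int n)) * edim (smul V) (hsp V (int n))"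
      by (simp add: S_def of_nat_eq_enat mult.commute)
  qed
  also have "\<dots> = (\<Sum>i=0..K. edim (pointwise (*)) (modular_forms \<Gamma> (2 * int i)) * edim (smul V) (hsp V (int (K - i))))"
    by (rule sum.reindex_bij_witness[of _ "\<lambda>i. K - i" "\<lambda>i. K - i"]) (auto simp: of_nat_diff)
  finally show ?thesis .
qed

end

theorem theoremE:
  fixes \<Gamma> :: "(real^2^2) set"
    and V :: "'v::ab_group_add voa"
    and E :: "complex \<Rightarrow> complex"
  assumes "fuchsian_first_kind \<Gamma>"
    and "\<exists>\<sigma>. cusp_at \<Gamma> \<sigma>"
    and "vertex_operator_algebra V"
    and "cft_type V"
    and "quasimodular_E2 \<Gamma> E"
  shows "(\<forall>f\<in>modular_ring \<Gamma>. \<forall>n. \<forall>v\<in>hsp V n. \<forall>k. \<forall>\<tau>\<in>uhp.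
            Pmap V E (tens V f v) k \<tau> =
            Sum_any (\<lambda>r. smul V (1 / fact r * (- (2 * of_real pi * \<i> / 12)) ^ r * E \<tau> ^ r * f (k - 2 * n) \<tau>)
                           ((vir V 1 ^^ r) v)))
       \<and> Vector_Spaces.linear (famscale V) (famscale V) (Pmap V E)
       \<and> bij_betw (Pmap V E) (tensor_module V \<Gamma>) (vmodular_module V \<Gamma>)
       \<and> (\<forall>k. Pmap V E ` homogeneous_part k (tensor_module V \<Gamma>) =
               homogeneous_part k (vmodular_module V \<Gamma>))
       \<and> (\<forall>g\<in>modular_ring \<Gamma>. \<forall>F\<in>tensor_module V \<Gamma>.
            ring_act V g F \<in> tensor_module V \<Gamma> \<and>
            Pmap V E (ring_act V g F) = ring_act V g (Pmap V E F))
       \<and> (\<forall>k::nat. even k \<longrightarrow>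
            edim (pointwise (smul V)) (vmodular_forms V \<Gamma> (int k)) =
            (\<Sum>i=0..k div 2. edim (pointwise (*)) (modular_forms \<Gamma> (2 * int i))
                               * edim (smul V) (hsp V (int (k div 2 - i)))))"
proof -
  obtain D where "finite_covolume \<Gamma> D" using fuchsian_finite_covolume[OF assms(1)] .
  then interpret lat: finite_covolume \<Gamma> D .
  obtain \<sigma> where \<sigma>: "cusp_at \<Gamma> \<sigma>" using assms(2) by blast
  interpret vertex_operator_algebra V by (rule assms(3))
  interpret cft_voa_forms V \<Gamma> E by unfold_locales (rule assms(4), rule assms(5))
  have dim: "edim (pointwise (smul V)) (vmodular_forms V \<Gamma> (int k)) =
      (\<Sum>i=0..k div 2. edim (pointwise (*)) (modular_forms \<Gamma> (2 * int i)) * edim (smul V) (hsp V (int (k div 2 - i))))"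
    if "even k" for k :: nat
  proof -
    have k: "int k = 2 * int (k div 2)" using that by auto
    have "edim (pointwise (smul V)) (tensor_forms (2 * int (k div 2))) =
      (\<Sum>i=0..k div 2. edim (pointwise (*)) (modular_forms \<Gamma> (2 * int i)) * edim (smul V) (hsp V (int (k div 2 - i))))"
      by (rule edim_tensor_forms) (rule lat.modular_forms_negative_weight[OF \<sigma>])
    then show ?thesis by (simp only: edim_vmodular_forms k[symmetric])
  qed
  show ?thesis
    by (intro conjI ballI allI impI Pmap_tens_explicit Pmap_linear Pmap_bij Pmap_homogeneous
        ring_act_tensor_module Pmap_ring_act dim)
qed

end
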